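(* Let $A,B\in\mathcal{M}_3(\mathbb{C})$ be $3\times 3$ complex matrices. Then the following two conditions are equivalent: (i) there exists a finite subset $U\subset\{n\in\mathbb{N}: n\geq 2\}$ such that for every $t\in\mathbb{N}\setminus U$, $\exp(tA+B)=\exp(tA)\exp(B)=\exp(B)\exp(tA)$; (ii) $\exp(A+B)=\exp(A)\exp(B)=\exp(B)\exp(A)$ and the pair $(A,B)$ has property L.
   Context: $\mathbb{N}$ denotes the set of positive integers (so $0\notin\mathbb{N}$), and $\exp$ is the matrix exponential. Property L (Motzkin–Taussky): a pair $(A,B)\in\mathcal{M}_n(\mathbb{C})^2$ has property L if there exist orderings $(\lambda_i)_{i\leq n}$ and $(\mu_i)_{i\leq n}$ of the eigenvalues of $A$ and of $B$ respectively (listed with algebraic multiplicity) such that for all $(x,y)\in\mathbb{C}^2$ the eigenvalues of $xA+yB$, counted with algebraic multiplicity, are $(x\lambda_i+y\mu_i)_{i\leq n}$. *)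

theory Defs
  imports "HOL-Analysis.Analysis" "Jordan_Normal_Form.Char_Poly"
begin

text \<open>The matrix type of \<^theory>\<open>Jordan_Normal_Form.Matrix\<close> carries no topology, so the series
  $\sum_k A^k / k!$ is summed entrywise; \<open>mat_exp_summable\<close> below shows that every entry
  converges absolutely, so no \<^const>\<open>suminf\<close> of a divergent series is involved.\<close>

definition mat_exp :: "complex mat \<Rightarrow> complex mat" where
  "mat_exp A = mat (dim_row A) (dim_col A) (\<lambda>(i, j). \<Sum>k. (A ^\<^sub>m k) $$ (i, j) / fact k)"

lemma norm_pow_mat_entry_le:
  fixes A :: "complex mat"
  assumes A: "A \<in> carrier_mat n n"
    and M: "\<And>i j. i < n \<Longrightarrow> j < n \<Longrightarrow> norm (A $$ (i, j)) \<le> M"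
    and ij: "i < n" "j < n"
  shows "norm ((A ^\<^sub>m k) $$ (i, j)) \<le> (real n * M) ^ k"
  using ij
proof (induction k arbitrary: i j)
  case 0
  then show ?case using A by auto
next
  case (Suc k)
  have P: "A ^\<^sub>m k \<in> carrier_mat n n" using A by (rule pow_carrier_mat)
  have M0: "0 \<le> M" using M[OF Suc.prems] norm_ge_zero order_trans by blast
  have "(A ^\<^sub>m Suc k) $$ (i, j) = (\<Sum>l = 0..<n. (A ^\<^sub>m k) $$ (i, l) * A $$ (l, j))"
    using A P Suc.prems by (simp add: scalar_prod_def)
  also have "norm \<dots> \<le> (\<Sum>l = 0..<n. (real n * M) ^ k * M)"
    using Suc M M0 by (intro sum_norm_le) (auto simp: norm_mult intro!: mult_mono)
  also have "\<dots> = (real n * M) ^ Suc k" by (simp add: mult_ac)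
  finally show ?case .
qed

lemma mat_exp_summable:
  fixes A :: "complex mat"
  assumes A: "A \<in> carrier_mat n n" and ij: "i < n" "j < n"
  shows "summable (\<lambda>k. norm ((A ^\<^sub>m k) $$ (i, j) / fact k))"
proof -
  define M where "M = (\<Sum>p\<in>{..<n} \<times> {..<n}. norm (A $$ p))"
  have M: "norm (A $$ (i, j)) \<le> M" if "i < n" "j < n" for i j
    unfolding M_def using that by (intro member_le_sum) auto
  have "summable (\<lambda>k. (real n * M) ^ k / fact k)"
    using summable_exp[of "real n * M"] by (simp add: divide_inverse mult.commute)
  then show ?thesis
    by (rule summable_comparison_test')
      (use norm_pow_mat_entry_le[OF A M ij] in \<open>auto simp: norm_divide intro!: divide_right_mono\<close>)
qed

definition eigenvalues_mset :: "complex mat \<Rightarrow> complex multiset" where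
  "eigenvalues_mset A = proots (char_poly A)"

definition property_L :: "nat \<Rightarrow> complex mat \<Rightarrow> complex mat \<Rightarrow> bool" where
  "property_L n A B \<longleftrightarrow>
     (\<exists>ls ms. length ls = n \<and> length ms = n \<and>
        mset ls = eigenvalues_mset A \<and> mset ms = eigenvalues_mset B \<and>
        (\<forall>x y. eigenvalues_mset (x \<cdot>\<^sub>m A + y \<cdot>\<^sub>m B)
                 = mset (map (\<lambda>i. x * ls ! i + y * ms ! i) [0..<n])))"

end

theory Submission
  imports Defs "HOL-Real_Asymp.Real_Asymp"
begin

text \<open>
  For the implication from property L, let \<open>S = exp A\<close> and \<open>T = exp B\<close>. The spectral idempotents
  of \<open>S\<close> and \<open>T\<close> commute with both \<open>A\<close> and \<open>B\<close>, because \<open>A * T - T * A\<close> commutes with \<open>T\<close>. Splitting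
  off the logarithms \<open>N\<close>, \<open>M\<close> of the unipotent parts of \<open>S\<close> and \<open>T\<close> leaves \<open>D1 = A - N\<close> and
  \<open>D2 = B - M\<close> with diagonalizable exponentials, while \<open>t * N + M\<close> commutes with \<open>t * D1 + D2\<close> for
  every \<open>t\<close>. If the pairs of eigenvalues of property L are distinct, \<open>t * D1 + D2\<close> has simple
  spectrum for almost all \<open>t\<close>, and its eigenvectors are matched with the joint eigenspaces of the
  exponentials by letting \<open>t\<close> tend to infinity and to \<open>0\<close> in a polynomial identity. If two pairs
  coincide, \<open>D1\<close>, \<open>D2\<close> and \<open>D1 + D2\<close> are, up to adding scalars, multiples of idempotents, and the
  exponentials are explicit.

  For the converse, an eigenvalue of \<open>t * A + B\<close> is, modulo \<open>2 * pi * i\<close>, of the form \<open>t * l + m\<close> with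
  \<open>l\<close>, \<open>m\<close> from finite sets. A branch of the spectrum that is asymptotic to a line therefore meets
  that line infinitely often, hence coincides with it. This splits a linear factor off the
  characteristic polynomial, and a second such argument shows that the discriminant of the
  remaining quadratic factor is a square.
\<close>

section \<open>The Banach algebra of complex 3 by 3 matrices\<close>

text \<open>Exponentials merge eigenvalues of \<open>A\<close> that differ by a multiple of
  \<open>2 * pi * i\<close>, so \<open>A\<close> and \<open>B\<close> need not commute; only the
  coarser idempotents of \<open>exp A\<close> and \<open>exp B\<close> are available. The relation
  at \<open>t = 1\<close> controls the whole pencil: \<open>A + B\<close> commutes with
  \<open>exp D1\<close>, \<open>exp D2\<close> and \<open>exp (A + B)\<close>, hence with
  \<open>N + M\<close>. As \<open>A\<close> commutes with \<open>N\<close> and \<open>B\<close> with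
  \<open>M\<close>, the mixed term in the commutator of \<open>x * A + y * B\<close> and
  \<open>x * N + y * M\<close> vanishes, so these commute for all \<open>x\<close>,
  \<open>y\<close>. Dimension 3 enters twice. If two pairs coincide, at most two distinct ones
  remain, and a diagonalizable matrix is then annihilated by a quadratic. In the converse,
  \<open>A\<close> has either a simple eigenvalue, whose branch is asymptotic to a line by
  perturbation, or a triple one, where bounded real parts limit the growth of the centred branches.
  The pair \<open>(l, m)\<close> behind a branch may change with \<open>t\<close>; by pigeonhole one
  pair recurs at a fixed gap, and a convergent sequence of logarithms of one number eventually
  equals its limit.\<close>

typedef cmat3 = "carrier_mat 3 3 :: complex mat set" morphisms mat_of cmat
  by (rule exI[of _ "0\<^sub>m 3 3"]) simp

setup_lifting type_definition_cmat3

lift_definition entry :: "cmat3 \<Rightarrow> nat \<Rightarrow> nat \<Rightarrow> complex" is "\<lambda>M i j. M $$ (i, j)" .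

lemma cmat3_eqI: "(\<And>i j. i < 3 \<Longrightarrow> j < 3 \<Longrightarrow> entry X i j = entry Y i j) \<Longrightarrow> X = Y"
  by transfer (auto intro!: eq_matI)

instantiation cmat3 :: ring_1
begin
lift_definition zero_cmat3 :: cmat3 is "0\<^sub>m 3 3" by simp
lift_definition one_cmat3 :: cmat3 is "1\<^sub>m 3" by simp
lift_definition plus_cmat3 :: "cmat3 \<Rightarrow> cmat3 \<Rightarrow> cmat3" is "(+)" by simp
lift_definition minus_cmat3 :: "cmat3 \<Rightarrow> cmat3 \<Rightarrow> cmat3" is "(-)" by (rule minus_carrier_mat)
lift_definition uminus_cmat3 :: "cmat3 \<Rightarrow> cmat3" is "uminus" by simp
lift_definition times_cmat3 :: "cmat3 \<Rightarrow> cmat3 \<Rightarrow> cmat3" is "(*)" by simp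
instance
proof
  show "(0::cmat3) \<noteq> 1"
  proof transfer
    have "0\<^sub>m 3 3 $$ (0,0) \<noteq> (1\<^sub>m 3 $$ (0,0) :: complex)" by simp
    then show "0\<^sub>m 3 3 \<noteq> (1\<^sub>m 3 :: complex mat)" by metis
  qed
qed (transfer; auto simp: assoc_mult_mat[of _ 3 3 _ 3 _ 3] add_mult_distrib_mat[of _ 3 3 _ _ 3]
      mult_add_distrib_mat[of _ 3 3 _ 3] comm_add_mat intro!: eq_matI)+
end

lemma entry_simps [simp]:
  assumes "i < 3" "j < 3"
  shows "entry 0 i j = 0" "entry 1 i j = (if i = j then 1 else 0)"
    "entry (X + Y) i j = entry X i j + entry Y i j" "entry (X - Y) i j = entry X i j - entry Y i j"
    "entry (- X) i j = - entry X i j"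
  using assms by (transfer; auto)+

lemma entry_mult: "i < 3 \<Longrightarrow> j < 3 \<Longrightarrow> entry (X * Y) i j = (\<Sum>k<3. entry X i k * entry Y k j)"
  by transfer (auto simp: scalar_prod_def lessThan_atLeast0)

lemma mat_of_power: "mat_of (X ^ k) = mat_of X ^\<^sub>m k"
proof (induction k)
  case 0
  then show ?case using mat_of[of X] by (simp add: one_cmat3.rep_eq)
next
  case (Suc k)
  then show ?case by (simp only: pow_mat.simps power_Suc2 times_cmat3.rep_eq)
qed

text \<open>Complex scalars become central elements of the ring, so eigenvalue equations turn into
  identities between matrices.\<close>

lift_definition cs :: "complex \<Rightarrow> cmat3" is "\<lambda>z. z \<cdot>\<^sub>m 1\<^sub>m 3" by simp

lemma entry_cs [simp]: "i < 3 \<Longrightarrow> j < 3 \<Longrightarrow> entry (cs z) i j = (if i = j then z else 0)"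
  by transfer auto

lemma lessThan3: "{..<3::nat} = {0, 1, 2}" by auto

lemma less3_cases: "i < (3::nat) \<Longrightarrow> i = 0 \<or> i = 1 \<or> i = 2" by auto

lemma entry_cs_mult [simp]: "i < 3 \<Longrightarrow> j < 3 \<Longrightarrow> entry (cs z * X) i j = z * entry X i j"
  by (auto simp: entry_mult lessThan3 dest!: less3_cases)

lemma cs_simps [simp]:
  "cs 0 = 0" "cs 1 = 1"
  by (rule cmat3_eqI; simp)+

lemma cs_add: "cs (a + b) = cs a + cs b"
  and cs_diff: "cs (a - b) = cs a - cs b"
  and cs_minus: "cs (- a) = - cs a"
  and cs_mult: "cs (a * b) = cs a * cs b"
  by (rule cmat3_eqI; simp add: algebra_simps entry_mult lessThan3)+

lemma cs_power: "cs (a ^ n) = cs a ^ n"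
  by (induction n) (auto simp: cs_mult)

lemma cs_comm: "cs a * X = X * cs a"
  by (rule cmat3_eqI) (auto simp: entry_mult lessThan3 dest!: less3_cases)

lemma cs_left_comm: "X * (cs a * Y) = cs a * (X * Y)"
  by (metis cs_comm mult.assoc)

lemma cs_inverse: "a \<noteq> 0 \<Longrightarrow> cs (inverse a) * (cs a * X) = X" "a \<noteq> 0 \<Longrightarrow> cs a * (cs (inverse a) * X) = X"
  by (simp_all add: mult.assoc[symmetric] cs_mult[symmetric])

lemma cs_mult_eq_0_iff: "cs a * X = 0 \<longleftrightarrow> a = 0 \<or> X = 0"
  by (metis cs_inverse(1) cs_simps(1) mult_zero_left mult_zero_right)

section \<open>Norm and completeness\<close>

definition row_sum :: "cmat3 \<Rightarrow> nat \<Rightarrow> real" where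
  "row_sum X i = (\<Sum>j<3. cmod (entry X i j))"

instantiation cmat3 :: real_vector
begin
definition scaleR_cmat3 :: "real \<Rightarrow> cmat3 \<Rightarrow> cmat3" where "scaleR_cmat3 r X = cs (of_real r) * X"
instance
  by standard (simp_all add: scaleR_cmat3_def cs_add cs_mult distrib_left distrib_right mult.assoc)
end

instantiation cmat3 :: real_normed_vector
begin
text \<open>This is the operator norm for the maximum norm on vectors: it is submultiplicative and
  gives \<open>1\<close> the norm 1, as the class \<open>real_normed_algebra_1\<close>
  demands.\<close>

definition norm_cmat3 :: "cmat3 \<Rightarrow> real" where "norm_cmat3 X = Max (row_sum X ` {..<3})"
definition dist_cmat3 :: "cmat3 \<Rightarrow> cmat3 \<Rightarrow> real" where "dist_cmat3 X Y = norm (X - Y)"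
definition sgn_cmat3 :: "cmat3 \<Rightarrow> cmat3" where "sgn_cmat3 X = X /\<^sub>R norm X"
definition uniformity_cmat3_def:
  "(uniformity :: (cmat3 \<times> cmat3) filter) = (INF e\<in>{0 <..}. principal {(x, y). dist x y < e})"
definition open_cmat3 :: "cmat3 set \<Rightarrow> bool" where
  "open_cmat3 U \<longleftrightarrow> (\<forall>x\<in>U. eventually (\<lambda>(x', y). x' = x \<longrightarrow> y \<in> U) uniformity)"

lemma norm_cmat3_le_iff: "norm (X::cmat3) \<le> c \<longleftrightarrow> (\<forall>i<3. row_sum X i \<le> c)"
  unfolding norm_cmat3_def by (subst Max_le_iff) (auto simp: lessThan_empty_iff)

lemma row_sum_le_norm: "i < 3 \<Longrightarrow> row_sum X i \<le> norm X"
  unfolding norm_cmat3_def by (rule Max_ge) auto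

lemma cmod_entry_le_norm: "i < 3 \<Longrightarrow> j < 3 \<Longrightarrow> cmod (entry X i j) \<le> norm X"
proof -
  assume "i < 3" "j < 3"
  then have "cmod (entry X i j) \<le> row_sum X i"
    unfolding row_sum_def by (intro member_le_sum) auto
  with row_sum_le_norm[OF \<open>i < 3\<close>] show ?thesis by (rule order_trans[rotated]) 
qed

instance
proof
  fix X Y :: cmat3 and a b :: real
  show "sgn X = X /\<^sub>R norm X" by (rule sgn_cmat3_def)
  show "dist X Y = norm (X - Y)" by (rule dist_cmat3_def)
  show "uniformity = (INF e\<in>{0 <..}. principal {(x, y::cmat3). dist x y < e})"
    by (rule uniformity_cmat3_def)
  show "open U \<longleftrightarrow> (\<forall>x\<in>U. eventually (\<lambda>(x', y). x' = x \<longrightarrow> y \<in> U) uniformity)" for U :: "cmat3 set"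
    by (rule open_cmat3_def)
  show "norm X = 0 \<longleftrightarrow> X = 0"
  proof
    assume "norm X = 0"
    then have "entry X i j = 0" if "i < 3" "j < 3" for i j
      using cmod_entry_le_norm[OF that, of X] by simp
    then show "X = 0" by (intro cmat3_eqI) auto
  next
    assume "X = 0"
    then have "row_sum X ` {..<3} = {0}" by (auto simp: row_sum_def lessThan3)
    then show "norm X = 0" by (simp add: norm_cmat3_def)
  qed
  show "norm (X + Y) \<le> norm X + norm Y"
    unfolding norm_cmat3_le_iff
  proof (intro allI impI)
    fix i :: nat assume i: "i < 3"
    have "row_sum (X + Y) i \<le> row_sum X i + row_sum Y i"
      using i by (auto simp: row_sum_def sum.distrib[symmetric] intro!: sum_mono norm_triangle_ineq)
    then show "row_sum (X + Y) i \<le> norm X + norm Y"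
      using row_sum_le_norm[OF i, of X] row_sum_le_norm[OF i, of Y] by linarith
  qed
  show "norm (a *\<^sub>R X) = \<bar>a\<bar> * norm X"
  proof -
    have "row_sum (a *\<^sub>R X) i = \<bar>a\<bar> * row_sum X i" if "i < 3" for i
      using that by (simp add: row_sum_def scaleR_cmat3_def norm_mult sum_distrib_left)
    then have "row_sum (a *\<^sub>R X) ` {..<3} = (\<lambda>r. \<bar>a\<bar> * r) ` row_sum X ` {..<3}"
      by (auto simp: image_image)
    moreover have "Max ((\<lambda>r. \<bar>a\<bar> * r) ` row_sum X ` {..<3}) = \<bar>a\<bar> * Max (row_sum X ` {..<3})"
      by (rule mono_Max_commute[symmetric])
        (auto simp: lessThan_empty_iff bot_nat_def intro!: monoI mult_left_mono)
    ultimately show ?thesis by (simp add: norm_cmat3_def)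
  qed
qed
end

instance cmat3 :: real_normed_algebra_1
proof
  fix X Y :: cmat3 and a b :: real
  show "a *\<^sub>R X * Y = a *\<^sub>R (X * Y)" "X * a *\<^sub>R Y = a *\<^sub>R (X * Y)"
    by (simp_all add: scaleR_cmat3_def mult.assoc cs_left_comm)
  show "norm (X * Y) \<le> norm X * norm Y"
    unfolding norm_cmat3_le_iff
  proof (intro allI impI)
    fix i :: nat assume i: "i < 3"
    have "row_sum (X * Y) i \<le> (\<Sum>j<3. \<Sum>k<3. cmod (entry X i k) * cmod (entry Y k j))"
      using i unfolding row_sum_def by (intro sum_mono) (auto simp: entry_mult norm_mult intro!: sum_norm_le)
    also have "\<dots> = (\<Sum>k<3. cmod (entry X i k) * row_sum Y k)"
      by (subst sum.swap) (simp add: row_sum_def sum_distrib_left)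
    also have "\<dots> \<le> (\<Sum>k<3. cmod (entry X i k) * norm Y)"
      by (intro sum_mono mult_left_mono row_sum_le_norm) auto
    also have "\<dots> = row_sum X i * norm Y" by (simp add: row_sum_def sum_distrib_right)
    also have "\<dots> \<le> norm X * norm Y"
      using row_sum_le_norm[OF i, of X] order_trans[OF norm_ge_zero cmod_entry_le_norm[of 0 0 Y]]
      by (intro mult_right_mono) auto
    finally show "row_sum (X * Y) i \<le> norm X * norm Y" .
  qed
  have "row_sum 1 ` {..<3} = {1}" by (auto simp: row_sum_def lessThan3)
  then show "norm (1::cmat3) = 1" by (simp add: norm_cmat3_def)
qed

lemma entry_scaleR [simp]: "i < 3 \<Longrightarrow> j < 3 \<Longrightarrow> entry (r *\<^sub>R X) i j = r *\<^sub>R entry X i j"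
  by (simp add: scaleR_cmat3_def scaleR_conv_of_real)

lemma bounded_linear_entry: "i < 3 \<Longrightarrow> j < 3 \<Longrightarrow> bounded_linear (\<lambda>X. entry X i j)"
  by (rule bounded_linear_intro[of _ 1]) (auto simp: cmod_entry_le_norm)

lemma norm_cmat3_le_sum: "norm (X::cmat3) \<le> (\<Sum>i<3. row_sum X i)"
proof -
  have "row_sum X i \<le> (\<Sum>i<3. row_sum X i)" if "i < 3" for i
    using that by (intro member_le_sum) (auto simp: row_sum_def sum_nonneg)
  then show ?thesis by (simp add: norm_cmat3_le_iff)
qed

instance cmat3 :: banach
proof
  fix X :: "nat \<Rightarrow> cmat3"
  assume X: "Cauchy X"
  have "\<exists>l. (\<lambda>n. entry (X n) i j) \<longlonglongrightarrow> l" if "i < 3" "j < 3" for i j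
    using bounded_linear.Cauchy[OF bounded_linear_entry[OF that] X] Cauchy_convergent convergent_def
    by blast
  then obtain l where l: "\<And>i j. i < 3 \<Longrightarrow> j < 3 \<Longrightarrow> (\<lambda>n. entry (X n) i j) \<longlonglongrightarrow> l i j" by metis
  define L where "L = cmat (Matrix.mat 3 3 (\<lambda>(i, j). l i j))"
  have L: "entry L i j = l i j" if "i < 3" "j < 3" for i j
    using that by (simp add: L_def entry.rep_eq cmat_inverse)
  have "(\<lambda>n. \<Sum>i<3. row_sum (X n - L) i) \<longlonglongrightarrow> (\<Sum>i<3::nat. \<Sum>j<3::nat. 0)"
    unfolding row_sum_def
  proof (intro tendsto_sum)
    fix i j :: nat assume ij: "i \<in> {..<3}" "j \<in> {..<3}"
    then have "(\<lambda>n. entry (X n) i j - l i j) \<longlonglongrightarrow> 0" using l[of i j] by (simp add: LIM_zero)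
    then show "(\<lambda>n. cmod (entry (X n - L) i j)) \<longlonglongrightarrow> 0"
      using ij L by (simp add: tendsto_norm_zero)
  qed
  then have "(\<lambda>n. \<Sum>i<3. row_sum (X n - L) i) \<longlonglongrightarrow> 0" by simp
  then have "(\<lambda>n. X n - L) \<longlonglongrightarrow> 0"
    by (rule Lim_null_comparison[rotated]) (auto simp: norm_cmat3_le_sum)
  then have "X \<longlonglongrightarrow> L" by (simp add: LIM_zero_iff)
  then show "convergent X" by (auto simp: convergent_def)
qed

text \<open>The bridge to the entrywise series: taking an entry is a bounded linear map, so it
  passes through the norm convergent series of \<open>exp\<close>.\<close>

lemma mat_of_exp: "mat_of (exp X) = mat_exp (mat_of X)"
proof (rule eq_matI)
  have c: "mat_of Y \<in> carrier_mat 3 3" for Y by (rule mat_of)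
  fix i j assume "i < dim_row (mat_exp (mat_of X))" "j < dim_col (mat_exp (mat_of X))"
  then have ij: "i < 3" "j < 3" using c[of X] by (auto simp: mat_exp_def)
  have pow: "entry (X ^ n) i j = (mat_of X ^\<^sub>m n) $$ (i, j)" for n
    by (simp add: entry.rep_eq mat_of_power)
  have "entry (exp X) i j = (\<Sum>n. entry (X ^ n /\<^sub>R fact n) i j)"
    unfolding exp_def by (rule bounded_linear.suminf[OF bounded_linear_entry[OF ij] summable_exp_generic])
  also have "\<dots> = (\<Sum>n. (mat_of X ^\<^sub>m n) $$ (i, j) / fact n)"
    using ij
    by (intro suminf_cong)
      (simp add: pow divide_inverse scaleR_conv_of_real[where 'a = complex] del: inverse_eq_divide)
  finally show "mat_of (exp X) $$ (i, j) = mat_exp (mat_of X) $$ (i, j)"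
    using ij c[of X] by (simp add: entry.rep_eq mat_exp_def)
next
  show "dim_row (mat_of (exp X)) = dim_row (mat_exp (mat_of X))"
    "dim_col (mat_of (exp X)) = dim_col (mat_exp (mat_of X))"
    using mat_of[of X] mat_of[of "exp X"] by (auto simp: mat_exp_def)
qed

section \<open>Characteristic polynomial and exponential\<close>

text \<open>Scalar matrices \<open>cs a\<close> commute with everything, but that law loops as a rewrite rule. Moving
  every scalar into \<open>sc\<close> instead gives the terminating rule set \<open>sc_ring\<close>.\<close>

definition sc :: "complex \<Rightarrow> cmat3 \<Rightarrow> cmat3" where
  "sc a X = cs a * X"

lemma sc_ring:
  "cs a * X = sc a X" "X * cs a = sc a X" "sc a (cs b) = cs (a * b)"
  "sc a X * Y = sc a (X * Y)" "X * sc a Y = sc a (X * Y)" "sc a (sc b X) = sc (a * b) X"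
  "sc a (X + Y) = sc a X + sc a Y" "sc a (X - Y) = sc a X - sc a Y" "sc a (- X) = - sc a X"
  "sc (a + b) X = sc a X + sc b X" "sc (a - b) X = sc a X - sc b X" "sc (- a) X = - sc a X"
  "sc 0 X = 0" "sc 1 X = X" "sc a 0 = 0" "sc a 1 = cs a"
  by (simp_all add: sc_def cs_add cs_diff cs_minus cs_mult distrib_left distrib_right
      left_diff_distrib right_diff_distrib mult.assoc cs_comm[of a X] cs_left_comm[of X a])

text \<open>\<open>e1\<close>, \<open>e2\<close>, \<open>e3\<close> are the trace, the sum of the
  principal 2 by 2 minors and the determinant, that is, the elementary symmetric functions of the
  eigenvalues.\<close>

definition e1 :: "cmat3 \<Rightarrow> complex" where
  "e1 X = entry X 0 0 + entry X 1 1 + entry X 2 2"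

definition e2 :: "cmat3 \<Rightarrow> complex" where
  "e2 X = (entry X 0 0 * entry X 1 1 - entry X 0 1 * entry X 1 0)
    + (entry X 0 0 * entry X 2 2 - entry X 0 2 * entry X 2 0)
    + (entry X 1 1 * entry X 2 2 - entry X 1 2 * entry X 2 1)"

definition e3 :: "cmat3 \<Rightarrow> complex" where
  "e3 X = entry X 0 0 * (entry X 1 1 * entry X 2 2 - entry X 1 2 * entry X 2 1)
    - entry X 0 1 * (entry X 1 0 * entry X 2 2 - entry X 1 2 * entry X 2 0)
    + entry X 0 2 * (entry X 1 0 * entry X 2 1 - entry X 1 1 * entry X 2 0)"

definition char_fun :: "cmat3 \<Rightarrow> complex \<Rightarrow> complex" where
  "char_fun X x = x ^ 3 - e1 X * x\<^sup>2 + e2 X * x - e3 X"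

lemma det_2x2:
  fixes M :: "'a :: comm_ring_1 mat"
  assumes "M \<in> carrier_mat 2 2"
  shows "det M = M $$ (0, 0) * M $$ (1, 1) - M $$ (0, 1) * M $$ (1, 0)"
proof -
  have "det M = (\<Sum>i<2. M $$ (i, 0) * cofactor M i 0)"
    using assms by (intro laplace_expansion_column) auto
  moreover have "det (mat_delete M i 0) = mat_delete M i 0 $$ (0, 0)" for i
    using assms by (intro det_single) (auto simp: mat_delete_def)
  ultimately have "det M = M $$ (0, 0) * mat_delete M 0 0 $$ (0, 0) - M $$ (1, 0) * mat_delete M 1 0 $$ (0, 0)"
    by (simp add: cofactor_def numeral_2_eq_2)
  then show ?thesis
    using assms by (simp add: mat_delete_def algebra_simps)
qed

lemma det_3x3:
  fixes M :: "'a :: comm_ring_1 mat"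
  assumes "M \<in> carrier_mat 3 3"
  shows "det M = M $$ (0, 0) * (M $$ (1, 1) * M $$ (2, 2) - M $$ (1, 2) * M $$ (2, 1))
    - M $$ (0, 1) * (M $$ (1, 0) * M $$ (2, 2) - M $$ (1, 2) * M $$ (2, 0))
    + M $$ (0, 2) * (M $$ (1, 0) * M $$ (2, 1) - M $$ (1, 1) * M $$ (2, 0))"
proof -
  have *: "det M = (\<Sum>i<3. M $$ (i, 0) * cofactor M i 0)"
    using assms by (intro laplace_expansion_column) auto
  have d: "det (mat_delete M i 0) = mat_delete M i 0 $$ (0, 0) * mat_delete M i 0 $$ (1, 1)
    - mat_delete M i 0 $$ (0, 1) * mat_delete M i 0 $$ (1, 0)" for i
    using assms by (intro det_2x2) (auto simp: mat_delete_def)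
  have "det M = M $$ (0, 0) * det (mat_delete M 0 0) - M $$ (1, 0) * det (mat_delete M 1 0)
    + M $$ (2, 0) * det (mat_delete M 2 0)"
    unfolding * by (simp add: lessThan3 cofactor_def)
  then show ?thesis
    using assms unfolding d
    by (simp add: mat_delete_def numeral_2_eq_2[symmetric] algebra_simps del: One_nat_def flip: One_nat_def)
qed

lemma mat_of_index: "mat_of X $$ (i, j) = entry X i j"
  by (simp add: entry.rep_eq)

lemma det_mat_of: "det (mat_of X) = e3 X"
  by (simp add: det_3x3[OF mat_of] e3_def entry.rep_eq)

lemma char_poly_mat_of: "char_poly (mat_of X) = [:- e3 X, e2 X, - e1 X, 1:]"
proof -
  have c: "mat_of X \<in> carrier_mat 3 3" by (rule mat_of)
  then show ?thesis
    unfolding char_poly_def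
    by (subst det_3x3) (auto simp: char_poly_matrix_def e1_def e2_def e3_def entry.rep_eq algebra_simps)
qed

lemma char_fun_eq_poly: "char_fun X x = poly (char_poly (mat_of X)) x"
  by (simp add: char_poly_mat_of char_fun_def algebra_simps power2_eq_square power3_eq_cube)

lemma char_fun_eq_e3: "char_fun X x = e3 (cs x - X)"
  by (simp add: char_fun_def e1_def e2_def e3_def algebra_simps power2_eq_square power3_eq_cube)

text \<open>A kernel vector is repeated as all three columns of \<open>V\<close>; conversely, some
  column of a nonzero \<open>V\<close> is a nonzero kernel vector.\<close>

lemma e3_eq_0_iff: "e3 Y = 0 \<longleftrightarrow> (\<exists>V. V \<noteq> 0 \<and> Y * V = 0)"
proof -
  have c: "mat_of X \<in> carrier_mat 3 3" for X by (rule mat_of)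
  have "(\<exists>v. v \<in> carrier_vec 3 \<and> v \<noteq> 0\<^sub>v 3 \<and> mat_of Y *\<^sub>v v = 0\<^sub>v 3) \<longleftrightarrow> (\<exists>V. V \<noteq> 0 \<and> Y * V = 0)"
  proof safe
    fix v :: "complex vec" assume v: "v \<in> carrier_vec 3" "v \<noteq> 0\<^sub>v 3" "mat_of Y *\<^sub>v v = 0\<^sub>v 3"
    define V where "V = cmat (Matrix.mat 3 3 (\<lambda>(i, j). v $ i))"
    have V: "entry V i j = v $ i" if "i < 3" "j < 3" for i j
      using that by (simp add: V_def entry.rep_eq cmat_inverse)
    obtain i where "i < 3" "v $ i \<noteq> 0"
      using v(1,2) by (metis carrier_vecD dim_vec eq_vecI index_zero_vec(1) zero_carrier_vec)
    then have "V \<noteq> 0" using V[of i i] by auto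
    moreover have "Y * V = 0"
    proof (rule cmat3_eqI)
      fix i j :: nat assume ij: "i < 3" "j < 3"
      have "entry (Y * V) i j = (mat_of Y *\<^sub>v v) $ i"
        using ij v(1) c[of Y] by (simp add: entry_mult V scalar_prod_def lessThan_atLeast0 mat_of_index)
      then show "entry (Y * V) i j = entry 0 i j" using v(3) ij by simp
    qed
    ultimately show "\<exists>V. V \<noteq> 0 \<and> Y * V = 0" by blast
  next
    fix V assume V: "V \<noteq> 0" "Y * V = 0"
    obtain i j where ij: "i < 3" "j < 3" "entry V i j \<noteq> 0"
      using V(1) cmat3_eqI[of V 0] by auto
    define v where "v = vec 3 (\<lambda>i. entry V i j)"
    have "mat_of Y *\<^sub>v v = 0\<^sub>v 3"
    proof (rule eq_vecI)
      fix k assume "k < dim_vec (0\<^sub>v 3 :: complex vec)"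
      then have k: "k < 3" by simp
      have "(mat_of Y *\<^sub>v v) $ k = entry (Y * V) k j"
        using ij k c[of Y] by (simp add: entry_mult v_def scalar_prod_def mat_of_index lessThan_atLeast0)
      then show "(mat_of Y *\<^sub>v v) $ k = 0\<^sub>v 3 $ k" using V k ij by simp
    qed (use c[of Y] in auto)
    moreover have "v \<noteq> 0\<^sub>v 3" using ij by (auto simp: v_def dest!: arg_cong[of _ _ "\<lambda>u. u $ i"])
    ultimately show "\<exists>v. v \<in> carrier_vec 3 \<and> v \<noteq> 0\<^sub>v 3 \<and> mat_of Y *\<^sub>v v = 0\<^sub>v 3"
      by (intro exI[of _ v]) (simp add: v_def)
  qed
  then show ?thesis by (simp add: det_mat_of flip: det_0_iff_vec_prod_zero[OF c])
qed

lemma char_fun_eq_0_iff: "char_fun X x = 0 \<longleftrightarrow> (\<exists>V. V \<noteq> 0 \<and> X * V = cs x * V)"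
  unfolding char_fun_eq_e3 e3_eq_0_iff by (auto simp: left_diff_distrib)

lemma Cayley_Hamilton3:
  assumes "e1 X = a + b + c" "e2 X = a * b + a * c + b * c" "e3 X = a * b * c"
  shows "(X - cs a) * (X - cs b) * (X - cs c) = 0"
proof -
  have "X * X * X - cs (e1 X) * (X * X) + cs (e2 X) * X - cs (e3 X) = 0"
  proof (rule cmat3_eqI)
    fix i j :: nat assume "i < 3" "j < 3"
    then have "i = 0 \<or> i = 1 \<or> i = 2" "j = 0 \<or> j = 1 \<or> j = 2" by auto
    then show "entry (X * X * X - cs (e1 X) * (X * X) + cs (e2 X) * X - cs (e3 X)) i j = entry 0 i j"
      by (elim disjE; simp add: entry_mult lessThan3 e1_def e2_def e3_def del: One_nat_def;
          simp add: algebra_simps del: One_nat_def)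
  qed
  moreover have "(X - cs a) * (X - cs b) * (X - cs c)
    = X * X * X - cs (a + b + c) * (X * X) + cs (a * b + a * c + b * c) * X - cs (a * b * c)"
    by (simp add: sc_ring algebra_simps cs_add)
  ultimately show ?thesis using assms by simp
qed

lemma char_fun_roots:
  "\<exists>a b c. e1 X = a + b + c \<and> e2 X = a * b + a * c + b * c \<and> e3 X = a * b * c
    \<and> (\<forall>x. char_fun X x = (x - a) * (x - b) * (x - c))"
proof -
  obtain as where as: "char_poly (mat_of X) = (\<Prod>a\<leftarrow>as. [:- a, 1:])" "length as = 3"
    using char_poly_factorized[OF mat_of] by blast
  then obtain a b c where "as = [a, b, c]"
    by (auto simp: numeral_3_eq_3 length_Suc_conv)
  with as have "[:- e3 X, e2 X, - e1 X, 1:] = [:- (a * b * c), a * b + a * c + b * c, - (a + b + c), 1:]"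
    by (simp add: char_poly_mat_of algebra_simps)
  then have "- e3 X = - (a * b * c)" "e2 X = a * b + a * c + b * c" "- e1 X = - (a + b + c)"
    by (simp_all only: pCons_eq_iff)
  then have "e1 X = a + b + c" "e2 X = a * b + a * c + b * c" "e3 X = a * b * c"
    by (simp_all only: neg_equal_iff_equal)
  moreover from this have "char_fun X x = (x - a) * (x - b) * (x - c)" for x
    by (simp add: char_fun_def algebra_simps power2_eq_square power3_eq_cube)
  ultimately show ?thesis by blast
qed

text \<open>Eigenvectors are represented by nonzero matrices (whose nonzero columns are eigenvectors in
  the usual sense), so that all computations stay inside one ring.\<close>

definition eigval :: "cmat3 \<Rightarrow> complex \<Rightarrow> bool" where
  "eigval X x \<longleftrightarrow> (\<exists>V. V \<noteq> 0 \<and> X * V = cs x * V)"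

text \<open>Apply \<open>Y - cs c\<close>, \<open>Y - cs b\<close>, \<open>Y - cs a\<close> to
  \<open>V\<close> in turn. The final result is 0 by Cayley-Hamilton, so the last nonzero
  intermediate matrix is an eigenvector of \<open>Y\<close>; by commutation it never leaves the
  eigenspace of \<open>X\<close>.\<close>

lemma common_eigen:
  assumes "X * Y = Y * X" "X * V = cs x * V" "V \<noteq> 0"
  obtains y W where "W \<noteq> 0" "X * W = cs x * W" "Y * W = cs y * W"
proof -
  obtain a b c where abc: "e1 Y = a + b + c" "e2 Y = a * b + a * c + b * c" "e3 Y = a * b * c"
    using char_fun_roots[of Y] by blast
  have inv: "X * ((Y - cs z) * W) = cs x * ((Y - cs z) * W)" if "X * W = cs x * W" for W z
  proof -
    have "X * (Y - cs z) = (Y - cs z) * X" using assms(1) by (simp add: sc_ring algebra_simps)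
    then have "X * ((Y - cs z) * W) = (Y - cs z) * (X * W)" by (metis mult.assoc)
    then show ?thesis by (simp add: that cs_left_comm)
  qed
  define V1 where "V1 = (Y - cs c) * V"
  define V2 where "V2 = (Y - cs b) * V1"
  have V12: "X * V1 = cs x * V1" "X * V2 = cs x * V2"
    unfolding V1_def V2_def by (intro inv assms(2))+
  have "(Y - cs a) * V2 = (Y - cs a) * (Y - cs b) * (Y - cs c) * V"
    unfolding V1_def V2_def by (simp only: mult.assoc)
  then have V3: "(Y - cs a) * V2 = 0" by (simp add: Cayley_Hamilton3[OF abc])
  show thesis
  proof (cases "V1 = 0")
    case True
    then show thesis using that[of V c] assms by (simp add: V1_def left_diff_distrib)
  next
    case V1: False
    show thesis
    proof (cases "V2 = 0")
      case True
      then show thesis using that[of V1 b] V1 V12 by (simp add: V2_def left_diff_distrib)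
    next
      case False
      then show thesis using that[of V2 a] V3 V12 by (simp add: left_diff_distrib)
    qed
  qed
qed

lemma e1_lincomb: "e1 (cs x * A + cs y * B) = x * e1 A + y * e1 B"
  by (simp add: e1_def algebra_simps)

lemma e2_lincomb:
  "e2 (cs x * A + cs y * B) = x\<^sup>2 * e2 A + x * y * (e2 (A + B) - e2 A - e2 B) + y\<^sup>2 * e2 B"
  by (simp add: e2_def algebra_simps power2_eq_square)

text \<open>Along the pencil the determinant is a binary cubic form; its two mixed coefficients are
  recovered from the values at \<open>A + B\<close> and \<open>A - B\<close>.\<close>

lemma e3_lincomb:
  obtains b c where "\<And>x y. e3 (cs x * A + cs y * B) = x ^ 3 * e3 A + x\<^sup>2 * y * b + x * y\<^sup>2 * c + y ^ 3 * e3 B"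
proof
  fix x y
  show "e3 (cs x * A + cs y * B) = x ^ 3 * e3 A + x\<^sup>2 * y * ((e3 (A + B) - e3 (A - B)) / 2 - e3 B)
     + x * y\<^sup>2 * ((e3 (A + B) + e3 (A - B)) / 2 - e3 A) + y ^ 3 * e3 B"
    by (simp add: e3_def field_simps power2_eq_square power3_eq_cube)
qed

section \<open>Exponentials of scalar, intertwined and nilpotent elements\<close>

lemma norm_cs: "norm (cs z) = cmod z"
proof -
  have "row_sum (cs z) ` {..<3} = {cmod z}" by (auto simp: row_sum_def lessThan3)
  then show ?thesis by (simp add: norm_cmat3_def)
qed

lemma cs_scaleR: "cs (r *\<^sub>R z) = r *\<^sub>R cs z"
  by (rule cmat3_eqI) simp

lemma exp_cs: "exp (cs z) = cs (exp z)"
proof -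
  have "bounded_linear cs"
    by (rule bounded_linear_intro[of _ 1]) (auto simp: cs_add cs_scaleR norm_cs)
  from bounded_linear.sums[OF this exp_converges[of z]]
  have "(\<lambda>n. cs z ^ n /\<^sub>R fact n) sums cs (exp z)" by (simp add: cs_scaleR cs_power)
  then show ?thesis using exp_converges[of "cs z"] sums_unique2 by blast
qed

text \<open>One statement covers eigenvectors (\<open>Y\<close> scalar) and commuting elements
  (\<open>X = Y\<close>).\<close>

lemma exp_intertwine:
  fixes X Y V :: "'a :: {real_normed_algebra_1, banach}"
  assumes "X * V = V * Y"
  shows "exp X * V = V * exp Y"
proof -
  have "X ^ n * V = V * Y ^ n" for n
    by (induction n) (simp_all add: assms mult.assoc power_Suc2, metis assms mult.assoc power_Suc2 power_Suc)
  then have "(\<lambda>n. V * (Y ^ n /\<^sub>R fact n)) sums (exp X * V)"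
    using bounded_linear.sums[OF bounded_linear_mult_left[of V] exp_converges[of X]] by simp
  then show ?thesis
    using bounded_linear.sums[OF bounded_linear_mult_right exp_converges[of Y]] sums_unique2 by blast
qed

lemma exp_eigen: "X * V = cs x * V \<Longrightarrow> exp X * V = cs (exp x) * V"
  using exp_intertwine[of X V "cs x"] by (simp add: exp_cs cs_comm)

lemma exp_of_nat_cs: "exp (cs (of_nat n) * X) = exp X ^ n"
proof (induction n)
  case (Suc n)
  have "exp (cs (of_nat (Suc n)) * X) = exp (X + cs (of_nat n) * X)"
    by (simp add: cs_add algebra_simps)
  also have "\<dots> = exp X * exp (cs (of_nat n) * X)"
    by (intro exp_add_commuting) (simp add: cs_left_comm mult.assoc)
  finally show ?case using Suc by simp
qed simp

text \<open>The square of \<open>X\<close> need only vanish on \<open>V\<close>, so this applies to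
  a generalized eigenvector of a shifted matrix that is not itself nilpotent.\<close>

lemma exp_mult_square_zero:
  fixes X V :: "'a :: {real_normed_algebra_1, banach}"
  assumes "X * (X * V) = 0"
  shows "exp X * V = V + X * V"
proof -
  have "X ^ n * V = 0" if "n \<notin> {..<2}" for n
  proof -
    have "X ^ n = X ^ (n - 2) * X ^ 2" using that
      by (metis le_add_diff_inverse2 lessThan_iff not_less power_add)
    then have "X ^ n = X ^ (n - 2) * X * X" by (simp add: power2_eq_square mult.assoc)
    then show ?thesis using assms by (simp add: mult.assoc)
  qed
  then have "(\<lambda>n. (X ^ n * V) /\<^sub>R fact n) sums (\<Sum>n<2. (X ^ n * V) /\<^sub>R fact n)"
    by (intro sums_finite) auto
  moreover have "(\<lambda>n. (X ^ n * V) /\<^sub>R fact n) sums (exp X * V)"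
    using bounded_linear.sums[OF bounded_linear_mult_left[of V] exp_converges[of X]] by simp
  ultimately show ?thesis using sums_unique2 by (fastforce simp: numeral_2_eq_2)
qed

lemma exp_cube_zero:
  fixes X :: "'a :: {real_normed_algebra_1, banach}"
  assumes "X * X * X = 0"
  shows "exp X = 1 + X + (X * X) /\<^sub>R 2"
proof -
  have "X ^ n = 0" if "n \<notin> {..<3}" for n
  proof -
    have "X ^ n = X ^ (n - 3) * X ^ 3" using that by (simp flip: power_add)
    then show ?thesis using assms by (simp add: power3_eq_cube)
  qed
  then have "(\<lambda>n. X ^ n /\<^sub>R fact n) sums (\<Sum>n<3. X ^ n /\<^sub>R fact n)"
    by (intro sums_finite) auto
  then show ?thesis
    using exp_converges[of X] sums_unique2
    by (fastforce simp: numeral_3_eq_3 power2_eq_square numeral_2_eq_2)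
qed

section \<open>Spectral idempotents and the unipotent part of an exponential\<close>

lemma commute_power: "X * Y = Y * X \<Longrightarrow> X ^ n * Y = Y * (X ^ n :: 'a :: monoid_mult)"
  by (rule power_commuting_commutes)

lemma sc_eq_0_iff: "sc a X = 0 \<longleftrightarrow> a = 0 \<or> X = 0"
  by (simp add: sc_def cs_mult_eq_0_iff)

lemma sc_sum: "sc a (sum f I) = (\<Sum>i\<in>I. sc a (f i))"
  by (simp add: sc_def sum_distrib_left)

lemma cs_commute: "X * cs a = cs a * X"
  by (simp add: sc_ring)

text \<open>On the kernel of a power of \<open>X\<close> the shift \<open>X + cs c\<close> is
  invertible: if \<open>W'\<close> solves the equation for \<open>X * Z\<close>, then
  \<open>(Z - W') / c\<close> solves it for \<open>Z\<close>. The commutation clause records that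
  \<open>W\<close> is built from \<open>X\<close> and \<open>Z\<close> alone.\<close>

lemma nilpotent_shift_solve:
  assumes "c \<noteq> 0" "X ^ k * Z = 0"
  shows "\<exists>W. (X + cs c) * W = Z \<and> X ^ k * W = 0 \<and>
    (\<forall>Y. Y * X = X * Y \<longrightarrow> Y * Z = Z * Y \<longrightarrow> Y * W = W * Y)"
  using assms(2)
proof (induction k arbitrary: Z)
  case 0
  then show ?case by (intro exI[of _ 0]) simp
next
  case (Suc k)
  have "X ^ k * (X * Z) = 0" using Suc.prems by (simp add: power_Suc2 mult.assoc del: power_Suc)
  from Suc.IH[OF this] obtain W where W: "(X + cs c) * W = X * Z" "X ^ k * W = 0"
    and comm: "\<And>Y. Y * X = X * Y \<Longrightarrow> Y * (X * Z) = X * Z * Y \<Longrightarrow> Y * W = W * Y" by blast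
  have "(X + cs c) * sc (1 / c) (Z - W) = sc (1 / c) ((X + cs c) * Z - (X + cs c) * W)"
    by (simp add: sc_ring right_diff_distrib)
  also have "(X + cs c) * Z - (X + cs c) * W = sc c Z"
    unfolding W(1) by (simp add: sc_ring distrib_right)
  also have "sc (1 / c) (sc c Z) = Z" using assms(1) by (simp add: sc_ring)
  finally have 1: "(X + cs c) * sc (1 / c) (Z - W) = Z" .
  have 2: "X ^ Suc k * sc (1 / c) (Z - W) = 0"
    using Suc.prems W(2) by (simp add: sc_ring right_diff_distrib mult.assoc)
  have 3: "Y * sc (1 / c) (Z - W) = sc (1 / c) (Z - W) * Y" if "Y * X = X * Y" "Y * Z = Z * Y" for Y
  proof -
    have "Y * (X * Z) = X * Z * Y" using that by (metis mult.assoc)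
    from comm[OF that(1) this] that(2) show ?thesis by (simp add: sc_ring algebra_simps)
  qed
  show ?case using 1 2 3 by blast
qed

text \<open>Peeling factors off the first kernel reduces to an eigenvector for
  \<open>\<alpha>\<close>, on which the second power acts as the nonzero scalar
  \<open>(\<alpha> - \<beta>) ^ m\<close>.\<close>

lemma coprime_kernels:
  assumes "\<alpha> \<noteq> \<beta>" "(X - cs \<alpha>) ^ k * Y = 0" "(X - cs \<beta>) ^ m * Y = 0"
  shows "Y = 0"
  using assms(2,3)
proof (induction k arbitrary: Y)
  case 0
  then show ?case by simp
next
  case (Suc k)
  have comm: "(X - cs \<beta>) * (X - cs \<alpha>) = (X - cs \<alpha>) * (X - cs \<beta>)"
    by (simp add: algebra_simps sc_ring)
  have "(X - cs \<alpha>) ^ k * ((X - cs \<alpha>) * Y) = 0"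
    using Suc.prems(1) by (simp add: power_Suc2 mult.assoc del: power_Suc)
  moreover have "(X - cs \<beta>) ^ m * ((X - cs \<alpha>) * Y) = 0"
    using Suc.prems(2) commute_power[OF comm, of m] by (metis mult.assoc mult_zero_right)
  ultimately have "(X - cs \<alpha>) * Y = 0" by (rule Suc.IH)
  then have "(X - cs \<beta>) * Y = sc (\<alpha> - \<beta>) Y" by (simp add: algebra_simps sc_ring)
  moreover define d where "d = \<alpha> - \<beta>"
  ultimately have eig: "(X - cs \<beta>) * Y = sc d Y" by simp
  have "(X - cs \<beta>) ^ m * Y = sc (d ^ m) Y"
    by (induction m) (simp_all add: sc_ring mult.assoc eig mult.commute)
  with Suc.prems(2) assms(1) show "Y = 0" by (simp add: sc_eq_0_iff d_def)
qed

text \<open>Induction on the list of roots, repetitions allowed. From a decomposition of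
  \<open>(S - cs r) * Y\<close>, the components for \<open>\<alpha> \<noteq> r\<close> are pulled
  back through \<open>S - cs r\<close>, which is invertible on them; the rest of \<open>Y\<close>
  belongs to \<open>r\<close>.\<close>

lemma generalized_eigen_decomposition:
  assumes "prod_list (map (\<lambda>r. S - cs r) rs) * Y = 0"
  shows "\<exists>E. Y = (\<Sum>\<alpha>\<in>set rs. E \<alpha>) \<and> (\<forall>\<alpha>\<in>set rs. (S - cs \<alpha>) ^ length rs * E \<alpha> = 0 \<and>
    (\<forall>Z. Z * S = S * Z \<longrightarrow> Z * Y = Y * Z \<longrightarrow> Z * E \<alpha> = E \<alpha> * Z))"
  using assms
proof (induction rs arbitrary: Y rule: rev_induct)
  case Nil
  then show ?case by simp
next
  case (snoc r rs)
  let ?k = "length rs"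
  have "prod_list (map (\<lambda>r. S - cs r) rs) * ((S - cs r) * Y) = 0"
    using snoc.prems by (simp add: mult.assoc)
  from snoc.IH[OF this] obtain E where E: "(S - cs r) * Y = (\<Sum>\<alpha>\<in>set rs. E \<alpha>)"
    "\<And>\<alpha>. \<alpha> \<in> set rs \<Longrightarrow> (S - cs \<alpha>) ^ ?k * E \<alpha> = 0"
    "\<And>\<alpha> Z. \<alpha> \<in> set rs \<Longrightarrow> Z * S = S * Z \<Longrightarrow> Z * ((S - cs r) * Y) = (S - cs r) * Y * Z \<Longrightarrow>
      Z * E \<alpha> = E \<alpha> * Z"
    by blast
  have commE: "Z * E \<alpha> = E \<alpha> * Z" if "\<alpha> \<in> set rs" "Z * S = S * Z" "Z * Y = Y * Z" for \<alpha> Z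
  proof -
    have "Z * (S - cs r) = (S - cs r) * Z" using that(2) by (simp add: algebra_simps cs_commute)
    then have "Z * ((S - cs r) * Y) = (S - cs r) * Y * Z" using that(3) by (metis mult.assoc)
    with that E(3) show ?thesis by blast
  qed
  have "\<exists>W. (S - cs r) * W = E \<alpha> \<and> (S - cs \<alpha>) ^ ?k * W = 0 \<and>
    (\<forall>Z. Z * S = S * Z \<longrightarrow> Z * Y = Y * Z \<longrightarrow> Z * W = W * Z)" if "\<alpha> \<in> set rs - {r}" for \<alpha>
  proof -
    have "\<alpha> - r \<noteq> 0" using that by simp
    from nilpotent_shift_solve[OF this E(2)] that obtain W where
      W: "(S - cs \<alpha> + cs (\<alpha> - r)) * W = E \<alpha>" "(S - cs \<alpha>) ^ ?k * W = 0"
      "\<And>Z. Z * (S - cs \<alpha>) = (S - cs \<alpha>) * Z \<Longrightarrow> Z * E \<alpha> = E \<alpha> * Z \<Longrightarrow> Z * W = W * Z"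
      by blast
    have "(S - cs r) * W = E \<alpha>" using W(1) by (simp add: cs_diff)
    moreover have "Z * W = W * Z" if "Z * S = S * Z" "Z * Y = Y * Z" for Z
      using W(3)[of Z] commE[of \<alpha> Z] that \<open>\<alpha> \<in> set rs - {r}\<close> by (simp add: algebra_simps cs_commute)
    ultimately show ?thesis using W(2) by blast
  qed
  then obtain W where W: "\<And>\<alpha>. \<alpha> \<in> set rs - {r} \<Longrightarrow> (S - cs r) * W \<alpha> = E \<alpha>"
    "\<And>\<alpha>. \<alpha> \<in> set rs - {r} \<Longrightarrow> (S - cs \<alpha>) ^ ?k * W \<alpha> = 0"
    "\<And>\<alpha> Z. \<alpha> \<in> set rs - {r} \<Longrightarrow> Z * S = S * Z \<Longrightarrow> Z * Y = Y * Z \<Longrightarrow> Z * W \<alpha> = W \<alpha> * Z"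
    by metis
  \<comment> \<open>After multiplication by \<open>S - cs r\<close> only the component for
    \<open>r\<close> survives in \<open>R\<close>, and only if \<open>r\<close> has already occurred
    in \<open>rs\<close>.\<close>
  define R where "R = Y - (\<Sum>\<alpha>\<in>set rs - {r}. W \<alpha>)"
  have "(S - cs r) * R = (\<Sum>\<alpha>\<in>set rs. E \<alpha>) - (\<Sum>\<alpha>\<in>set rs - {r}. E \<alpha>)"
    by (simp add: R_def right_diff_distrib[of "S - cs r"] E(1) sum_distrib_left W(1))
  also have "\<dots> = (if r \<in> set rs then E r else 0)"
    by (auto simp: sum.remove[of "set rs" r])
  finally have "(S - cs r) ^ ?k * ((S - cs r) * R) = 0" using E(2) by simp
  then have R: "(S - cs r) ^ Suc ?k * R = 0" by (simp add: power_Suc2 mult.assoc del: power_Suc)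
  have commR: "Z * R = R * Z" if "Z * S = S * Z" "Z * Y = Y * Z" for Z
    using W(3) that by (simp add: R_def algebra_simps sum_distrib_left sum_distrib_right)
  define E' where "E' = (\<lambda>\<alpha>. if \<alpha> = r then R else W \<alpha>)"
  have "set (rs @ [r]) = insert r (set rs - {r})" by auto
  moreover have "(\<Sum>\<alpha>\<in>insert r (set rs - {r}). E' \<alpha>) = Y"
    by (subst sum.insert) (auto simp: E'_def R_def)
  moreover have "(S - cs \<alpha>) ^ length (rs @ [r]) * E' \<alpha> = 0" if "\<alpha> \<in> insert r (set rs - {r})" for \<alpha>
    using that R W(2)[of \<alpha>] by (auto simp: E'_def mult.assoc)
  moreover have "Z * E' \<alpha> = E' \<alpha> * Z"
    if "\<alpha> \<in> insert r (set rs - {r})" "Z * S = S * Z" "Z * Y = Y * Z" for \<alpha> Z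
    using that commR W(3)[of \<alpha> Z] by (auto simp: E'_def)
  ultimately show ?case by (intro exI[of _ E']) auto
qed

lemma eigval_iff_char_fun: "eigval X x \<longleftrightarrow> char_fun X x = 0"
  by (simp add: eigval_def char_fun_eq_0_iff)

text \<open>The exponent 3 bounds every multiplicity. The last clause says that the components lie
  in the bicommutant of \<open>S\<close>; this replaces the description of spectral projections as
  polynomials in \<open>S\<close>.\<close>

definition spectral_resolution :: "cmat3 \<Rightarrow> complex set \<Rightarrow> (complex \<Rightarrow> cmat3) \<Rightarrow> bool" where
  "spectral_resolution S F E \<longleftrightarrow> finite F \<and> (\<forall>\<alpha>\<in>F. eigval S \<alpha>) \<and> (\<Sum>\<alpha>\<in>F. E \<alpha>) = 1
    \<and> (\<forall>\<alpha>\<in>F. (S - cs \<alpha>) ^ 3 * E \<alpha> = 0) \<and> (\<forall>\<alpha>\<in>F. \<forall>\<beta>\<in>F. \<alpha> \<noteq> \<beta> \<longrightarrow> E \<alpha> * E \<beta> = 0)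
    \<and> (\<forall>\<alpha>\<in>F. \<forall>Z. Z * S = S * Z \<longrightarrow> Z * E \<alpha> = E \<alpha> * Z)"

text \<open>The unit matrix is decomposed along the roots of the characteristic polynomial. It
  commutes with everything, so the components commute with all that commutes with
  \<open>S\<close>.\<close>

lemma spectral_resolution_exists: "\<exists>F E. spectral_resolution S F E"
proof -
  obtain a b c where abc: "e1 S = a + b + c" "e2 S = a * b + a * c + b * c" "e3 S = a * b * c"
    "\<forall>x. char_fun S x = (x - a) * (x - b) * (x - c)"
    using char_fun_roots[of S] by blast
  have "prod_list (map (\<lambda>r. S - cs r) [a, b, c]) * 1 = 0"
    using Cayley_Hamilton3[OF abc(1-3)] by (simp add: mult.assoc)
  moreover define F where "F = {a, b, c}"
  ultimately have "prod_list (map (\<lambda>r. S - cs r) [a, b, c]) * 1 = 0" "set [a, b, c] = F" by simp_all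
  note * = this
  from generalized_eigen_decomposition[OF *(1), unfolded *(2)] obtain E where
    E: "1 = (\<Sum>\<alpha>\<in>F. E \<alpha>)" "\<And>\<alpha>. \<alpha> \<in> F \<Longrightarrow> (S - cs \<alpha>) ^ 3 * E \<alpha> = 0"
    "\<And>\<alpha> Z. \<alpha> \<in> F \<Longrightarrow> Z * S = S * Z \<Longrightarrow> Z * E \<alpha> = E \<alpha> * Z"
    by (auto simp: numeral_3_eq_3)
  have "E \<alpha> * E \<beta> = 0" if ab: "\<alpha> \<in> F" "\<beta> \<in> F" "\<alpha> \<noteq> \<beta>" for \<alpha> \<beta>
  proof (rule coprime_kernels[OF ab(3)])
    have SE: "S * E \<alpha> = E \<alpha> * S" by (rule E(3)[OF ab(1)]) simp
    show "(S - cs \<alpha>) ^ 3 * (E \<alpha> * E \<beta>) = 0"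
      using E(2)[OF ab(1)] by (simp flip: mult.assoc)
    have "(S - cs \<beta>) * E \<alpha> = E \<alpha> * (S - cs \<beta>)" using SE by (simp add: algebra_simps cs_commute)
    from commute_power[OF this, of 3] show "(S - cs \<beta>) ^ 3 * (E \<alpha> * E \<beta>) = 0"
      using E(2)[OF ab(2)] by (metis mult.assoc mult_zero_right)
  qed
  moreover have "eigval S \<alpha>" if "\<alpha> \<in> F" for \<alpha>
    using that abc(4) by (auto simp: eigval_iff_char_fun F_def)
  moreover have "finite F" by (simp add: F_def)
  ultimately have "spectral_resolution S F E"
    unfolding spectral_resolution_def
    by (intro conjI ballI allI impI) (assumption | rule E(1)[symmetric] | rule E(2,3); assumption)+
  then show ?thesis by blast
qed

section \<open>Resolutions of the identity\<close>

lemma resolution_ext: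
  fixes E :: "'b \<Rightarrow> cmat3"
  assumes "(\<Sum>i\<in>I. E i) = 1" "\<And>i. i \<in> I \<Longrightarrow> P * E i = P' * E i"
  shows "P = P'"
proof -
  have "P = P * (\<Sum>i\<in>I. E i)" using assms(1) by simp
  also have "\<dots> = P' * (\<Sum>i\<in>I. E i)" by (simp add: sum_distrib_left assms(2))
  finally show ?thesis using assms(1) by simp
qed

lemma resolution_mult_sum:
  fixes E :: "'b \<Rightarrow> cmat3"
  assumes "finite I" "\<beta> \<in> I" "\<And>\<alpha>. \<alpha> \<in> I \<Longrightarrow> \<alpha> \<noteq> \<beta> \<Longrightarrow> E \<alpha> * E \<beta> = 0"
  shows "(\<Sum>\<alpha>\<in>I. X \<alpha> * E \<alpha>) * E \<beta> = X \<beta> * (E \<beta> * E \<beta>)"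
proof -
  have "(\<Sum>\<alpha>\<in>I. X \<alpha> * E \<alpha>) * E \<beta> = (\<Sum>\<alpha>\<in>I. if \<alpha> = \<beta> then X \<beta> * (E \<beta> * E \<beta>) else 0)"
    unfolding sum_distrib_right by (intro sum.cong) (auto simp: mult.assoc assms(3))
  then show ?thesis using assms(1,2) by simp
qed

lemma resolution_idem:
  fixes E :: "'b \<Rightarrow> cmat3"
  assumes "finite I" "\<beta> \<in> I" "\<And>\<alpha>. \<alpha> \<in> I \<Longrightarrow> \<alpha> \<noteq> \<beta> \<Longrightarrow> E \<alpha> * E \<beta> = 0" "(\<Sum>i\<in>I. E i) = 1"
  shows "E \<beta> * E \<beta> = E \<beta>"
  using resolution_mult_sum[of I \<beta> E "\<lambda>_. 1"] assms by simp

section \<open>Semisimple and unipotent factors of an exponential\<close>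

lemma eigval_exp_nonzero: "eigval (exp A) \<alpha> \<Longrightarrow> \<alpha> \<noteq> 0"
proof
  assume "eigval (exp A) \<alpha>" "\<alpha> = 0"
  then obtain V where "V \<noteq> 0" "exp A * V = 0" by (auto simp: eigval_def)
  then have "exp (- A) * (exp A * V) = 0" by simp
  then show False using \<open>V \<noteq> 0\<close> exp_minus_inverse[of "- A"] by (simp flip: mult.assoc)
qed

lemma exp_commute: "X * A = A * X \<Longrightarrow> X * exp A = exp A * (X :: cmat3)"
  using exp_intertwine[of A X A] by simp

text \<open>\<open>N\<close> is the logarithm series of \<open>1 + Q\<close>, cut off by the
  vanishing cube.\<close>

lemma exp_unipotent:
  fixes Q :: "'a :: {real_normed_algebra_1, banach}"
  assumes "Q * Q * Q = 0"
  defines "N \<equiv> Q - (Q * Q) /\<^sub>R 2"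
  shows "exp N = 1 + Q" "N * N * N = 0"
proof -
  have z: "Q * (Q * Q) = 0" "Q * (Q * (Q * Q)) = 0" using assms(1) by (simp_all add: mult.assoc)
  have 2: "N * N = Q * Q" unfolding N_def using z by (simp add: algebra_simps)
  then show 3: "N * N * N = 0" unfolding N_def using z by (simp add: algebra_simps)
  show "exp N = 1 + Q" unfolding exp_cube_zero[OF 3] 2 by (simp add: N_def)
qed

text \<open>The multiplicative Jordan decomposition of \<open>exp A\<close>, with the unipotent
  factor written as \<open>exp N\<close>. What matters is that \<open>N\<close> commutes with
  everything that commutes with \<open>exp A\<close>, a larger set than the commutant of
  \<open>A\<close>.\<close>

lemma exp_spectral_splitting:
  fixes A :: cmat3
  obtains F E N where "spectral_resolution (exp A) F E" "N * N * N = 0"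
    "\<And>Z. Z * exp A = exp A * Z \<Longrightarrow> Z * N = N * Z"
    "\<And>\<alpha>. \<alpha> \<in> F \<Longrightarrow> exp (A - N) * E \<alpha> = sc \<alpha> (E \<alpha>)"
proof -
  let ?S = "exp A"
  obtain F E where FE: "spectral_resolution ?S F E" using spectral_resolution_exists by blast
  note FE' = FE[unfolded spectral_resolution_def]
  have "\<forall>\<alpha>\<in>F. eigval ?S \<alpha>" using FE' by blast
  then have nz: "\<alpha> \<noteq> 0" if "\<alpha> \<in> F" for \<alpha> using eigval_exp_nonzero[of A \<alpha>] that by blast
  have sum1: "(\<Sum>\<alpha>\<in>F. E \<alpha>) = 1" and cube: "\<And>\<alpha>. \<alpha> \<in> F \<Longrightarrow> (?S - cs \<alpha>) ^ 3 * E \<alpha> = 0"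
    and orth: "\<And>\<alpha> \<beta>. \<alpha> \<in> F \<Longrightarrow> \<beta> \<in> F \<Longrightarrow> \<alpha> \<noteq> \<beta> \<Longrightarrow> E \<alpha> * E \<beta> = 0"
    and comm: "\<And>\<alpha> Z. \<alpha> \<in> F \<Longrightarrow> Z * ?S = ?S * Z \<Longrightarrow> Z * E \<alpha> = E \<alpha> * Z"
    and finF: "finite F"
    using FE' by blast+
  have idem: "E \<beta> * E \<beta> = E \<beta>" if "\<beta> \<in> F" for \<beta>
    by (rule resolution_idem[OF finF that _ sum1]) (rule orth[OF _ that])
  \<comment> \<open>On the range of \<open>E \<alpha>\<close> the exponential is
    \<open>\<alpha> * (1 + Q)\<close>; the division is legitimate because eigenvalues of an
    exponential are nonzero.\<close>
  define Q where "Q = (\<Sum>\<alpha>\<in>F. sc (1 / \<alpha>) (?S - cs \<alpha>) * E \<alpha>)"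
  have QE: "Q * E \<beta> = sc (1 / \<beta>) ((?S - cs \<beta>) * E \<beta>)" if "\<beta> \<in> F" for \<beta>
    unfolding Q_def using resolution_mult_sum[OF finF that, of E "\<lambda>\<alpha>. sc (1 / \<alpha>) (?S - cs \<alpha>)"]
      orth[OF _ that] idem[OF that]
    by (simp add: sc_ring(4))
  have commQ: "Z * Q = Q * Z" if Z: "Z * ?S = ?S * Z" for Z
    unfolding Q_def sum_distrib_left sum_distrib_right
  proof (intro sum.cong refl)
    fix \<alpha> assume "\<alpha> \<in> F"
    have "Z * sc (1 / \<alpha>) (?S - cs \<alpha>) = sc (1 / \<alpha>) (?S - cs \<alpha>) * Z"
      using Z by (simp add: algebra_simps sc_ring)
    then show "Z * (sc (1 / \<alpha>) (?S - cs \<alpha>) * E \<alpha>) = sc (1 / \<alpha>) (?S - cs \<alpha>) * E \<alpha> * Z"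
      using comm[OF \<open>\<alpha> \<in> F\<close> Z] by (metis mult.assoc)
  qed
  have SQ: "(?S - cs \<beta>) * Q = Q * (?S - cs \<beta>)" for \<beta>
    using commQ[of ?S] by (simp add: algebra_simps sc_ring)
  have Q3: "Q * Q * Q = 0"
  proof (rule resolution_ext[OF sum1])
    fix \<beta> assume b: "\<beta> \<in> F"
    let ?P = "?S - cs \<beta>"
    have step: "Q * (R * E \<beta>) = R * (Q * E \<beta>)" if "R * Q = Q * R" for R
      using that by (metis mult.assoc)
    have PP: "(?P * ?P) * Q = Q * (?P * ?P)" using SQ by (metis mult.assoc)
    have "Q * (Q * (Q * E \<beta>)) = sc (1 / \<beta> * (1 / \<beta>) * (1 / \<beta>)) (?P * (?P * (?P * E \<beta>)))"
      using step[OF SQ] step[OF PP] by (simp add: QE[OF b] sc_ring mult.assoc)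
    then show "Q * Q * Q * E \<beta> = 0 * E \<beta>"
      using cube[OF b] by (simp add: power3_eq_cube mult.assoc sc_ring)
  qed
  define N where "N = Q - (Q * Q) /\<^sub>R 2"
  have N: "exp N = 1 + Q" "N * N * N = 0" unfolding N_def by (rule exp_unipotent[OF Q3])+
  have commN: "Z * N = N * Z" if "Z * ?S = ?S * Z" for Z
  proof -
    have "Z * (Q * Q) = Q * Q * Z" using commQ[OF that] by (metis mult.assoc)
    then show ?thesis using commQ[OF that] by (simp add: N_def algebra_simps)
  qed
  have "A * N = N * A" by (rule commN) (simp add: exp_commute)
  then have "exp (A - N) = ?S * exp (- N)"
    using exp_add_commuting[of A "- N"] by simp
  moreover have "exp N * exp (- N) = 1" by (rule exp_minus_inverse)
  moreover have "?S * E \<alpha> = sc \<alpha> (exp N * E \<alpha>)" if "\<alpha> \<in> F" for \<alpha>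
    using nz[OF that] QE[OF that] by (simp add: N distrib_right sc_ring left_diff_distrib)
  moreover have "exp (- N) * E \<alpha> = E \<alpha> * exp (- N)" if "\<alpha> \<in> F" for \<alpha>
  proof -
    have "N * ?S = ?S * N" by (rule commN[symmetric]) simp
    then have "N * E \<alpha> = E \<alpha> * N" by (rule comm[OF that])
    then show ?thesis by (intro exp_commute[symmetric]) simp
  qed
  ultimately have "exp (A - N) * E \<alpha> = sc \<alpha> (E \<alpha>)" if "\<alpha> \<in> F" for \<alpha>
    using that by (metis mult.assoc sc_ring(4) mult_1_left mult_1_right exp_minus_inverse add.inverse_inverse)
  then show thesis using that[OF FE N(2)] commN by blast
qed

section \<open>Commutation and kernels of pencils\<close>

lemma eigval_nilpotent: "N * N * N = 0 \<Longrightarrow> eigval N x \<Longrightarrow> x = 0"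
proof -
  assume N: "N * N * N = 0" and "eigval N x"
  then obtain V where V: "V \<noteq> 0" "N * V = sc x V" by (auto simp: eigval_def sc_def)
  have "N * N * N * V = sc (x * x * x) V" by (simp add: mult.assoc V(2) sc_ring)
  then show "x = 0" using N V(1) by (simp add: sc_eq_0_iff)
qed

lemma nilpotentI:
  assumes "\<And>x. eigval N x \<Longrightarrow> x = 0"
  shows "N * N * N = 0"
proof -
  obtain a b c where abc: "e1 N = a + b + c" "e2 N = a * b + a * c + b * c" "e3 N = a * b * c"
    "\<forall>x. char_fun N x = (x - a) * (x - b) * (x - c)"
    using char_fun_roots[of N] by blast
  have "a = 0" "b = 0" "c = 0" using assms abc(4) by (auto simp: eigval_iff_char_fun)
  then show ?thesis using Cayley_Hamilton3[OF abc(1-3)] by simp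
qed

text \<open>\<open>X\<close> and \<open>N\<close> share an eigenvector for the given eigenvalue of
  \<open>X\<close>, and \<open>N\<close> can only act on it as 0.\<close>

lemma eigval_add_nilpotent:
  assumes "X * N = N * X" "N * N * N = 0" "eigval X x"
  shows "eigval (X + N) x"
proof -
  obtain V where "V \<noteq> 0" "X * V = cs x * V" using assms(3) by (auto simp: eigval_def)
  then obtain y W where W: "W \<noteq> 0" "X * W = cs x * W" "N * W = cs y * W"
    using common_eigen[OF assms(1)] by metis
  then have "y = 0" using eigval_nilpotent[OF assms(2), of y] by (auto simp: eigval_def)
  with W show ?thesis by (auto simp: eigval_def distrib_right)
qed

text \<open>Arguing through eigenvalues and Cayley-Hamilton keeps the exponent 3; expanding the
  binomial would only give exponent 5.\<close>

lemma nilpotent_add: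
  fixes N M :: cmat3
  assumes "N * M = M * N" "N * N * N = 0" "M * M * M = 0"
  shows "(N + M) * (N + M) * (N + M) = 0"
proof (rule nilpotentI)
  fix x assume "eigval (N + M) x"
  moreover have "(N + M) * (- M) = (- M) * (N + M)" "(- M) * (- M) * (- M) = 0"
    using assms by (simp_all add: algebra_simps)
  ultimately have "eigval (N + M + - M) x" using eigval_add_nilpotent by blast
  then show "x = 0" using eigval_nilpotent[OF assms(2)] by simp
qed

section \<open>Commutators obtained from the exponential relation\<close>

lemma exp_times_exp_minus: "exp X * exp (- X) = (1 :: cmat3)" "exp (- X) * exp X = (1 :: cmat3)"
  using exp_minus_inverse[of X] exp_minus_inverse[of "- X"] by simp_all

lemma exp_mult_left_cancel: "exp X * Y = exp X * Z \<Longrightarrow> Y = (Z :: cmat3)"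
  by (metis exp_times_exp_minus(2) mult.assoc mult_1_left)

text \<open>\<open>A + B\<close> commutes with its exponential \<open>exp A * exp B\<close>. As
  \<open>A\<close> commutes with \<open>exp A\<close> and \<open>B\<close> with
  \<open>exp B\<close>, this turns into \<open>exp A * (A * exp B - exp B * A) = (exp A * B - B *
  exp A) * exp B\<close>. Everything on the right commutes with \<open>exp B\<close>; cancelling
  \<open>exp A\<close> leaves the claim.\<close>

lemma exp_commutator_commutes:
  fixes A B :: cmat3
  assumes "exp (A + B) = exp A * exp B" "exp A * exp B = exp B * exp A"
  shows "exp B * (A * exp B - exp B * A) = (A * exp B - exp B * A) * exp B"
proof -
  let ?S = "exp A" and ?T = "exp B"
  have AS: "A * ?S = ?S * A" and BT: "B * ?T = ?T * B" by (simp_all add: exp_commute)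
  have "(A + B) * (?S * ?T) = (?S * ?T) * (A + B)"
    using exp_commute[of "A + B" "A + B"] assms(1) by simp
  moreover have "A * (?S * ?T) = ?S * A * ?T" "?S * ?T * B = ?S * B * ?T"
    using AS BT by (metis mult.assoc)+
  ultimately have SK: "?S * (A * ?T - ?T * A) = (?S * B - B * ?S) * ?T"
    by (simp add: algebra_simps mult.assoc)
  have "?T * (?S * B - B * ?S) = (?S * B - B * ?S) * ?T"
    unfolding right_diff_distrib left_diff_distrib using BT assms(2) by (metis mult.assoc)
  then have "?T * (?S * (A * ?T - ?T * A)) = ?S * (A * ?T - ?T * A) * ?T"
    unfolding SK by (metis mult.assoc)
  then have "?S * (?T * (A * ?T - ?T * A)) = ?S * ((A * ?T - ?T * A) * ?T)"
    using assms(2) by (metis mult.assoc)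
  then show ?thesis by (rule exp_mult_left_cancel)
qed

text \<open>The off-diagonal blocks \<open>E \<gamma> * A * E \<delta>\<close> vanish. The
  commutator \<open>A * T - T * A\<close> respects the idempotents, so its own off-diagonal block is
  0, which makes \<open>T\<close> commute with the block of \<open>A\<close>. That block is then
  killed by powers of both \<open>T - cs \<gamma>\<close> and
  \<open>T - cs \<delta>\<close>.\<close>

lemma commute_spectral_idempotent:
  assumes res: "spectral_resolution T F E"
    and K: "T * (A * T - T * A) = (A * T - T * A) * T"
    and b: "\<beta> \<in> F"
  shows "A * E \<beta> = E \<beta> * A"
proof -
  note res' = res[unfolded spectral_resolution_def]
  have sum1: "(\<Sum>\<alpha>\<in>F. E \<alpha>) = 1" and cube: "\<And>\<alpha>. \<alpha> \<in> F \<Longrightarrow> (T - cs \<alpha>) ^ 3 * E \<alpha> = 0"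
    and orth: "\<And>\<alpha> \<beta>. \<alpha> \<in> F \<Longrightarrow> \<beta> \<in> F \<Longrightarrow> \<alpha> \<noteq> \<beta> \<Longrightarrow> E \<alpha> * E \<beta> = 0"
    and comm: "\<And>\<alpha> Z. \<alpha> \<in> F \<Longrightarrow> Z * T = T * Z \<Longrightarrow> Z * E \<alpha> = E \<alpha> * Z" and fin: "finite F"
    using res' by blast+
  have zero: "E \<gamma> * A * E \<delta> = 0" if gd: "\<gamma> \<in> F" "\<delta> \<in> F" "\<gamma> \<noteq> \<delta>" for \<gamma> \<delta>
  proof (rule coprime_kernels[OF gd(3)])
    have TE: "T * E \<gamma> = E \<gamma> * T" "T * E \<delta> = E \<delta> * T" using comm gd(1,2) by blast+
    have "(A * T - T * A) * E \<delta> = E \<delta> * (A * T - T * A)"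
      by (rule comm[OF gd(2) K[symmetric]])
    then have "E \<gamma> * ((A * T - T * A) * E \<delta>) = 0"
      using orth[OF gd] by (simp flip: mult.assoc)
    then have "E \<gamma> * A * (T * E \<delta>) = E \<gamma> * T * A * E \<delta>"
      by (simp add: algebra_simps)
    then have TY: "T * (E \<gamma> * A * E \<delta>) = (E \<gamma> * A * E \<delta>) * T"
      using TE by (metis mult.assoc)
    show "(T - cs \<gamma>) ^ 3 * (E \<gamma> * A * E \<delta>) = 0"
      using cube[OF gd(1)] by (simp flip: mult.assoc)
    have "(T - cs \<delta>) * (E \<gamma> * A * E \<delta>) = (E \<gamma> * A * E \<delta>) * (T - cs \<delta>)"
      using TY by (simp add: left_diff_distrib right_diff_distrib cs_commute)
    from commute_power[OF this, of 3]
    have "(T - cs \<delta>) ^ 3 * (E \<gamma> * A * E \<delta>) = E \<gamma> * A * (E \<delta> * (T - cs \<delta>) ^ 3)"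
      by (simp add: mult.assoc)
    also have "E \<delta> * (T - cs \<delta>) ^ 3 = (T - cs \<delta>) ^ 3 * E \<delta>"
      using TE(2) by (intro commute_power[symmetric]) (simp add: algebra_simps cs_commute)
    finally show "(T - cs \<delta>) ^ 3 * (E \<gamma> * A * E \<delta>) = 0" by (simp add: cube[OF gd(2)])
  qed
  have "A * E \<beta> = (\<Sum>\<gamma>\<in>F. E \<gamma>) * (A * E \<beta>)" by (simp add: sum1)
  also have "\<dots> = (\<Sum>\<gamma>\<in>F. if \<gamma> = \<beta> then E \<beta> * A * E \<beta> else 0)"
    unfolding sum_distrib_right by (intro sum.cong) (use zero b in \<open>auto simp: mult.assoc\<close>)
  also have "\<dots> = (\<Sum>\<gamma>\<in>F. (E \<beta> * A) * E \<gamma>)"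
    by (intro sum.cong) (use zero b in auto)
  also have "\<dots> = E \<beta> * A" by (simp add: sum1 flip: sum_distrib_left)
  finally show ?thesis .
qed

text \<open>A nilpotent \<open>N\<close> of index at most 3 is recovered from \<open>exp N\<close>
  by a polynomial.\<close>

lemma commute_log_unipotent:
  assumes "X * exp N = exp N * X" "N * N * N = 0"
  shows "X * N = N * (X :: cmat3)"
proof -
  define Q where "Q = exp N - 1"
  have z: "N * (N * N) = 0" "N * (N * (N * N)) = 0" using assms(2) by (simp_all add: mult.assoc)
  have Q: "Q = N + (N * N) /\<^sub>R 2" unfolding Q_def exp_cube_zero[OF assms(2)] by simp
  have "Q * Q = N * N" unfolding Q by (simp add: algebra_simps z)
  then have N: "N = Q - (Q * Q) /\<^sub>R 2" by (simp add: Q)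
  have XQ: "X * Q = Q * X" using assms(1) by (simp add: Q_def algebra_simps)
  then have "X * (Q * Q) = Q * Q * X" by (metis mult.assoc)
  with XQ have "X * (Q - (Q * Q) /\<^sub>R 2) = (Q - (Q * Q) /\<^sub>R 2) * X" by (simp add: algebra_simps)
  then show ?thesis using N by simp
qed

section \<open>Singular members of a linear pencil\<close>

lemma cubic_identically_zero:
  fixes a b c d :: complex
  assumes "infinite {t :: nat. a * of_nat t ^ 3 + b * (of_nat t)\<^sup>2 + c * of_nat t + d = 0}"
  shows "a = 0" "b = 0" "c = 0" "d = 0"
proof -
  have "inj_on (of_nat :: nat \<Rightarrow> complex) A" for A by (auto intro: inj_onI)
  with assms have "infinite ((of_nat :: nat \<Rightarrow> complex) `
    {t. a * of_nat t ^ 3 + b * (of_nat t)\<^sup>2 + c * of_nat t + d = 0})"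
    using finite_imageD by blast
  moreover have "(of_nat :: nat \<Rightarrow> complex) ` {t. a * of_nat t ^ 3 + b * (of_nat t)\<^sup>2 + c * of_nat t + d = 0}
    \<subseteq> {z. poly [:d, c, b, a:] z = 0}"
    by (auto simp: algebra_simps power2_eq_square power3_eq_cube)
  ultimately have "infinite {z. poly [:d, c, b, a:] z = 0}" using finite_subset by blast
  then have "[:d, c, b, a:] = 0" using poly_roots_finite by blast
  then show "a = 0" "b = 0" "c = 0" "d = 0" by simp_all
qed

lemma e3_pencil_zero:
  assumes "infinite {t :: nat. e3 (cs (of_nat t) * X + Y) = 0}"
  shows "e3 (cs z * X + Y) = 0"
proof -
  obtain b c where *: "\<And>x y. e3 (cs x * X + cs y * Y) = x ^ 3 * e3 X + x\<^sup>2 * y * b + x * y\<^sup>2 * c + y ^ 3 * e3 Y"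
    using e3_lincomb[of X Y] by metis
  have e: "e3 (cs x * X + Y) = e3 X * x ^ 3 + b * x\<^sup>2 + c * x + e3 Y" for x
    using *[of x 1] by (simp add: algebra_simps)
  show ?thesis using cubic_identically_zero[OF assms[unfolded e]] by (simp add: e)
qed

text \<open>\<open>M\<close> is kept on the range of \<open>J\<close> and replaced by the identity
  on the complement, so that a determinant of full size detects a kernel inside the range of
  \<open>J\<close>.\<close>

lemma compressed_kernel:
  assumes J: "J * J = J" "M * J = J * M"
  shows "e3 (M * J + (1 - J)) = 0 \<longleftrightarrow> (\<exists>V. V \<noteq> 0 \<and> J * V = V \<and> M * V = 0)"
proof
  assume "e3 (M * J + (1 - J)) = 0"
  then obtain V where V: "V \<noteq> 0" "(M * J + (1 - J)) * V = 0" by (auto simp: e3_eq_0_iff)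
  have JM: "J * (M * Z) = M * (J * Z)" for Z using J(2) by (simp flip: mult.assoc)
  have JJ: "J * (J * Z) = J * Z" for Z using J(1) by (simp flip: mult.assoc)
  have "(1 - J) * ((M * J + (1 - J)) * V) = (1 - J) * V"
    by (simp add: algebra_simps JM JJ)
  with V have "J * V = V" by (simp add: algebra_simps)
  with V show "\<exists>V. V \<noteq> 0 \<and> J * V = V \<and> M * V = 0"
    by (intro exI[of _ V]) (simp add: algebra_simps)
next
  assume "\<exists>V. V \<noteq> 0 \<and> J * V = V \<and> M * V = 0"
  then show "e3 (M * J + (1 - J)) = 0"
    by (force simp: e3_eq_0_iff algebra_simps)
qed

text \<open>The compressed determinant is a polynomial along the pencil; with infinitely many zeros
  it vanishes identically, in particular at both ends of the pencil.\<close>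

lemma pencil_kernel_limits:
  assumes J: "J * J = J" "X * J = J * X" "Y * J = J * Y"
    and inf: "infinite {t :: nat. \<exists>V. V \<noteq> 0 \<and> J * V = V \<and> (cs (of_nat t) * X + Y) * V = 0}"
  shows "\<exists>V. V \<noteq> 0 \<and> J * V = V \<and> X * V = 0" "\<exists>V. V \<noteq> 0 \<and> J * V = V \<and> Y * V = 0"
proof -
  have comm: "(cs z * P + Q) * J = J * (cs z * P + Q)" if "P * J = J * P" "Q * J = J * Q" for z P Q
    using that by (simp add: sc_ring algebra_simps)
  have eq: "(cs z * P + Q) * J + (1 - J) = cs z * (P * J) + (Q * J + (1 - J))" for z P Q
    by (simp add: algebra_simps)
  note ck1 = compressed_kernel[OF J(1) comm[OF J(2,3)], unfolded eq, symmetric]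
  note ck2 = compressed_kernel[OF J(1) comm[OF J(3,2)], unfolded eq, symmetric]
  have all: "\<exists>V. V \<noteq> 0 \<and> J * V = V \<and> (cs z * X + Y) * V = 0" for z
    unfolding ck1 by (rule e3_pencil_zero[OF inf[unfolded ck1]])
  from all[of 0] show "\<exists>V. V \<noteq> 0 \<and> J * V = V \<and> Y * V = 0" by simp
  \<comment> \<open>Reversing the pencil turns the limit at infinity into evaluation at 0:
    \<open>s * Y + X = s * ((1 / s) * X + Y)\<close>.\<close>
  have "\<exists>V. V \<noteq> 0 \<and> J * V = V \<and> (cs (of_nat s) * Y + X) * V = 0" if "s > 0" for s :: nat
  proof -
    obtain V where V: "V \<noteq> 0" "J * V = V" "(cs (1 / of_nat s) * X + Y) * V = 0"
      using all by blast
    have "(cs (of_nat s) * Y + X) * V = sc (of_nat s) ((cs (1 / of_nat s) * X + Y) * V)"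
      using that by (simp add: distrib_right sc_ring)
    with V show ?thesis by (auto simp: sc_ring)
  qed
  then have "{0<..} \<subseteq> {t :: nat. \<exists>V. V \<noteq> 0 \<and> J * V = V \<and> (cs (of_nat t) * Y + X) * V = 0}" by auto
  then have "infinite {t :: nat. \<exists>V. V \<noteq> 0 \<and> J * V = V \<and> (cs (of_nat t) * Y + X) * V = 0}"
    using infinite_Ioi finite_subset by blast
  then have "\<exists>V. V \<noteq> 0 \<and> J * V = V \<and> (cs 0 * Y + X) * V = 0"
    unfolding ck2 by (rule e3_pencil_zero)
  then show "\<exists>V. V \<noteq> 0 \<and> J * V = V \<and> X * V = 0" by simp
qed

lemma cubic_three_roots:
  assumes "eigval C l0" "eigval C l1" "eigval C l2" "l0 \<noteq> l1" "l0 \<noteq> l2" "l1 \<noteq> l2"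
  shows "(C - cs l0) * (C - cs l1) * (C - cs l2) = 0"
proof -
  obtain a b c where abc: "e1 C = a + b + c" "e2 C = a * b + a * c + b * c" "e3 C = a * b * c"
    "\<forall>x. char_fun C x = (x - a) * (x - b) * (x - c)"
    using char_fun_roots[of C] by blast
  have "l0 \<in> {a, b, c}" "l1 \<in> {a, b, c}" "l2 \<in> {a, b, c}"
    using assms(1-3) abc(4) by (auto simp: eigval_iff_char_fun)
  then have "e1 C = l0 + l1 + l2 \<and> e2 C = l0 * l1 + l0 * l2 + l1 * l2 \<and> e3 C = l0 * l1 * l2"
    using assms(4-6) by (elim insertE emptyE) (simp_all add: abc(1-3))
  then show ?thesis by (intro Cayley_Hamilton3) auto
qed

text \<open>With distinct roots the eigenvectors span, made explicit by Lagrange interpolation: 1 is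
  a combination of the products \<open>W a b\<close>, each of which is an eigenvector.\<close>

lemma matrix_eq_if_agree_on_eigenvectors:
  assumes C: "(C - cs l0) * (C - cs l1) * (C - cs l2) = 0"
    and d: "l0 \<noteq> l1" "l0 \<noteq> l2" "l1 \<noteq> l2"
    and agree: "\<And>l W. l \<in> {l0, l1, l2} \<Longrightarrow> C * W = cs l * W \<Longrightarrow> P * W = P' * W"
  shows "P = P'"
proof -
  define W where "W = (\<lambda>a b. (C - cs a) * (C - cs b))"
  have comm: "(C - cs a) * (C - cs b) = (C - cs b) * (C - cs a)" for a b
    by (simp add: algebra_simps sc_ring)
  have "(C - cs l0) * W l1 l2 = 0" "(C - cs l1) * W l0 l2 = 0" "(C - cs l2) * W l0 l1 = 0"
    unfolding W_def using C comm by (metis mult.assoc)+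
  then have W: "C * W l1 l2 = cs l0 * W l1 l2" "C * W l0 l2 = cs l1 * W l0 l2" "C * W l0 l1 = cs l2 * W l0 l1"
    by (simp_all add: left_diff_distrib)
  \<comment> \<open>These are the Lagrange weights for the constant polynomial 1 at the nodes
    \<open>l0\<close>, \<open>l1\<close>, \<open>l2\<close>.\<close>
  define u v w where "u = 1 / ((l0 - l1) * (l0 - l2))" and "v = 1 / ((l1 - l0) * (l1 - l2))"
    and "w = 1 / ((l2 - l0) * (l2 - l1))"
  have uvw: "u + v + w = 0" "u * (l1 + l2) + v * (l0 + l2) + w * (l0 + l1) = 0"
    "u * (l1 * l2) + v * (l0 * l2) + w * (l0 * l1) = 1"
    using d unfolding u_def v_def w_def by (simp_all add: divide_simps) (simp_all add: algebra_simps)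
  have Wab: "sc s (W a b) = sc s (C * C) - sc (s * (a + b)) C + cs (s * (a * b))" for s a b
    unfolding W_def by (simp add: algebra_simps sc_ring)
  have "sc u (W l1 l2) + sc v (W l0 l2) + sc w (W l0 l1)
    = sc (u + v + w) (C * C) - sc (u * (l1 + l2) + v * (l0 + l2) + w * (l0 + l1)) C
      + cs (u * (l1 * l2) + v * (l0 * l2) + w * (l0 * l1))"
    unfolding Wab cs_add by (simp only: sc_ring(10) algebra_simps)
  also have "\<dots> = 1" unfolding uvw by (simp add: sc_ring)
  finally have one: "sc u (W l1 l2) + sc v (W l0 l2) + sc w (W l0 l1) = 1" .
  have "P * W l1 l2 = P' * W l1 l2" "P * W l0 l2 = P' * W l0 l2" "P * W l0 l1 = P' * W l0 l1"
    using agree W by blast+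
  then have "P * (sc u (W l1 l2) + sc v (W l0 l2) + sc w (W l0 l1))
    = P' * (sc u (W l1 l2) + sc v (W l0 l2) + sc w (W l0 l1))"
    by (simp add: distrib_left sc_ring)
  then show ?thesis unfolding one by simp
qed

section \<open>Pencils of diagonalizable matrices\<close>

lemma finite_linear_zeros:
  fixes a b :: complex
  assumes "(a, b) \<noteq> (0, 0)"
  shows "finite {t :: nat. of_nat t * a + b = 0}"
proof (rule ccontr)
  have "{t :: nat. of_nat t * a + b = 0}
    = {t. 0 * of_nat t ^ 3 + 0 * (of_nat t)\<^sup>2 + a * of_nat t + b = 0}"
    by (intro Collect_cong) (simp add: mult.commute)
  moreover assume "infinite {t :: nat. of_nat t * a + b = 0}"
  ultimately have "infinite {t :: nat. 0 * of_nat t ^ 3 + 0 * (of_nat t)\<^sup>2 + a * of_nat t + b = 0}"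
    by (rule subst)
  from cubic_identically_zero(3,4)[OF this] assms show False by simp
qed

text \<open>Property L for the sets of eigenvalues, multiplicities forgotten. In this form it passes
  from \<open>A\<close>, \<open>B\<close> to \<open>D1\<close>, \<open>D2\<close> by comparing
  eigenvectors.\<close>

definition linear_spectrum :: "cmat3 \<Rightarrow> cmat3 \<Rightarrow> (nat \<Rightarrow> complex) \<Rightarrow> (nat \<Rightarrow> complex) \<Rightarrow> bool" where
  "linear_spectrum A B l m \<longleftrightarrow>
    (\<forall>x y z. eigval (cs x * A + cs y * B) z \<longleftrightarrow> (\<exists>i<3. z = x * l i + y * m i))"

text \<open>Away from finitely many \<open>t\<close> the pencil has three distinct eigenvalues, so
  both sides may be compared on an eigenvector \<open>W\<close>. Each nonzero block
  \<open>J \<alpha> \<beta> * W\<close> is again an eigenvector, and the task is to show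
  \<open>exp (l i) = \<alpha>\<close> and \<open>exp (m i) = \<beta>\<close> for its branch
  \<open>i\<close>.\<close>

lemma exp_pencil_distinct:
  assumes fin: "finite F" "finite F'" and sum1: "(\<Sum>\<alpha>\<in>F. E \<alpha>) = 1" "(\<Sum>\<beta>\<in>F'. E' \<beta>) = 1"
    and idem: "\<And>\<alpha>. \<alpha> \<in> F \<Longrightarrow> E \<alpha> * E \<alpha> = E \<alpha>" "\<And>\<beta>. \<beta> \<in> F' \<Longrightarrow> E' \<beta> * E' \<beta> = E' \<beta>"
    and comm: "\<And>\<alpha> \<beta>. \<alpha> \<in> F \<Longrightarrow> \<beta> \<in> F' \<Longrightarrow> E \<alpha> * E' \<beta> = E' \<beta> * E \<alpha>"
    and D1: "\<And>\<alpha>. \<alpha> \<in> F \<Longrightarrow> D1 * E \<alpha> = E \<alpha> * D1" "\<And>\<beta>. \<beta> \<in> F' \<Longrightarrow> D1 * E' \<beta> = E' \<beta> * D1"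
    and D2: "\<And>\<alpha>. \<alpha> \<in> F \<Longrightarrow> D2 * E \<alpha> = E \<alpha> * D2" "\<And>\<beta>. \<beta> \<in> F' \<Longrightarrow> D2 * E' \<beta> = E' \<beta> * D2"
    and e1: "\<And>\<alpha>. \<alpha> \<in> F \<Longrightarrow> exp D1 * E \<alpha> = sc \<alpha> (E \<alpha>)"
    and e2: "\<And>\<beta>. \<beta> \<in> F' \<Longrightarrow> exp D2 * E' \<beta> = sc \<beta> (E' \<beta>)"
    and ls: "linear_spectrum D1 D2 l m"
    and dist: "\<And>i j. i < 3 \<Longrightarrow> j < 3 \<Longrightarrow> i \<noteq> j \<Longrightarrow> (l i, m i) \<noteq> (l j, m j)"
  shows "finite {t :: nat. exp (cs (of_nat t) * D1 + D2) \<noteq> exp D1 ^ t * exp D2}"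
proof -
  define J where "J = (\<lambda>\<alpha> \<beta>. E \<alpha> * E' \<beta>)"
  have JJ: "J \<alpha> \<beta> * J \<alpha> \<beta> = J \<alpha> \<beta>" if "\<alpha> \<in> F" "\<beta> \<in> F'" for \<alpha> \<beta>
    unfolding J_def using idem comm that by (metis mult.assoc)
  have JD: "D1 * J \<alpha> \<beta> = J \<alpha> \<beta> * D1" "D2 * J \<alpha> \<beta> = J \<alpha> \<beta> * D2" if "\<alpha> \<in> F" "\<beta> \<in> F'" for \<alpha> \<beta>
    unfolding J_def using D1 D2 that by (metis mult.assoc)+
  have eJ: "exp D1 * J \<alpha> \<beta> = sc \<alpha> (J \<alpha> \<beta>)" "exp D2 * J \<alpha> \<beta> = sc \<beta> (J \<alpha> \<beta>)"
    if "\<alpha> \<in> F" "\<beta> \<in> F'" for \<alpha> \<beta>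
  proof -
    show "exp D1 * J \<alpha> \<beta> = sc \<alpha> (J \<alpha> \<beta>)"
      using e1[OF that(1)] by (simp add: J_def sc_ring flip: mult.assoc)
    show "exp D2 * J \<alpha> \<beta> = sc \<beta> (J \<alpha> \<beta>)"
      unfolding J_def comm[OF that] using e2[OF that(2)] by (simp add: sc_ring flip: mult.assoc)
  qed
  have sumJ: "(\<Sum>\<alpha>\<in>F. \<Sum>\<beta>\<in>F'. J \<alpha> \<beta>) = 1"
    using sum1 by (simp add: J_def flip: sum_product)
  define sing where "sing = (\<lambda>i \<alpha> \<beta>. {t :: nat. \<exists>V. V \<noteq> 0 \<and> J \<alpha> \<beta> * V = V \<and>
    (cs (of_nat t) * (D1 - cs (l i)) + (D2 - cs (m i))) * V = 0})"
  \<comment> \<open>Parameters at which two of the three branches collide.\<close>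
  define Bad1 where "Bad1 = (\<Union>i\<in>{..<3}. \<Union>j\<in>{..<3} - {i}.
    {t :: nat. of_nat t * (l i - l j) + (m i - m j) = 0})"
  \<comment> \<open>A branch that meets a joint eigenspace for finitely many \<open>t\<close> only
    is discarded together with these \<open>t\<close>; every remaining incidence occurs infinitely
    often, which is what the limit argument needs.\<close>
  define Bad2 where "Bad2 = (\<Union>i\<in>{..<3}. \<Union>\<alpha>\<in>F. \<Union>\<beta>\<in>F'.
    if finite (sing i \<alpha> \<beta>) then sing i \<alpha> \<beta> else {})"
  have "finite Bad1" unfolding Bad1_def
    using dist by (intro finite_UN_I finite_linear_zeros) auto
  moreover have "finite Bad2" unfolding Bad2_def
    using fin by (intro finite_UN_I) auto
  moreover have "exp (cs (of_nat t) * D1 + D2) = exp D1 ^ t * exp D2" if t: "t \<notin> Bad1 \<union> Bad2" for t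
  proof -
    let ?C = "cs (of_nat t) * D1 + D2" and ?G = "exp D1 ^ t * exp D2"
    define L where "L = (\<lambda>i. of_nat t * l i + m i)"
    have Lne: "L i \<noteq> L j" if "i < 3" "j < 3" "i \<noteq> j" for i j
      using t that by (auto simp: Bad1_def L_def algebra_simps)
    have eigL: "eigval ?C (L i)" if "i < 3" for i
      using ls[unfolded linear_spectrum_def, rule_format, of "of_nat t" 1 "L i"] that
      by (auto simp: L_def)
    show ?thesis
    proof (rule matrix_eq_if_agree_on_eigenvectors)
      show "(?C - cs (L 0)) * (?C - cs (L 1)) * (?C - cs (L 2)) = 0"
        by (intro cubic_three_roots eigL Lne) auto
      show "L 0 \<noteq> L 1" "L 0 \<noteq> L 2" "L 1 \<noteq> L 2" by (rule Lne; simp)+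
      fix x W assume "x \<in> {L 0, L 1, L 2}" and W: "?C * W = cs x * W"
      have "(0::nat) < 3" "(1::nat) < 3" "(2::nat) < 3" by simp_all
      then obtain i where i: "i < 3" "x = L i" using \<open>x \<in> {L 0, L 1, L 2}\<close> by blast
      have "?G * (J \<alpha> \<beta> * W) = sc (exp x) (J \<alpha> \<beta> * W)" if ab: "\<alpha> \<in> F" "\<beta> \<in> F'" for \<alpha> \<beta>
      proof (cases "J \<alpha> \<beta> * W = 0")
        case False
        have CJ: "?C * J \<alpha> \<beta> = J \<alpha> \<beta> * ?C"
          using JD[OF ab] by (simp add: distrib_left distrib_right sc_ring)
        have "?C * (J \<alpha> \<beta> * W) = J \<alpha> \<beta> * (?C * W)" using CJ by (metis mult.assoc)
        then have "?C * (J \<alpha> \<beta> * W) = sc x (J \<alpha> \<beta> * W)" unfolding W by (simp add: sc_ring)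
        then have "(cs (of_nat t) * (D1 - cs (l i)) + (D2 - cs (m i))) * (J \<alpha> \<beta> * W) = 0"
          by (simp add: i(2) L_def algebra_simps sc_ring)
        moreover have "J \<alpha> \<beta> * (J \<alpha> \<beta> * W) = J \<alpha> \<beta> * W" using JJ[OF ab] by (metis mult.assoc)
        ultimately have "t \<in> sing i \<alpha> \<beta>" using False by (auto simp: sing_def)
        with t ab i(1) have inf: "infinite (sing i \<alpha> \<beta>)" by (auto simp: Bad2_def split: if_splits)
        have c: "(D1 - cs (l i)) * J \<alpha> \<beta> = J \<alpha> \<beta> * (D1 - cs (l i))"
          "(D2 - cs (m i)) * J \<alpha> \<beta> = J \<alpha> \<beta> * (D2 - cs (m i))"
          using JD[OF ab] by (simp_all add: algebra_simps sc_ring)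
        \<comment> \<open>The two ends of the pencil yield eigenvectors of \<open>D1\<close> for
          \<open>l i\<close> and of \<open>D2\<close> for \<open>m i\<close> inside the same joint
          eigenspace, so the exponentials are matched separately.\<close>
        note lim = pencil_kernel_limits[OF JJ[OF ab] c inf[unfolded sing_def]]
        obtain V where V: "V \<noteq> 0" "J \<alpha> \<beta> * V = V" "(D1 - cs (l i)) * V = 0" using lim(1) by blast
        have "exp D1 * V = sc (exp (l i)) V" using exp_eigen[of D1 V "l i"] V(3)
          by (simp add: left_diff_distrib sc_def)
        moreover have "exp D1 * V = sc \<alpha> V" using eJ(1)[OF ab] V(2) by (metis mult.assoc sc_ring(4))
        ultimately have "sc (exp (l i) - \<alpha>) V = 0" by (simp add: sc_ring)
        then have el: "exp (l i) = \<alpha>" using V(1) by (simp add: sc_eq_0_iff)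
        obtain V where V: "V \<noteq> 0" "J \<alpha> \<beta> * V = V" "(D2 - cs (m i)) * V = 0" using lim(2) by blast
        have "exp D2 * V = sc (exp (m i)) V" using exp_eigen[of D2 V "m i"] V(3)
          by (simp add: left_diff_distrib sc_def)
        moreover have "exp D2 * V = sc \<beta> V" using eJ(2)[OF ab] V(2) by (metis mult.assoc sc_ring(4))
        ultimately have "sc (exp (m i) - \<beta>) V = 0" by (simp add: sc_ring)
        then have em: "exp (m i) = \<beta>" using V(1) by (simp add: sc_eq_0_iff)
        have pw: "exp D1 ^ n * J \<alpha> \<beta> = sc (\<alpha> ^ n) (J \<alpha> \<beta>)" for n
          by (induction n) (simp_all add: sc_ring mult.assoc eJ[OF ab] mult.commute)
        have "exp x = \<alpha> ^ t * \<beta>" by (simp add: i(2) L_def exp_add exp_of_nat_mult el em)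
        moreover have "?G * J \<alpha> \<beta> = sc (\<alpha> ^ t * \<beta>) (J \<alpha> \<beta>)"
          by (simp add: mult.assoc eJ[OF ab] sc_ring pw mult.commute)
        ultimately show ?thesis by (metis mult.assoc sc_ring(4))
      qed (simp add: sc_ring)
      then have "(\<Sum>\<alpha>\<in>F. \<Sum>\<beta>\<in>F'. ?G * (J \<alpha> \<beta> * W)) = (\<Sum>\<alpha>\<in>F. \<Sum>\<beta>\<in>F'. sc (exp x) (J \<alpha> \<beta> * W))"
        by (intro sum.cong refl)
      then have "?G * ((\<Sum>\<alpha>\<in>F. \<Sum>\<beta>\<in>F'. J \<alpha> \<beta>) * W) = sc (exp x) ((\<Sum>\<alpha>\<in>F. \<Sum>\<beta>\<in>F'. J \<alpha> \<beta>) * W)"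
        by (simp only: sum_distrib_left sum_distrib_right sc_sum)
      then have "?G * W = sc (exp x) W" by (simp add: sumJ)
      then show "exp ?C * W = ?G * W" using exp_eigen[OF W] by (simp add: sc_def)
    qed
  qed
  then have "{t :: nat. exp (cs (of_nat t) * D1 + D2) \<noteq> exp D1 ^ t * exp D2} \<subseteq> Bad1 \<union> Bad2" by blast
  ultimately show ?thesis using finite_subset by blast
qed

text \<open>\<open>X / r\<close> is idempotent: \<open>exp X\<close> acts as \<open>exp r\<close> on
  \<open>X\<close> and as 1 on \<open>cs r - X\<close>, and \<open>cs r\<close> is the sum of the
  two.\<close>

lemma exp_scaled_idempotent:
  assumes "X * X = sc r X" "r \<noteq> 0"
  shows "exp X = 1 + sc ((exp r - 1) / r) X"
proof -
  have "exp X * X = sc (exp r) X" using exp_eigen[of X X r] assms(1) by (simp add: sc_def)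
  moreover have "exp X * (cs r - X) = cs r - X"
    using exp_eigen[of X "cs r - X" 0] assms(1) by (simp add: right_diff_distrib sc_ring)
  ultimately have "sc r (exp X) = cs r + sc (exp r - 1) X"
    by (simp add: right_diff_distrib sc_ring algebra_simps)
  then have "sc (1 / r) (sc r (exp X)) = sc (1 / r) (cs r + sc (exp r - 1) X)" by simp
  then show ?thesis using assms(2) by (simp add: sc_ring(3,6,7,14))
qed

text \<open>If \<open>X\<close> and \<open>Y\<close> do not commute, the explicit exponentials force
  \<open>a = b = c = 0\<close>, so \<open>exp X = exp Y = 1\<close> and \<open>r\<close>,
  \<open>s\<close> are periods of \<open>exp\<close>. Each \<open>t * X + Y\<close> is again a
  multiple of an idempotent, with factor \<open>t * r + s\<close>, so its exponential is 1 unless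
  that factor vanishes.\<close>

lemma exp_pencil_coincident:
  assumes e: "exp (X + Y) = exp X * exp Y" "exp X * exp Y = exp Y * exp X"
    and sq: "X * X = sc r X" "Y * Y = sc s Y" "(X + Y) * (X + Y) = sc (r + s) (X + Y)"
    and z: "r = 0 \<Longrightarrow> X = 0" "s = 0 \<Longrightarrow> Y = 0" "r + s = 0 \<Longrightarrow> X + Y = 0"
  shows "finite {t :: nat. exp (cs (of_nat t) * X + Y) \<noteq> exp X ^ t * exp Y}"
proof (cases "X * Y = Y * X")
  case True
  then have "exp (cs (of_nat t) * X + Y) = exp X ^ t * exp Y" for t
    by (subst exp_add_commuting) (simp_all add: sc_ring flip: exp_of_nat_cs)
  then show ?thesis by simp
next
  case False
  have "Y = - X" if "X + Y = 0" using that by (simp add: add_eq_0_iff)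
  then have nz: "r \<noteq> 0" "s \<noteq> 0" "r + s \<noteq> 0" using z False by auto
  define a b c where "a = (exp r - 1) / r" and "b = (exp s - 1) / s"
    and "c = (exp (r + s) - 1) / (r + s)"
  have ex: "exp X = 1 + sc a X" "exp Y = 1 + sc b Y" "exp (X + Y) = 1 + sc c (X + Y)"
    unfolding a_def b_def c_def using sq nz by (simp_all add: exp_scaled_idempotent)
  have "sc (a * b) (X * Y - Y * X) = 0"
    using e(2) unfolding ex by (simp add: algebra_simps sc_ring)
  then have ab: "a * b = 0" using False by (simp add: sc_eq_0_iff)
  have "sc c (X + Y) = sc a X + sc b Y + sc (a * b) (X * Y)"
    using e(1) unfolding ex by (simp add: algebra_simps sc_ring)
  then have lin: "sc (a - c) X = sc (c - b) Y" unfolding ab by (simp add: sc_ring algebra_simps)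
  have ac: "a = c"
  proof (rule ccontr)
    assume "a \<noteq> c"
    then have "X = sc (1 / (a - c)) (sc (c - b) Y)"
      unfolding lin[symmetric] by (simp only: sc_ring(6)) (simp add: sc_ring)
    then have "X * Y = Y * X" by (metis sc_ring(4,5))
    with False show False by simp
  qed
  then have "c = b" using lin False by (auto simp: sc_eq_0_iff sc_ring(13))
  with ab ac have "a = 0" "b = 0" by auto
  with nz have er: "exp r = 1" "exp s = 1" by (auto simp: a_def b_def)
  have eX: "exp X = 1" "exp Y = 1" using ex \<open>a = 0\<close> \<open>b = 0\<close> by (simp_all add: sc_ring)
  \<comment> \<open>The relation for \<open>(X + Y) * (X + Y)\<close> determines the anticommutator,
    and thereby the square of every \<open>t * X + Y\<close>.\<close>
  have XY: "X * Y + Y * X = sc r Y + sc s X"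
    using sq by (simp add: algebra_simps sc_ring)
  have "exp (cs (of_nat t) * X + Y) = exp X ^ t * exp Y" if "of_nat t * r + s \<noteq> 0" for t :: nat
  proof -
    let ?t = "of_nat t :: complex"
    let ?Z = "cs ?t * X + Y"
    have "?Z * ?Z = sc (?t * ?t) (X * X) + sc ?t (X * Y + Y * X) + Y * Y"
      by (simp add: algebra_simps sc_ring)
    also have "\<dots> = sc (?t * r + s) ?Z"
      unfolding XY sq(1,2) by (simp add: algebra_simps sc_ring)
    finally have "exp ?Z = 1 + sc ((exp (?t * r + s) - 1) / (?t * r + s)) ?Z"
      using that by (rule exp_scaled_idempotent)
    then show ?thesis by (simp add: eX exp_add exp_of_nat_mult er sc_ring)
  qed
  then have "{t :: nat. exp (cs (of_nat t) * X + Y) \<noteq> exp X ^ t * exp Y}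
    \<subseteq> {t. of_nat t * r + s = 0}" by blast
  then show ?thesis using finite_linear_zeros[of r s] nz finite_subset by blast
qed

text \<open>A Jordan block of \<open>D\<close> would give \<open>exp D\<close> the block
  \<open>exp a * (1 + N)\<close>, which a diagonalizable matrix cannot have.\<close>

lemma exp_semisimple:
  fixes J :: "'b \<Rightarrow> cmat3"
  assumes sum1: "(\<Sum>i\<in>I. J i) = 1" and comm: "\<And>i. i \<in> I \<Longrightarrow> D * J i = J i * D"
    and eig: "\<And>i. i \<in> I \<Longrightarrow> exp D * J i = sc (c i) (J i)"
    and W: "(D - cs a) * ((D - cs a) * W) = 0"
  shows "(D - cs a) * W = 0"
proof -
  define N where "N = D - cs a"
  note W = W[folded N_def]
  have "exp D = exp (cs a + N)" by (simp add: N_def)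
  also have "\<dots> = sc (exp a) (exp N)"
    by (subst exp_add_commuting) (simp_all add: sc_ring exp_cs)
  finally have eD: "exp D = sc (exp a) (exp N)" .
  have 1: "(exp D - cs (exp a)) * W = sc (exp a) (N * W)"
    unfolding eD left_diff_distrib sc_ring(4) exp_mult_square_zero[OF W] by (simp add: sc_ring)
  have 2: "(exp D - cs (exp a)) * (N * W) = 0"
    unfolding eD left_diff_distrib sc_ring(4)
    using exp_mult_square_zero[of N "N * W"] W by (simp add: sc_ring)
  have "J i * (N * W) = 0" if i: "i \<in> I" for i
  proof -
    define d where "d = c i - exp a"
    have eJ: "exp D * J i = J i * exp D" using exp_commute[of "J i" D] comm[OF i] by simp
    have JP: "J i * ((exp D - cs (exp a)) * Z) = sc d (J i * Z)" for Z
    proof -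
      have "J i * (exp D - cs (exp a)) = (exp D - cs (exp a)) * J i"
        using eJ by (simp add: left_diff_distrib right_diff_distrib sc_ring)
      also have "\<dots> = sc d (J i)" using eig[OF i] by (simp add: d_def left_diff_distrib sc_ring)
      finally show ?thesis by (metis mult.assoc sc_ring(4))
    qed
    have "sc d (J i * (N * W)) = 0" using JP[of "N * W"] 2 by simp
    moreover have "sc d (J i * W) = sc (exp a) (J i * (N * W))"
      using JP[of W] 1 by (simp add: sc_ring)
    \<comment> \<open>If \<open>d = 0\<close> the second relation gives the claim, otherwise the
      first.\<close>
    ultimately show ?thesis by (auto simp: sc_eq_0_iff sc_ring)
  qed
  then have "(\<Sum>i\<in>I. J i) * (N * W) = 0" by (simp only: sum_distrib_right) simp
  then show ?thesis by (simp add: sum1 N_def)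
qed

text \<open>Each factor of the Cayley-Hamilton product is \<open>D - cs a\<close> or
  \<open>D - cs b\<close>, and \<open>red\<close> cancels repetitions. The case \<open>a = b\<close>
  is included.\<close>

lemma semisimple_two_eigenvalues:
  assumes red: "\<And>a W. (D - cs a) * ((D - cs a) * W) = 0 \<Longrightarrow> (D - cs a) * W = 0"
    and eig: "\<And>z. eigval D z \<Longrightarrow> z = a \<or> z = b"
  shows "(D - cs a) * (D - cs b) = 0"
proof -
  obtain p q r where pqr: "e1 D = p + q + r" "e2 D = p * q + p * r + q * r" "e3 D = p * q * r"
    "\<forall>x. char_fun D x = (x - p) * (x - q) * (x - r)"
    using char_fun_roots[of D] by blast
  define A B where "A = D - cs a" and "B = D - cs b"
  have AB: "A * B = B * A" by (simp add: A_def B_def algebra_simps sc_ring)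
  have rA: "A * W = 0" if "A * (A * W) = 0" for W using red that by (simp add: A_def)
  have rB: "B * W = 0" if "B * (B * W) = 0" for W using red that by (simp add: B_def)
  define P Q R where "P = D - cs p" and "Q = D - cs q" and "R = D - cs r"
  have "p = a \<or> p = b" "q = a \<or> q = b" "r = a \<or> r = b"
    using eig pqr(4) by (auto simp: eigval_iff_char_fun)
  then have PQR: "P = A \<or> P = B" "Q = A \<or> Q = B" "R = A \<or> R = B"
    unfolding P_def Q_def R_def A_def B_def by blast+
  have zero: "P * (Q * R) = 0"
    using Cayley_Hamilton3[OF pqr(1-3)] by (simp only: mult.assoc P_def Q_def R_def)
  have perm: "A * (B * A) = A * (A * B)" "B * (A * A) = A * (A * B)"
    "A * (B * B) = B * (B * A)" "B * (A * B) = B * (B * A)"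
    using AB by (metis mult.assoc)+
  from PQR zero consider "A * (A * A) = 0" | "A * (A * B) = 0" | "B * (B * A) = 0" | "B * (B * B) = 0"
    using perm by metis
  then have "A * B = 0"
  proof cases
    case 1
    then have "A * (A * 1) = 0" using rA[of A] by simp
    then have "A * 1 = 0" by (rule rA)
    then show ?thesis by simp
  next
    case 2
    then show ?thesis by (rule rA)
  next
    case 3
    then show ?thesis unfolding AB by (rule rB)
  next
    case 4
    then have "B * (B * 1) = 0" using rB[of B] by simp
    then have "B * 1 = 0" by (rule rB)
    then show ?thesis by simp
  qed
  then show ?thesis by (simp add: A_def B_def)
qed

section \<open>Pencils with linear spectrum\<close>

lemma power_mult_distrib_commute:
  fixes X Y :: "'a :: monoid_mult"
  assumes "X * Y = Y * X"
  shows "(X * Y) ^ n = X ^ n * Y ^ n"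
proof (induction n)
  case (Suc n)
  have "Y * X ^ n = X ^ n * Y" by (rule commute_power[OF assms, symmetric])
  then have "X * Y * (X ^ n * Y ^ n) = X * X ^ n * (Y * Y ^ n)" by (metis mult.assoc)
  then show ?case by (simp add: Suc)
qed simp

lemma shifted_quadratic:
  assumes "(D - cs a) * (D - cs b) = 0"
  shows "(D - cs a) * (D - cs a) = sc (b - a) (D - cs a)"
proof -
  have "(D - cs a) * (D - cs a) - sc (b - a) (D - cs a) = (D - cs a) * (D - cs b)"
    by (simp add: algebra_simps sc_ring cs_diff)
  then show ?thesis using assms by simp
qed

lemma exp_pencil_semisimple:
  assumes fin: "finite F" "finite F'" and sum1: "(\<Sum>\<alpha>\<in>F. E \<alpha>) = 1" "(\<Sum>\<beta>\<in>F'. E' \<beta>) = 1"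
    and idem: "\<And>\<alpha>. \<alpha> \<in> F \<Longrightarrow> E \<alpha> * E \<alpha> = E \<alpha>" "\<And>\<beta>. \<beta> \<in> F' \<Longrightarrow> E' \<beta> * E' \<beta> = E' \<beta>"
    and comm: "\<And>\<alpha> \<beta>. \<alpha> \<in> F \<Longrightarrow> \<beta> \<in> F' \<Longrightarrow> E \<alpha> * E' \<beta> = E' \<beta> * E \<alpha>"
    and D1: "\<And>\<alpha>. \<alpha> \<in> F \<Longrightarrow> D1 * E \<alpha> = E \<alpha> * D1" "\<And>\<beta>. \<beta> \<in> F' \<Longrightarrow> D1 * E' \<beta> = E' \<beta> * D1"
    and D2: "\<And>\<alpha>. \<alpha> \<in> F \<Longrightarrow> D2 * E \<alpha> = E \<alpha> * D2" "\<And>\<beta>. \<beta> \<in> F' \<Longrightarrow> D2 * E' \<beta> = E' \<beta> * D2"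
    and e1: "\<And>\<alpha>. \<alpha> \<in> F \<Longrightarrow> exp D1 * E \<alpha> = sc \<alpha> (E \<alpha>)"
    and e2: "\<And>\<beta>. \<beta> \<in> F' \<Longrightarrow> exp D2 * E' \<beta> = sc \<beta> (E' \<beta>)"
    and ls: "linear_spectrum D1 D2 l m"
    and e: "exp (D1 + D2) = exp D1 * exp D2" "exp D1 * exp D2 = exp D2 * exp D1"
  shows "finite {t :: nat. exp (cs (of_nat t) * D1 + D2) \<noteq> exp D1 ^ t * exp D2}"
proof (cases "\<forall>i<3. \<forall>j<3. i \<noteq> j \<longrightarrow> (l i, m i) \<noteq> (l j, m j)")
  case True
  then show ?thesis by (intro exp_pencil_distinct[OF fin sum1 idem comm D1 D2 e1 e2 ls]) auto
next
  case False
  then obtain i j where ij: "i < 3" "j < 3" "i \<noteq> j" "l i = l j" "m i = m j" by blast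
  \<comment> \<open>The third index, because \<open>0 + 1 + 2 = 3\<close>.\<close>
  define k where "k = 3 - i - j"
  have k: "n = i \<or> n = j \<or> n = k" if "n < 3" for n
    using less3_cases[OF that] less3_cases[OF ij(1)] less3_cases[OF ij(2)] ij(3)
    by (elim disjE; simp add: k_def)+
  have two: "z = x * l i + y * m i \<or> z = x * l k + y * m k" if "\<exists>n<3. z = x * l n + y * m n" for x y z
  proof -
    from that obtain n where n: "n < 3" "z = x * l n + y * m n" by blast
    show ?thesis using k[OF n(1)] n(2) ij(4,5) by (elim disjE) simp_all
  qed
  have spec: "eigval (cs x * D1 + cs y * D2) z \<Longrightarrow> z = x * l i + y * m i \<or> z = x * l k + y * m k" for x y z
    using ls two unfolding linear_spectrum_def by blast
  define r s where "r = l k - l i" and "s = m k - m i"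
  define X Y where "X = D1 - cs (l i)" and "Y = D2 - cs (m i)"
  have XY: "X + Y = D1 + D2 - cs (l i + m i)" by (simp add: X_def Y_def cs_add)
  have red1: "(D1 - cs a) * W = 0" if "(D1 - cs a) * ((D1 - cs a) * W) = 0" for a W
    by (rule exp_semisimple[OF sum1(1) D1(1) e1 that])
  have red2: "(D2 - cs a) * W = 0" if "(D2 - cs a) * ((D2 - cs a) * W) = 0" for a W
    by (rule exp_semisimple[OF sum1(2) D2(2) e2 that])
  \<comment> \<open>Here \<open>exp (D1 + D2)\<close> is diagonalized by the products
    \<open>E \<alpha> * E' \<beta>\<close>, since by hypothesis it is the product of the two
    exponentials.\<close>
  have red3: "(D1 + D2 - cs a) * W = 0" if "(D1 + D2 - cs a) * ((D1 + D2 - cs a) * W) = 0" for a W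
  proof (rule exp_semisimple[where J = "\<lambda>(\<alpha>, \<beta>). E \<alpha> * E' \<beta>" and I = "F \<times> F'"
        and c = "\<lambda>(\<alpha>, \<beta>). \<alpha> * \<beta>", OF _ _ _ that])
    show "(\<Sum>(\<alpha>, \<beta>)\<in>F \<times> F'. E \<alpha> * E' \<beta>) = 1"
      using sum1 by (simp flip: sum.cartesian_product sum_product)
    fix p assume "p \<in> F \<times> F'"
    then obtain \<alpha> \<beta> where p: "p = (\<alpha>, \<beta>)" "\<alpha> \<in> F" "\<beta> \<in> F'" by auto
    have "D * (E \<alpha> * E' \<beta>) = E \<alpha> * E' \<beta> * D" if "D \<in> {D1, D2}" for D
      using that p D1 D2 by (metis insert_iff empty_iff mult.assoc)
    then show "(D1 + D2) * (case p of (\<alpha>, \<beta>) \<Rightarrow> E \<alpha> * E' \<beta>) = (case p of (\<alpha>, \<beta>) \<Rightarrow> E \<alpha> * E' \<beta>) * (D1 + D2)"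
      by (simp add: p(1) distrib_left distrib_right)
    have "exp D1 * exp D2 * (E \<alpha> * E' \<beta>) = exp D1 * (exp D2 * E' \<beta>) * E \<alpha>"
      by (simp only: mult.assoc comm[OF p(2,3)])
    also have "\<dots> = sc \<beta> (exp D1 * E \<alpha> * E' \<beta>)"
      using comm[OF p(2,3)] by (simp add: e2[OF p(3)] sc_ring mult.assoc)
    also have "\<dots> = sc (\<alpha> * \<beta>) (E \<alpha> * E' \<beta>)"
      by (simp add: e1[OF p(2)] sc_ring mult.commute)
    finally show "exp (D1 + D2) * (case p of (\<alpha>, \<beta>) \<Rightarrow> E \<alpha> * E' \<beta>)
      = sc (case p of (\<alpha>, \<beta>) \<Rightarrow> \<alpha> * \<beta>) (case p of (\<alpha>, \<beta>) \<Rightarrow> E \<alpha> * E' \<beta>)"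
      by (simp add: p(1) e(1))
  qed
  have q1: "(D1 - cs (l i)) * (D1 - cs (l k)) = 0"
    by (rule semisimple_two_eigenvalues[OF red1]) (assumption, use spec[of 1 0] in simp)
  have q2: "(D2 - cs (m i)) * (D2 - cs (m k)) = 0"
    by (rule semisimple_two_eigenvalues[OF red2]) (assumption, use spec[of 0 1] in simp)
  have q3: "(D1 + D2 - cs (l i + m i)) * (D1 + D2 - cs (l k + m k)) = 0"
    by (rule semisimple_two_eigenvalues[OF red3]) (assumption, use spec[of 1 1] in simp)
  have sq: "X * X = sc r X" "Y * Y = sc s Y" "(X + Y) * (X + Y) = sc (r + s) (X + Y)"
    using shifted_quadratic[OF q1] shifted_quadratic[OF q2] shifted_quadratic[OF q3]
    unfolding XY by (simp_all add: X_def Y_def r_def s_def algebra_simps)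
  have z: "X = 0" if "r = 0"
    using red1[of "l i" 1] sq(1) that by (simp add: X_def sc_ring)
  have z': "Y = 0" if "s = 0"
    using red2[of "m i" 1] sq(2) that by (simp add: Y_def sc_ring)
  have z'': "X + Y = 0" if "r + s = 0"
    using red3[of "l i + m i" 1] sq(3) that unfolding XY by (simp add: sc_ring)
  have shift: "exp (cs a + Z) = sc (exp a) (exp Z)" for a Z
    by (subst exp_add_commuting) (simp_all add: sc_ring exp_cs)
  have D12: "D1 = cs (l i) + X" "D2 = cs (m i) + Y" "D1 + D2 = cs (l i + m i) + (X + Y)"
    by (simp_all add: X_def Y_def cs_add)
  have cancel: "A = B" if "sc (exp a) A = sc (exp a) B" for a A B
  proof -
    have "sc (exp (- a)) (sc (exp a) A) = sc (exp (- a)) (sc (exp a) B)" using that by simp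
    then show ?thesis by (simp add: sc_ring flip: exp_add)
  qed
  have "sc (exp (l i + m i)) (exp (X + Y)) = sc (exp (l i + m i)) (exp X * exp Y)"
    using e(1) unfolding D12(3) shift unfolding D12(1,2) shift by (simp add: sc_ring exp_add mult.commute)
  then have e': "exp (X + Y) = exp X * exp Y" by (rule cancel)
  have "sc (exp (l i + m i)) (exp X * exp Y) = sc (exp (l i + m i)) (exp Y * exp X)"
    using e(2) unfolding D12(1,2) shift by (simp add: sc_ring exp_add mult.commute)
  then have e'': "exp X * exp Y = exp Y * exp X" by (rule cancel)
  have "exp (cs (of_nat t) * D1 + D2) = exp D1 ^ t * exp D2"
    if "exp (cs (of_nat t) * X + Y) = exp X ^ t * exp Y" for t :: nat
  proof -
    have "cs (of_nat t) * D1 + D2 = cs (of_nat t * l i + m i) + (cs (of_nat t) * X + Y)"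
      unfolding D12(1,2) by (simp add: algebra_simps sc_ring cs_add)
    then have 1: "exp (cs (of_nat t) * D1 + D2) = sc (exp (of_nat t * l i + m i)) (exp X ^ t * exp Y)"
      by (simp add: shift that)
    have "exp D1 ^ t = sc (exp (l i) ^ t) (exp X ^ t)"
      unfolding D12(1) shift by (induction t) (simp_all add: sc_ring mult.commute[of "exp (l i)"])
    then have "exp D1 ^ t * exp D2 = sc (exp (l i) ^ t * exp (m i)) (exp X ^ t * exp Y)"
      unfolding D12(2) shift by (simp add: sc_ring mult.commute[of "exp (m i)"])
    then show ?thesis unfolding 1 by (simp only: exp_add exp_of_nat_mult)
  qed
  then have "{t :: nat. exp (cs (of_nat t) * D1 + D2) \<noteq> exp D1 ^ t * exp D2}
    \<subseteq> {t :: nat. exp (cs (of_nat t) * X + Y) \<noteq> exp X ^ t * exp Y}" by blast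
  then show ?thesis using exp_pencil_coincident[OF e' e'' sq z z' z''] finite_subset by blast
qed

text \<open>\<open>N\<close> and \<open>M\<close> commute with each other and with all idempotents,
  by the bicommutant property. The exponentials therefore factor, and the relation for
  \<open>A\<close>, \<open>B\<close> at \<open>t\<close> is the one for \<open>D1\<close>,
  \<open>D2\<close> times the one for the commuting pair \<open>N\<close>, \<open>M\<close>.\<close>

lemma exp_pencil_linear_spectrum:
  assumes e: "exp (A + B) = exp A * exp B" "exp A * exp B = exp B * exp A"
    and ls: "linear_spectrum A B l m"
  shows "finite {t :: nat. exp (cs (of_nat t) * A + B) \<noteq> exp (cs (of_nat t) * A) * exp B}"
proof -
  obtain F E N where res: "spectral_resolution (exp A) F E" and N3: "N * N * N = 0"
    and N: "\<And>Z. Z * exp A = exp A * Z \<Longrightarrow> Z * N = N * Z"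
    and eE: "\<And>\<alpha>. \<alpha> \<in> F \<Longrightarrow> exp (A - N) * E \<alpha> = sc \<alpha> (E \<alpha>)"
    by (rule exp_spectral_splitting[of A]) blast
  obtain F' E' M where res': "spectral_resolution (exp B) F' E'" and M3: "M * M * M = 0"
    and M: "\<And>Z. Z * exp B = exp B * Z \<Longrightarrow> Z * M = M * Z"
    and eE': "\<And>\<beta>. \<beta> \<in> F' \<Longrightarrow> exp (B - M) * E' \<beta> = sc \<beta> (E' \<beta>)"
    by (rule exp_spectral_splitting[of B]) blast
  have fin: "finite F" and sum1: "(\<Sum>\<alpha>\<in>F. E \<alpha>) = 1"
    and orth: "\<And>\<alpha> \<beta>. \<alpha> \<in> F \<Longrightarrow> \<beta> \<in> F \<Longrightarrow> \<alpha> \<noteq> \<beta> \<Longrightarrow> E \<alpha> * E \<beta> = 0"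
    and cE: "\<And>\<alpha> Z. \<alpha> \<in> F \<Longrightarrow> Z * exp A = exp A * Z \<Longrightarrow> Z * E \<alpha> = E \<alpha> * Z"
    using res[unfolded spectral_resolution_def] by blast+
  have fin': "finite F'" and sum1': "(\<Sum>\<alpha>\<in>F'. E' \<alpha>) = 1"
    and orth': "\<And>\<alpha> \<beta>. \<alpha> \<in> F' \<Longrightarrow> \<beta> \<in> F' \<Longrightarrow> \<alpha> \<noteq> \<beta> \<Longrightarrow> E' \<alpha> * E' \<beta> = 0"
    and cE': "\<And>\<alpha> Z. \<alpha> \<in> F' \<Longrightarrow> Z * exp B = exp B * Z \<Longrightarrow> Z * E' \<alpha> = E' \<alpha> * Z"
    using res'[unfolded spectral_resolution_def] by blast+
  have idem: "E \<beta> * E \<beta> = E \<beta>" if "\<beta> \<in> F" for \<beta>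
    by (rule resolution_idem[OF fin that _ sum1]) (rule orth[OF _ that])
  have idem': "E' \<beta> * E' \<beta> = E' \<beta>" if "\<beta> \<in> F'" for \<beta>
    by (rule resolution_idem[OF fin' that _ sum1']) (rule orth'[OF _ that])
  have AS: "A * exp A = exp A * A" and BT: "B * exp B = exp B * B" by (simp_all add: exp_commute)
  have AE': "A * E' \<beta> = E' \<beta> * A" if "\<beta> \<in> F'" for \<beta>
    by (rule commute_spectral_idempotent[OF res' exp_commutator_commutes[OF e] that])
  \<comment> \<open>The exponential hypotheses are symmetric in \<open>A\<close> and
    \<open>B\<close>.\<close>
  have BE: "B * E \<alpha> = E \<alpha> * B" if "\<alpha> \<in> F" for \<alpha>
    by (rule commute_spectral_idempotent[OF res exp_commutator_commutes that])
      (use e in \<open>simp_all add: add.commute\<close>)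
  have AE: "A * E \<alpha> = E \<alpha> * A" if "\<alpha> \<in> F" for \<alpha> by (rule cE[OF that AS])
  have BE': "B * E' \<beta> = E' \<beta> * B" if "\<beta> \<in> F'" for \<beta> by (rule cE'[OF that BT])
  have TN: "exp B * N = N * exp B" by (rule N[OF e(2)[symmetric]])
  have SM: "exp A * M = M * exp A" by (rule M[OF e(2)])
  have NS: "N * exp A = exp A * N" by (rule N[symmetric]) simp
  have MT: "M * exp B = exp B * M" by (rule M[symmetric]) simp
  have AN: "A * N = N * A" by (rule N[OF AS])
  have BM: "B * M = M * B" by (rule M[OF BT])
  have NM: "N * M = M * N" by (rule M[OF TN[symmetric]])
  have NE: "N * E \<alpha> = E \<alpha> * N" if "\<alpha> \<in> F" for \<alpha> by (rule cE[OF that NS])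
  have NE': "N * E' \<beta> = E' \<beta> * N" if "\<beta> \<in> F'" for \<beta> by (rule cE'[OF that TN[symmetric]])
  have ME: "M * E \<alpha> = E \<alpha> * M" if "\<alpha> \<in> F" for \<alpha> by (rule cE[OF that SM[symmetric]])
  have ME': "M * E' \<beta> = E' \<beta> * M" if "\<beta> \<in> F'" for \<beta> by (rule cE'[OF that MT])
  have EE': "E \<alpha> * E' \<beta> = E' \<beta> * E \<alpha>" if "\<alpha> \<in> F" "\<beta> \<in> F'" for \<alpha> \<beta>
    by (rule cE[OF that(1), symmetric], rule cE'[OF that(2), symmetric]) (rule e(2))
  define D1 D2 where "D1 = A - N" and "D2 = B - M"
  have expA: "exp A = exp D1 * exp N" and D1N: "D1 * N = N * D1"
    using exp_add_commuting[of D1 N] AN by (simp_all add: D1_def algebra_simps)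
  have expB: "exp B = exp D2 * exp M" and D2M: "D2 * M = M * D2"
    using exp_add_commuting[of D2 M] BM by (simp_all add: D2_def algebra_simps)
  have expD1: "exp D1 = exp A * exp (- N)" and expD2: "exp D2 = exp B * exp (- M)"
    unfolding expA expB by (simp_all add: mult.assoc exp_times_exp_minus)
  have c: "X * (Y * exp (- Z)) = Y * exp (- Z) * X" if "X * Y = Y * X" "X * Z = Z * X" for X Y Z :: cmat3
  proof -
    have "X * exp (- Z) = exp (- Z) * X" by (rule exp_commute) (use that(2) in simp)
    then show ?thesis using that(1) by (metis mult.assoc)
  qed
  have MD1: "M * exp D1 = exp D1 * M" unfolding expD1 by (rule c) (simp_all add: SM NM)
  have ND2: "N * exp D2 = exp D2 * N" unfolding expD2 by (rule c) (simp_all add: TN NM)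
  have D1T: "exp B * exp D1 = exp D1 * exp B" unfolding expD1 by (rule c) (simp_all add: e(2) TN)
  have D1D2: "exp D1 * exp D2 = exp D2 * exp D1"
    unfolding expD2 by (rule c) (simp_all add: D1T MD1)
  have eN: "exp N * exp D2 = exp D2 * exp N"
    by (rule exp_intertwine) (rule ND2)
  have expNM: "exp (N + M) = exp N * exp M" by (rule exp_add_commuting[OF NM])
  have ST: "exp A * exp B = exp D1 * exp D2 * exp (N + M)"
    unfolding expA expB expNM using eN by (metis mult.assoc)
  \<comment> \<open>\<open>?X\<close> commutes with the idempotents, hence with
    \<open>exp D1\<close> and \<open>exp D2\<close>, which are scalar on their ranges, and with its
    own exponential \<open>exp D1 * exp D2 * exp (N + M)\<close>. Cancellation leaves
    \<open>exp (N + M)\<close>, and the nilpotent logarithm \<open>N + M\<close> follows.\<close>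
  let ?X = "A + B"
  have XE: "?X * E \<alpha> = E \<alpha> * ?X" if "\<alpha> \<in> F" for \<alpha>
    using AE[OF that] BE[OF that] by (simp add: algebra_simps)
  have XE': "?X * E' \<beta> = E' \<beta> * ?X" if "\<beta> \<in> F'" for \<beta>
    using AE'[OF that] BE'[OF that] by (simp add: algebra_simps)
  have XD1: "?X * exp D1 = exp D1 * ?X"
  proof (rule resolution_ext[OF sum1])
    fix \<alpha> assume a: "\<alpha> \<in> F"
    have "?X * exp D1 * E \<alpha> = sc \<alpha> (?X * E \<alpha>)" using eE[OF a] by (simp add: D1_def mult.assoc sc_ring)
    also have "\<dots> = exp D1 * ?X * E \<alpha>"
      using eE[OF a] XE[OF a] by (simp add: D1_def mult.assoc sc_ring(4) flip: mult.assoc[of _ "E \<alpha>"])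
    finally show "?X * exp D1 * E \<alpha> = exp D1 * ?X * E \<alpha>" .
  qed
  have XD2: "?X * exp D2 = exp D2 * ?X"
  proof (rule resolution_ext[OF sum1'])
    fix \<alpha> assume a: "\<alpha> \<in> F'"
    have "?X * exp D2 * E' \<alpha> = sc \<alpha> (?X * E' \<alpha>)" using eE'[OF a] by (simp add: D2_def mult.assoc sc_ring)
    also have "\<dots> = exp D2 * ?X * E' \<alpha>"
      using eE'[OF a] XE'[OF a] by (simp add: D2_def mult.assoc sc_ring(4) flip: mult.assoc[of _ "E' \<alpha>"])
    finally show "?X * exp D2 * E' \<alpha> = exp D2 * ?X * E' \<alpha>" .
  qed
  have XST: "?X * (exp D1 * exp D2 * exp (N + M)) = exp D1 * exp D2 * exp (N + M) * ?X"
    using exp_commute[of ?X ?X] e(1) unfolding ST[symmetric] by simp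
  have XDD: "?X * (exp D1 * exp D2) = exp D1 * exp D2 * ?X"
    using XD1 XD2 by (metis mult.assoc)
  have "exp D1 * exp D2 * (?X * exp (N + M)) = ?X * (exp D1 * exp D2) * exp (N + M)"
    unfolding XDD by (simp only: mult.assoc)
  also have "\<dots> = exp D1 * exp D2 * exp (N + M) * ?X"
    using XST by (simp only: mult.assoc)
  finally have "exp D1 * (exp D2 * (?X * exp (N + M))) = exp D1 * (exp D2 * (exp (N + M) * ?X))"
    by (simp only: mult.assoc)
  then have "?X * exp (N + M) = exp (N + M) * ?X" by (blast dest: exp_mult_left_cancel)
  then have XN: "?X * (N + M) = (N + M) * ?X"
    by (rule commute_log_unipotent) (rule nilpotent_add[OF NM N3 M3])
  \<comment> \<open>This is the coefficient of \<open>x * y\<close> in the commutator of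
    \<open>x * A + y * B\<close> and \<open>x * N + y * M\<close>; the other two coefficients vanish
    by \<open>AN\<close> and \<open>BM\<close>.\<close>
  then have cross: "A * M + B * N = M * A + N * B"
    using AN BM by (simp add: algebra_simps)
  have pencil: "(cs x * A + cs y * B) * (cs x * N + cs y * M) = (cs x * N + cs y * M) * (cs x * A + cs y * B)" for x y
  proof -
    have "(cs x * A + cs y * B) * (cs x * N + cs y * M)
      = sc (x * x) (A * N) + sc (x * y) (A * M + B * N) + sc (y * y) (B * M)"
      by (simp add: algebra_simps sc_ring)
    also have "\<dots> = (cs x * N + cs y * M) * (cs x * A + cs y * B)"
      unfolding cross AN BM by (simp add: algebra_simps sc_ring)
    finally show ?thesis .
  qed
  have split: "cs x * A + cs y * B = (cs x * D1 + cs y * D2) + (cs x * N + cs y * M)" for x y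
    by (simp add: D1_def D2_def algebra_simps)
  have nil: "(cs x * N + cs y * M) * (cs x * N + cs y * M) * (cs x * N + cs y * M) = 0" for x y
  proof (rule nilpotent_add)
    show "cs x * N * (cs y * M) = cs y * M * (cs x * N)" by (simp add: sc_ring NM mult.commute)
    show "cs x * N * (cs x * N) * (cs x * N) = 0" using N3 by (simp add: sc_ring)
    show "cs y * M * (cs y * M) * (cs y * M) = 0" using M3 by (simp add: sc_ring)
  qed
  have pencilD: "(cs x * D1 + cs y * D2) * (cs x * N + cs y * M) = (cs x * N + cs y * M) * (cs x * D1 + cs y * D2)" for x y
    using pencil[of x y] unfolding split by (simp add: distrib_left distrib_right)
  \<comment> \<open>The two pencils differ by a commuting nilpotent, which moves no eigenvalue in
    either direction.\<close>
  have "eigval (cs x * D1 + cs y * D2) z \<longleftrightarrow> eigval (cs x * A + cs y * B) z" for x y z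
  proof
    assume "eigval (cs x * D1 + cs y * D2) z"
    then show "eigval (cs x * A + cs y * B) z"
      unfolding split by (rule eigval_add_nilpotent[OF pencilD nil])
  next
    assume *: "eigval (cs x * A + cs y * B) z"
    have "eigval (cs x * A + cs y * B + - (cs x * N + cs y * M)) z"
      by (rule eigval_add_nilpotent[OF _ _ *])
        (use pencil[of x y] nil[of x y] in \<open>simp_all only: mult_minus_left mult_minus_right minus_minus neg_equal_0_iff_equal\<close>)
    then show "eigval (cs x * D1 + cs y * D2) z"
      unfolding split by simp
  qed
  with ls have lsD: "linear_spectrum D1 D2 l m" by (simp add: linear_spectrum_def)
  have expxy: "exp (cs x * A + cs y * B) = exp (cs x * D1 + cs y * D2) * exp (cs x * N + cs y * M)" for x y
    unfolding split by (rule exp_add_commuting[OF pencilD])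
  have "exp (D1 + D2) * exp (N + M) = exp D1 * exp D2 * exp (N + M)"
    using expxy[of 1 1] e(1) ST by simp
  then have "exp (D1 + D2) * exp (N + M) * exp (- (N + M)) = exp D1 * exp D2 * exp (N + M) * exp (- (N + M))"
    by simp
  then have eD: "exp (D1 + D2) = exp D1 * exp D2"
    by (simp only: mult.assoc exp_times_exp_minus mult_1_right)
  have D1E: "D1 * E \<alpha> = E \<alpha> * D1" "D2 * E \<alpha> = E \<alpha> * D2" if "\<alpha> \<in> F" for \<alpha>
    using AE[OF that] NE[OF that] BE[OF that] ME[OF that] by (simp_all add: D1_def D2_def algebra_simps)
  have D1E': "D1 * E' \<alpha> = E' \<alpha> * D1" "D2 * E' \<alpha> = E' \<alpha> * D2" if "\<alpha> \<in> F'" for \<alpha>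
    using AE'[OF that] NE'[OF that] BE'[OF that] ME'[OF that] by (simp_all add: D1_def D2_def algebra_simps)
  have "finite {t :: nat. exp (cs (of_nat t) * D1 + D2) \<noteq> exp D1 ^ t * exp D2}"
    by (rule exp_pencil_semisimple[OF fin fin' sum1 sum1' idem idem' EE' D1E(1) D1E'(1) D1E(2) D1E'(2)
          eE[folded D1_def] eE'[folded D2_def] lsD eD D1D2])
  moreover have "exp (cs (of_nat t) * A + B) = exp (cs (of_nat t) * A) * exp B"
    if t: "exp (cs (of_nat t) * D1 + D2) = exp D1 ^ t * exp D2" for t
  proof -
    have "exp (cs (of_nat t) * N + M) = exp N ^ t * exp M"
      using NM by (subst exp_add_commuting) (simp_all add: sc_ring flip: exp_of_nat_cs)
    then have 1: "exp (cs (of_nat t) * A + B) = exp D1 ^ t * exp D2 * (exp N ^ t * exp M)"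
      using expxy[of "of_nat t" 1] t by simp
    have "exp D1 * exp N = exp N * exp D1"
      by (rule exp_intertwine, rule exp_commute, rule D1N)
    then have "exp A ^ t = exp D1 ^ t * exp N ^ t"
      unfolding expA by (rule power_mult_distrib_commute)
    moreover have "exp N ^ t * exp D2 = exp D2 * exp N ^ t" by (rule commute_power[OF eN])
    ultimately have "exp A ^ t * exp B = exp D1 ^ t * exp D2 * (exp N ^ t * exp M)"
      unfolding expB by (metis mult.assoc)
    then show ?thesis using 1 by (simp add: exp_of_nat_cs)
  qed
  then have "{t :: nat. exp (cs (of_nat t) * A + B) \<noteq> exp (cs (of_nat t) * A) * exp B}
    \<subseteq> {t :: nat. exp (cs (of_nat t) * D1 + D2) \<noteq> exp D1 ^ t * exp D2}" by blast
  ultimately show ?thesis using finite_subset by blast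
qed

section \<open>Sequences of logarithms\<close>

lemma exp_eq_near:
  assumes "exp y = exp (L :: complex)" "cmod (y - L) < 1"
  shows "y = L"
proof -
  obtain n :: int where n: "y = L + of_int (2 * n) * pi * \<i>"
    using assms(1) exp_eq[of y L] by auto
  have "cmod (y - L) = 2 * pi * \<bar>of_int n\<bar>"
    unfolding n by (simp add: norm_mult)
  then have "2 * pi * \<bar>real_of_int n\<bar> < 1" using assms(2) by simp
  moreover have "2 * pi * 1 \<le> 2 * pi * \<bar>real_of_int n\<bar>" if "n \<noteq> 0"
    using that by (intro mult_left_mono) (auto simp flip: of_int_abs)
  ultimately have "n = 0" using pi_ge_two by fastforce
  then show ?thesis using n by simp
qed

text \<open>Continuity gives \<open>exp L = w\<close>. Logarithms of one number are at least
  \<open>2 * pi\<close> apart, so those \<open>y t\<close> within distance 1 of \<open>L\<close> are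
  equal to \<open>L\<close>.\<close>

lemma exp_constant_on_infinite:
  fixes y :: "nat \<Rightarrow> complex"
  assumes T: "infinite T" "\<And>t. t \<in> T \<Longrightarrow> exp (y t) = w" and L: "y \<longlonglongrightarrow> L"
  shows "exp L = w" "infinite {t. y t = L}"
proof -
  have freq: "\<exists>\<^sub>F t in sequentially. t \<in> T"
    using T(1) frequently_cofinite[of "\<lambda>t. t \<in> T"] by (simp add: cofinite_eq_sequentially)
  have lim: "(\<lambda>t. exp (y t)) \<longlonglongrightarrow> exp L" using L by (intro tendsto_exp)
  show w: "exp L = w"
  proof (rule ccontr)
    assume "exp L \<noteq> w"
    then have "\<forall>\<^sub>F t in sequentially. exp (y t) \<noteq> w" by (rule tendsto_imp_eventually_ne[OF lim])
    with freq have "\<exists>\<^sub>F t in sequentially. t \<in> T \<and> exp (y t) \<noteq> w"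
      by (rule frequently_eventually_frequently)
    then show False using T(2) by (auto dest: frequently_ex)
  qed
  have "\<forall>\<^sub>F t in sequentially. dist (y t) L < 1" using L by (rule tendstoD) simp
  with freq have "\<exists>\<^sub>F t in sequentially. t \<in> T \<and> dist (y t) L < 1"
    by (rule frequently_eventually_frequently)
  then have "\<exists>\<^sub>F t in sequentially. y t = L"
    by (rule frequently_elim1) (auto simp: dist_norm T(2) w intro: exp_eq_near)
  then show "infinite {t. y t = L}"
    using frequently_cofinite[of "\<lambda>t. y t = L"] by (simp add: cofinite_eq_sequentially)
qed

text \<open>From some point on, \<open>x t\<close> lies in the set of all \<open>t * l + m\<close>
  modulo \<open>2 * pi * i\<close>; the pair \<open>(l, m)\<close> may depend on
  \<open>t\<close>.\<close>

definition log_lattice :: "complex set \<Rightarrow> complex set \<Rightarrow> (nat \<Rightarrow> complex) \<Rightarrow> bool" where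
  "log_lattice \<Lambda> M x \<longleftrightarrow> finite \<Lambda> \<and> finite M \<and>
    (\<forall>\<^sub>F t in sequentially. \<exists>l\<in>\<Lambda>. \<exists>m\<in>M. exp (x t) = exp (of_nat t * l + m))"

text \<open>Among \<open>k + 1\<close> consecutive indices two share their pair, at a gap of at most
  \<open>k\<close>. There are finitely many combinations of gap and pair, so one of them occurs
  infinitely often.\<close>

lemma log_lattice_recurrence:
  assumes "log_lattice \<Lambda> M x"
  obtains d l m where "d \<ge> 1"
    "infinite {t. exp (x t) = exp (of_nat t * l + m) \<and> exp (x (t + d)) = exp (of_nat (t + d) * l + m)}"
proof -
  obtain t0 where t0: "\<And>t. t \<ge> t0 \<Longrightarrow> \<exists>l\<in>\<Lambda>. \<exists>m\<in>M. exp (x t) = exp (of_nat t * l + m)"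
    using assms by (auto simp: log_lattice_def eventually_sequentially)
  have fin: "finite (\<Lambda> \<times> M)" using assms by (simp add: log_lattice_def)
  define hit where "hit = (\<lambda>t p. exp (x t) = exp (of_nat t * fst p + snd p))"
  have "\<exists>p\<in>\<Lambda> \<times> M. hit t p" if "t \<ge> t0" for t
    using t0[OF that] by (auto simp: hit_def)
  then obtain c where c: "\<And>t. t \<ge> t0 \<Longrightarrow> c t \<in> \<Lambda> \<times> M" "\<And>t. t \<ge> t0 \<Longrightarrow> hit t (c t)" by metis
  define k where "k = card (\<Lambda> \<times> M)"
  define T where "T = (\<lambda>(d, p). {t. hit t p \<and> hit (t + d) p})"
  define Qs where "Qs = {1..k} \<times> (\<Lambda> \<times> M)"
  have "\<exists>t\<ge>n. t \<in> (\<Union>q\<in>Qs. T q)" for n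
  proof -
    define f where "f = (\<lambda>i. c (max n t0 + i))"
    have "f ` {..k} \<subseteq> \<Lambda> \<times> M" unfolding f_def by (rule image_subsetI, rule c(1)) simp
    then have "card (f ` {..k}) \<le> k" unfolding k_def by (rule card_mono[OF fin])
    then have "\<not> inj_on f {..k}" by (intro pigeonhole) simp
    then obtain i j where ij: "i \<le> k" "j \<le> k" "i < j" "f i = f j"
      by (metis atMost_iff inj_on_def linorder_neqE_nat)
    let ?t = "max n t0 + i"
    have "?t + (j - i) = max n t0 + j" using ij by simp
    then have "?t \<in> T (j - i, c ?t)"
      using c(2)[of ?t] c(2)[of "max n t0 + j"] ij(4) by (auto simp: T_def f_def)
    moreover have "(j - i, c ?t) \<in> {1..k} \<times> (\<Lambda> \<times> M)" using ij(2,3) c(1)[of ?t] by (simp del: mem_Sigma_iff add: mem_Sigma_iff[of "j - i"]) arith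
    ultimately have "?t \<in> (\<Union>q\<in>Qs. T q)" unfolding Qs_def by (rule UN_I[rotated])
    then show ?thesis by (intro exI[of _ ?t]) simp
  qed
  then have "infinite (\<Union>q\<in>Qs. T q)"
    by (simp only: infinite_nat_iff_unbounded_le) simp
  moreover have "finite Qs" using fin by (simp add: Qs_def)
  ultimately obtain q where q: "q \<in> Qs" "infinite (T q)" using finite_UN_I[of Qs T] by blast
  show thesis
  proof (rule that)
    show "fst q \<ge> 1" using q(1) by (auto simp: Qs_def)
    show "infinite {t. exp (x t) = exp (of_nat t * fst (snd q) + snd (snd q)) \<and>
      exp (x (t + fst q)) = exp (of_nat (t + fst q) * fst (snd q) + snd (snd q))}"
      using q(2) by (simp add: T_def hit_def case_prod_beta)
  qed
qed

lemma tendsto_multi_step: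
  fixes x :: "nat \<Rightarrow> complex"
  assumes "(\<lambda>t. x (t + 1) - x t) \<longlonglongrightarrow> k"
  shows "(\<lambda>t. x (t + d) - x t) \<longlonglongrightarrow> of_nat d * k"
proof (induction d)
  case (Suc d)
  have "(\<lambda>t. (x (t + d + 1) - x (t + d)) + (x (t + d) - x t)) \<longlonglongrightarrow> k + of_nat d * k"
    using LIMSEQ_ignore_initial_segment[OF assms, of d] Suc by (intro tendsto_add) simp_all
  then show ?case by (simp add: algebra_simps)
qed simp

text \<open>At a recurrence, the difference over the gap \<open>d\<close> has the exponential
  \<open>exp (of_nat d * l)\<close>, independent of \<open>t\<close>, while it converges to
  \<open>of_nat d * k\<close>.\<close>

lemma log_lattice_recurrent_step:
  assumes x: "log_lattice \<Lambda> M x" and k: "(\<lambda>t. x (t + 1) - x t) \<longlonglongrightarrow> k"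
  obtains d where "d \<ge> 1" "infinite {t. x (t + d) - x t = of_nat d * k}"
proof -
  obtain d l m where d: "d \<ge> 1"
    "infinite {t. exp (x t) = exp (of_nat t * l + m) \<and> exp (x (t + d)) = exp (of_nat (t + d) * l + m)}"
    using log_lattice_recurrence[OF x] by blast
  have "exp (x (t + d) - x t) = exp (of_nat d * l)"
    if "t \<in> {t. exp (x t) = exp (of_nat t * l + m) \<and> exp (x (t + d)) = exp (of_nat (t + d) * l + m)}" for t
    using that by (simp add: exp_diff) (simp add: algebra_simps flip: exp_diff)
  from exp_constant_on_infinite(2)[OF d(2) this tendsto_multi_step[OF k]] d(1)
  show thesis by (rule that[rotated])
qed

text \<open>On the recurrence set, \<open>x t - t * k\<close> has the exponential
  \<open>exp (t * (l - k) + m)\<close>, which may vary with \<open>t\<close>. The increments of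
  \<open>x\<close> tend to \<open>k\<close>, and this forces \<open>exp (d * (l - k)) = 1\<close>
  for a gap \<open>d\<close>; on a residue class modulo \<open>d\<close> the exponential is
  therefore constant.\<close>

lemma log_lattice_linear:
  assumes x: "log_lattice \<Lambda> M x" and b: "(\<lambda>t. x t - of_nat t * k) \<longlonglongrightarrow> b"
  shows "infinite {t. x t = of_nat t * k + b}"
proof -
  obtain d l m where d: "d \<ge> 1"
    and inf: "infinite {t. exp (x t) = exp (of_nat t * l + m) \<and> exp (x (t + d)) = exp (of_nat (t + d) * l + m)}"
    using log_lattice_recurrence[OF x] by blast
  define T where "T = {t. exp (x t) = exp (of_nat t * l + m) \<and> exp (x (t + d)) = exp (of_nat (t + d) * l + m)}"
  have "(\<lambda>t. (x (t + 1) - of_nat (t + 1) * k) - (x t - of_nat t * k) + k) \<longlonglongrightarrow> b - b + k"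
    using LIMSEQ_ignore_initial_segment[OF b, of 1] b by (intro tendsto_intros) simp_all
  then have step: "(\<lambda>t. x (t + 1) - x t) \<longlonglongrightarrow> k" by (simp add: algebra_simps)
  have "exp (x (t + d) - x t) = exp (of_nat d * l)" if "t \<in> T" for t
    using that by (simp add: T_def exp_diff) (simp add: algebra_simps flip: exp_diff)
  from exp_constant_on_infinite(1)[OF inf[folded T_def] this tendsto_multi_step[OF step]]
  have period: "exp (of_nat d * (l - k)) = 1" by (simp add: right_diff_distrib exp_diff)
  have "T = (\<Union>r\<in>{..<d}. {t \<in> T. t mod d = r})" using d by auto
  then have "infinite (\<Union>r\<in>{..<d}. {t \<in> T. t mod d = r})" using inf by (simp add: T_def)
  then obtain r where r: "infinite {t \<in> T. t mod d = r}" by blast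
  have "exp (x t - of_nat t * k) = exp (of_nat r * (l - k)) * exp m" if "t \<in> {t \<in> T. t mod d = r}" for t
  proof -
    have t: "t = d * (t div d) + r" using that by (auto simp: mult_div_mod_eq)
    have "exp (x t - of_nat t * k) = exp (of_nat t * (l - k)) * exp m"
      using that by (simp add: T_def exp_diff exp_add right_diff_distrib)
    also have "of_nat t * (l - k) = of_nat (t div d) * (of_nat d * (l - k)) + of_nat r * (l - k)"
      by (subst t) (simp add: algebra_simps)
    also have "exp \<dots> = exp (of_nat r * (l - k))"
      by (simp only: exp_add exp_of_nat_mult[of "t div d"] period) simp
    finally show ?thesis .
  qed
  from exp_constant_on_infinite(2)[OF r this b] show ?thesis by (simp add: algebra_simps)
qed

text \<open>The value at \<open>c\<close> is the product of the distances to the roots, so the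
  smallest distance cubed is at most its modulus.\<close>

lemma root_near:
  assumes P: "\<And>x. P x = (x - r1) * (x - r2) * (x - r3 :: complex)"
  shows "\<exists>x. P x = 0 \<and> cmod (x - c) ^ 3 \<le> cmod (P c)"
proof -
  have near: "\<exists>x. P x = 0 \<and> cmod (x - c) ^ 3 \<le> cmod (P c)"
    if r: "P r = 0" and le: "cmod (P c) = cmod (c - r) * y * z" "cmod (c - r) \<le> y" "cmod (c - r) \<le> z"
    for r y z
  proof (intro exI conjI)
    have "cmod (c - r) * cmod (c - r) \<le> y * z"
      using le(2,3) norm_ge_zero order_trans by (intro mult_mono) blast+
    then have "cmod (c - r) * (cmod (c - r) * cmod (c - r)) \<le> cmod (c - r) * (y * z)"
      by (rule mult_left_mono) simp
    then show "cmod (r - c) ^ 3 \<le> cmod (P c)"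
      unfolding le(1) by (subst norm_minus_commute) (simp add: power3_eq_cube mult.assoc)
  qed (rule r)
  define u v w where "u = cmod (c - r1)" and "v = cmod (c - r2)" and "w = cmod (c - r3)"
  have Pc: "cmod (P c) = u * v * w" by (simp add: P norm_mult u_def v_def w_def)
  have "u \<le> v \<and> u \<le> w \<or> v \<le> u \<and> v \<le> w \<or> w \<le> u \<and> w \<le> v" by linarith
  then show ?thesis
    using near[of r1 v w] near[of r2 u w] near[of r3 u v] Pc
    by (auto simp: P u_def v_def w_def mult.commute mult.left_commute)
qed

section \<open>Square roots of a quadratic along the natural numbers\<close>

lemma quadratic_identically_zero:
  fixes b c d :: complex
  assumes "infinite {t :: nat. b * (of_nat t)\<^sup>2 + c * of_nat t + d = 0}"
  shows "b = 0" "c = 0" "d = 0"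
proof -
  have eq: "{t :: nat. b * (of_nat t)\<^sup>2 + c * of_nat t + d = 0}
    = {t. 0 * of_nat t ^ 3 + b * (of_nat t)\<^sup>2 + c * of_nat t + d = 0}"
    by (intro Collect_cong) simp
  from cubic_identically_zero(2-4)[OF assms[unfolded eq]] show "b = 0" "c = 0" "d = 0" by blast+
qed

text \<open>The increment is the reciprocal of the sum of the two roots; principal roots have
  nonnegative real part, so nothing cancels in that sum.\<close>

lemma csqrt_increment_tendsto:
  "(\<lambda>t. csqrt (of_nat (t + 1) + c) - csqrt (of_nat t + c)) \<longlonglongrightarrow> 0"
proof (rule Lim_null_comparison)
  have "(\<lambda>t. 1 / sqrt (real t + Re c)) \<longlonglongrightarrow> 0" by real_asymp
  then show "(\<lambda>t. 1 / sqrt (real t + Re c)) \<longlonglongrightarrow> 0" .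
  have "\<forall>\<^sub>F t in sequentially. real t + Re c > 0" by real_asymp
  then show "\<forall>\<^sub>F t in sequentially. norm (csqrt (of_nat (t + 1) + c) - csqrt (of_nat t + c)) \<le> 1 / sqrt (real t + Re c)"
  proof (rule eventually_mono)
    fix t :: nat assume t: "real t + Re c > 0"
    let ?z = "of_nat t + c :: complex"
    have re: "sqrt (Re z) \<le> Re (csqrt z)" for z
      using complex_Re_le_cmod[of z] by (simp add: real_sqrt_le_mono)
    have "sqrt (Re ?z) + 0 \<le> Re (csqrt ?z) + Re (csqrt (?z + 1))"
      using re[of ?z] csqrt_principal[of "?z + 1"] by (intro add_mono) auto
    also have "\<dots> \<le> cmod (csqrt (?z + 1) + csqrt ?z)"
      using complex_Re_le_cmod[of "csqrt (?z + 1) + csqrt ?z"] by simp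
    finally have ge: "sqrt (real t + Re c) \<le> cmod (csqrt (?z + 1) + csqrt ?z)" by simp
    have "(csqrt (?z + 1) - csqrt ?z) * (csqrt (?z + 1) + csqrt ?z) = (csqrt (?z + 1))\<^sup>2 - (csqrt ?z)\<^sup>2"
      by (simp add: algebra_simps power2_eq_square)
    also have "\<dots> = 1" by simp
    finally have "cmod (csqrt (?z + 1) - csqrt ?z) * cmod (csqrt (?z + 1) + csqrt ?z) = 1"
      by (metis norm_mult norm_one)
    moreover from this have "cmod (csqrt (?z + 1) + csqrt ?z) \<noteq> 0" by (metis mult_zero_right zero_neq_one)
    ultimately have "cmod (csqrt (?z + 1) - csqrt ?z) = 1 / cmod (csqrt (?z + 1) + csqrt ?z)"
      by (simp only: eq_divide_eq) simp
    also have "\<dots> \<le> 1 / sqrt (real t + Re c)"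
      using ge t by (intro divide_left_mono) (auto intro!: mult_pos_pos order_less_le_trans[OF _ ge])
    finally show "norm (csqrt (of_nat (t + 1) + c) - csqrt (of_nat t + c)) \<le> 1 / sqrt (real t + Re c)"
      by (simp add: add_ac)
  qed
qed

text \<open>The hypothesis covers every choice of square roots \<open>y\<close>. For
  \<open>d2 \<noteq> 0\<close> a suitable choice is asymptotic to a line and meets it infinitely
  often. For \<open>d2 = 0\<close>, \<open>d1 \<noteq> 0\<close> the increments of \<open>y\<close>
  tend to 0, so recurrence would make \<open>y\<close> repeat a value, which a nonconstant linear
  \<open>y t ^ 2\<close> excludes.\<close>

lemma discriminant_is_square:
  fixes p0 p1 d0 d1 d2 :: complex
  assumes lat: "\<And>y. (\<And>t. (y t)\<^sup>2 = d2 * (of_nat t)\<^sup>2 + d1 * of_nat t + d0) \<Longrightarrow>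
    log_lattice \<Lambda> M (\<lambda>t. (p1 * of_nat t + p0 + y t) / 2)"
  shows "\<exists>k c. \<forall>z. d2 * z\<^sup>2 + d1 * z + d0 = (k * z + c)\<^sup>2"
proof (cases "d2 = 0")
  case False
  define k where "k = csqrt d2"
  have k: "k \<noteq> 0" "k\<^sup>2 = d2" using False by (simp_all add: k_def)
  define D where "D = (\<lambda>t::nat. d2 * (of_nat t)\<^sup>2 + d1 * of_nat t + d0)"
  \<comment> \<open>The sign of the root is chosen so that \<open>y\<close> stays closer to
    \<open>k * t\<close> than to \<open>- k * t\<close>; this keeps \<open>y + k * t\<close> away
    from 0 in \<open>wy\<close>.\<close>
  have "\<exists>y. y\<^sup>2 = D t \<and> cmod (y - k * of_nat t) \<le> cmod (y + k * of_nat t)" for t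
  proof (cases "cmod (csqrt (D t) - k * of_nat t) \<le> cmod (csqrt (D t) + k * of_nat t)")
    case True
    then show ?thesis by (intro exI[of _ "csqrt (D t)"]) simp
  next
    case False
    have "cmod (- csqrt (D t) - k * of_nat t) = cmod (csqrt (D t) + k * of_nat t)"
      "cmod (- csqrt (D t) + k * of_nat t) = cmod (csqrt (D t) - k * of_nat t)"
      by (metis minus_add_distrib norm_minus_cancel diff_conv_add_uminus, metis minus_diff_eq norm_minus_cancel uminus_add_conv_diff)
    with False show ?thesis by (intro exI[of _ "- csqrt (D t)"]) simp
  qed
  then obtain y where y: "\<And>t. (y t)\<^sup>2 = D t" "\<And>t. cmod (y t - k * of_nat t) \<le> cmod (y t + k * of_nat t)"
    by metis
  define w where "w = (\<lambda>t. y t - k * of_nat t)"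
  have big: "cmod (y t + k * of_nat t) \<ge> cmod k * t" for t
  proof -
    have "2 * (cmod k * t) = cmod ((y t + k * of_nat t) - (y t - k * of_nat t))" by (simp add: norm_mult)
    also have "\<dots> \<le> cmod (y t + k * of_nat t) + cmod (y t - k * of_nat t)" by (rule norm_triangle_ineq4)
    finally show ?thesis using y(2)[of t] by linarith
  qed
  have wy: "w t * (y t + k * of_nat t) = d1 * of_nat t + d0" for t
    using y(1)[of t] k(2) by (simp add: w_def D_def algebra_simps power2_eq_square)
  have wt0: "(\<lambda>t. w t / of_nat t) \<longlonglongrightarrow> 0"
  proof (rule Lim_null_comparison)
    show "(\<lambda>t. (cmod d1 * real t + cmod d0) / (cmod k * (real t)\<^sup>2)) \<longlonglongrightarrow> 0"
      using k(1) by real_asymp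
    show "\<forall>\<^sub>F t in sequentially. norm (w t / of_nat t) \<le> (cmod d1 * real t + cmod d0) / (cmod k * (real t)\<^sup>2)"
      using eventually_gt_at_top[of 0]
    proof (rule eventually_mono)
      fix t :: nat assume t: "t > 0"
      have "cmod (w t) * (cmod k * t) \<le> cmod (w t) * cmod (y t + k * of_nat t)"
        using big by (intro mult_left_mono) auto
      also have "\<dots> = cmod (d1 * of_nat t + d0)" by (metis wy norm_mult)
      also have "\<dots> \<le> cmod d1 * t + cmod d0" by (rule norm_triangle_le) (simp add: norm_mult)
      finally show "norm (w t / of_nat t) \<le> (cmod d1 * real t + cmod d0) / (cmod k * (real t)\<^sup>2)"
        using t k(1) by (simp add: norm_divide field_simps power2_eq_square)
    qed
  qed
  have inv0: "(\<lambda>t. 1 / of_nat t :: complex) \<longlonglongrightarrow> 0" by (rule lim_1_over_n)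
  have "(\<lambda>t. (d1 + d0 * (1 / of_nat t)) / (w t / of_nat t + 2 * k)) \<longlonglongrightarrow> (d1 + d0 * 0) / (0 + 2 * k)"
    using k(1) by (intro tendsto_intros wt0 inv0) simp
  moreover have "\<forall>\<^sub>F t in sequentially. (d1 + d0 * (1 / of_nat t)) / (w t / of_nat t + 2 * k) = w t"
    using eventually_gt_at_top[of 0]
  proof (rule eventually_mono)
    fix t :: nat assume t: "t > 0"
    have q: "y t + k * of_nat t = of_nat t * (w t / of_nat t + 2 * k)"
      using t by (simp add: w_def field_simps)
    have "y t + k * of_nat t \<noteq> 0" using big[of t] t k(1) by (auto simp: mult_le_0_iff)
    then have nz: "w t / of_nat t + 2 * k \<noteq> 0" using q by auto
    have "of_nat t * (w t * (w t / of_nat t + 2 * k)) = of_nat t * (d1 + d0 * (1 / of_nat t))"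
      using wy[of t] t unfolding q by (simp add: distrib_left mult_ac)
    then have "w t * (w t / of_nat t + 2 * k) = d1 + d0 * (1 / of_nat t)"
      using t by (subst (asm) mult_left_cancel) simp_all
    then show "(d1 + d0 * (1 / of_nat t)) / (w t / of_nat t + 2 * k) = w t"
      using nz by (simp add: divide_eq_eq)
  qed
  ultimately have "w \<longlonglongrightarrow> (d1 + d0 * 0) / (0 + 2 * k)" by (rule Lim_transform_eventually)
  \<comment> \<open>The constant that completes the square in \<open>d2 * z ^ 2 + d1 * z\<close>,
    and the limit of \<open>w\<close>.\<close>
  moreover define c where "c = d1 / (2 * k)"
  ultimately have w: "w \<longlonglongrightarrow> c" by simp
  have L: "log_lattice \<Lambda> M (\<lambda>t. (p1 * of_nat t + p0 + y t) / 2)"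
    by (rule lat) (simp add: y(1) D_def)
  have "(\<lambda>t. (p0 + w t) / 2) \<longlonglongrightarrow> (p0 + c) / 2" by (intro tendsto_intros w) simp
  moreover have "(p0 + w t) / 2 = (p1 * of_nat t + p0 + y t) / 2 - of_nat t * ((p1 + k) / 2)" for t
    by (simp add: w_def field_simps)
  ultimately have "infinite {t. (p1 * of_nat t + p0 + y t) / 2 = of_nat t * ((p1 + k) / 2) + (p0 + c) / 2}"
    by (intro log_lattice_linear[OF L]) simp
  moreover have "{t. (p1 * of_nat t + p0 + y t) / 2 = of_nat t * ((p1 + k) / 2) + (p0 + c) / 2}
    \<subseteq> {t. 0 * (of_nat t)\<^sup>2 + 0 * of_nat t + (d0 - c\<^sup>2) = 0}"
  proof (intro Collect_mono impI)
    fix t assume "(p1 * of_nat t + p0 + y t) / 2 = of_nat t * ((p1 + k) / 2) + (p0 + c) / 2"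
    then have "4 * y t = 4 * (k * of_nat t + c)" by (simp add: field_simps)
    then have "y t = k * of_nat t + c" by (simp only: mult_cancel_left) simp
    then have "(k * of_nat t + c)\<^sup>2 = D t" using y(1)[of t] by simp
    moreover have "D t = k\<^sup>2 * (of_nat t)\<^sup>2 + 2 * k * c * of_nat t + d0"
      using k by (simp add: D_def c_def)
    ultimately show "0 * (of_nat t)\<^sup>2 + 0 * of_nat t + (d0 - c\<^sup>2) = 0"
      by (simp add: power2_sum power_mult_distrib algebra_simps)
  qed
  ultimately have "infinite {t::nat. 0 * (of_nat t)\<^sup>2 + 0 * of_nat t + (d0 - c\<^sup>2) = 0}"
    using finite_subset by blast
  then have "d0 = c\<^sup>2" using quadratic_identically_zero(3) by force
  moreover have "2 * k * c = d1" using k(1) by (simp add: c_def)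
  ultimately have "\<forall>z. d2 * z\<^sup>2 + d1 * z + d0 = (k * z + c)\<^sup>2"
    using k(2) by (auto simp: power2_sum power_mult_distrib algebra_simps)
  then show ?thesis by blast
next
  case d2: True
  show ?thesis
  proof (cases "d1 = 0")
    case True
    then show ?thesis using d2 by (intro exI[of _ 0] exI[of _ "csqrt d0"]) simp
  next
    case False
    define y where "y = (\<lambda>t::nat. csqrt d1 * csqrt (of_nat t + d0 / d1))"
    have y2: "(y t)\<^sup>2 = d1 * of_nat t + d0" for t
      using False by (simp add: y_def power_mult_distrib distrib_left)
    have L: "log_lattice \<Lambda> M (\<lambda>t. (p1 * of_nat t + p0 + y t) / 2)"
      by (rule lat) (simp add: y2 d2)
    have "(\<lambda>t. (p1 + csqrt d1 * (csqrt (of_nat (t + 1) + d0 / d1) - csqrt (of_nat t + d0 / d1))) / 2)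
      \<longlonglongrightarrow> (p1 + csqrt d1 * 0) / 2"
      by (intro tendsto_intros csqrt_increment_tendsto) simp
    moreover have "(p1 + csqrt d1 * (csqrt (of_nat (t + 1) + d0 / d1) - csqrt (of_nat t + d0 / d1))) / 2
      = (p1 * of_nat (t + 1) + p0 + y (t + 1)) / 2 - (p1 * of_nat t + p0 + y t) / 2" for t
      by (simp add: y_def algebra_simps diff_divide_distrib add_divide_distrib)
    ultimately have "(\<lambda>t. (p1 * of_nat (t + 1) + p0 + y (t + 1)) / 2 - (p1 * of_nat t + p0 + y t) / 2)
      \<longlonglongrightarrow> p1 / 2" by (simp only: mult_zero_right add_0_right)
    from log_lattice_recurrent_step[OF L this] obtain d where d: "d \<ge> 1"
      "infinite {t. (p1 * of_nat (t + d) + p0 + y (t + d)) / 2 - (p1 * of_nat t + p0 + y t) / 2 = of_nat d * (p1 / 2)}"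
      by blast
    then obtain t where "(p1 * of_nat (t + d) + p0 + y (t + d)) / 2 - (p1 * of_nat t + p0 + y t) / 2 = of_nat d * (p1 / 2)"
      using not_finite_existsD by blast
    then have "y (t + d) = y t" by (simp add: field_simps)
    then have "d1 * of_nat (t + d) + d0 = d1 * of_nat t + d0" by (metis y2)
    with False d(1) show ?thesis by (simp add: distrib_left)
  qed
qed

section \<open>Linear branches of the spectrum\<close>

lemma monic_cubic_coeffs:
  assumes "\<And>x. x ^ 3 - s1 * x\<^sup>2 + s2 * x - s3 = (x - r1) * (x - r2) * (x - r3 :: complex)"
  shows "s1 = r1 + r2 + r3" "s2 = r1 * r2 + r1 * r3 + r2 * r3" "s3 = r1 * r2 * r3"
proof -
  have A: "1 - s1 + s2 - s3 = (1 - r1) * (1 - r2) * (1 - r3)" using assms[of 1] by simp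
  have B: "- 1 - s1 - s2 - s3 = (- 1 - r1) * (- 1 - r2) * (- 1 - r3)" using assms[of "- 1"] by simp
  show s3: "s3 = r1 * r2 * r3" using assms[of 0] by simp
  have "2 * s1 = - ((1 - s1 + s2 - s3) + (- 1 - s1 - s2 - s3)) - 2 * s3" by simp
  also have "\<dots> = 2 * (r1 + r2 + r3)" unfolding A B unfolding s3 by (simp add: algebra_simps)
  finally show s1: "s1 = r1 + r2 + r3" by (simp only: mult_cancel_left) simp
  have "s2 = (1 - s1 + s2 - s3) - 1 + s1 + s3" by simp
  also have "\<dots> = r1 * r2 + r1 * r3 + r2 * r3" unfolding A unfolding s1 s3 by (simp add: algebra_simps)
  finally show "s2 = r1 * r2 + r1 * r3 + r2 * r3" .
qed

text \<open>First order perturbation of the simple eigenvalue \<open>k\<close> of \<open>A\<close>: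
  a root of the characteristic polynomial stays asymptotic to \<open>k * t + b\<close>, so the
  lattice condition makes it meet this line infinitely often.\<close>

lemma simple_eigenvalue_branch:
  fixes k p q b1 b2 c2 b3 c3 d3 :: complex
  defines "P \<equiv> \<lambda>z x. x ^ 3 - ((k + p + q) * z + b1) * x\<^sup>2
    + ((k * p + k * q + p * q) * z\<^sup>2 + b2 * z + c2) * x - (k * p * q * z ^ 3 + b3 * z\<^sup>2 + c3 * z + d3)"
  assumes ne: "k \<noteq> p" "k \<noteq> q" and fin: "finite \<Lambda>" "finite M"
    and roots: "\<And>t :: nat. \<exists>r1 r2 r3. \<forall>x. P (of_nat t) x = (x - r1) * (x - r2) * (x - r3)"
    and lat: "\<forall>\<^sub>F t in sequentially. \<forall>x. P (of_nat t) x = 0 \<longrightarrow>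
      (\<exists>l\<in>\<Lambda>. \<exists>m\<in>M. exp x = exp (of_nat t * l + m))"
  shows "\<exists>b. \<forall>z. P z (k * z + b) = 0"
proof -
  \<comment> \<open>Along \<open>x = k * z + y\<close> the cubic terms in \<open>z\<close> cancel
    and the quadratic coefficient is \<open>g * y - h\<close>, where \<open>g\<close> is the
    derivative at \<open>k\<close> of the characteristic polynomial of \<open>A\<close>. The choice
    \<open>b = h / g\<close> removes this coefficient.\<close>
  define g h where "g = (k - p) * (k - q)" and "h = b1 * k\<^sup>2 - b2 * k + b3"
  define b where "b = h / g"
  have g: "g \<noteq> 0" using ne by (simp add: g_def)
  define q2 q1 q0 where "q2 = 2 * k - p - q" and "q1 = b2 - 2 * b1 * k" and "q0 = c2 * k - c3"
  define Q R where "Q = (\<lambda>y. q2 * y\<^sup>2 + q1 * y + q0)" and "R = (\<lambda>y. y ^ 3 - b1 * y\<^sup>2 + c2 * y - d3)"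
  have P: "P z (k * z + y) = z\<^sup>2 * (g * y - h) + z * Q y + R y" for z y
    unfolding P_def g_def h_def Q_def R_def q2_def q1_def q0_def
    by (simp add: algebra_simps power2_eq_square power3_eq_cube)
  have Pb: "P z (k * z + b) = z * Q b + R b" for z
    using g unfolding P by (simp add: b_def)
  \<comment> \<open>On the line the polynomial has size \<open>O(t)\<close>, so some root is within
    \<open>O(t ^ (1/3))\<close> of it. This crude bound already gives \<open>u / t\<close> tending
    to 0.\<close>
  have "\<exists>x. P (of_nat t) x = 0 \<and> cmod (x - (k * of_nat t + b)) ^ 3 \<le> cmod (P (of_nat t) (k * of_nat t + b))" for t :: nat
  proof -
    obtain r1 r2 r3 where "\<And>x. P (of_nat t) x = (x - r1) * (x - r2) * (x - r3)" using roots by blast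
    then show ?thesis by (rule root_near)
  qed
  then obtain x where x: "\<And>t. P (of_nat t) (x t) = 0"
    "\<And>t. cmod (x t - (k * of_nat t + b)) ^ 3 \<le> cmod (of_nat t * Q b + R b)"
    unfolding Pb by metis
  define u where "u = (\<lambda>t. x t - (k * of_nat t + b))"
  have ut: "(\<lambda>t. u t / of_nat t) \<longlonglongrightarrow> 0"
  proof -
    have "(\<lambda>t. (u t / of_nat t) ^ 3) \<longlonglongrightarrow> 0"
    proof (rule Lim_null_comparison)
      show "(\<lambda>t. (real t * cmod (Q b) + cmod (R b)) / real t ^ 3) \<longlonglongrightarrow> 0" by real_asymp
      have "norm ((u t / of_nat t) ^ 3) \<le> (real t * cmod (Q b) + cmod (R b)) / real t ^ 3" for t
      proof -
        have "cmod (of_nat t * Q b + R b) \<le> real t * cmod (Q b) + cmod (R b)"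
          by (rule norm_triangle_le) (simp add: norm_mult)
        then have "cmod (u t) ^ 3 \<le> real t * cmod (Q b) + cmod (R b)"
          using x(2)[of t] unfolding u_def by linarith
        then show ?thesis
          by (simp add: norm_power norm_divide power_divide divide_right_mono)
      qed
      then show "\<forall>\<^sub>F t in sequentially. norm ((u t / of_nat t) ^ 3)
        \<le> (real t * cmod (Q b) + cmod (R b)) / real t ^ 3" by simp
    qed
    from tendsto_norm_zero[OF this] have "(\<lambda>t. cmod (u t / of_nat t)) \<longlonglongrightarrow> 0"
      by (simp only: norm_power power_tendsto_0_iff zero_less_numeral)
    then show ?thesis by (rule tendsto_norm_zero_cancel)
  qed
  define Q' R' r2 where "Q' = 2 * q2 * b + q1" and "R' = 3 * b\<^sup>2 - 2 * b1 * b + c2" and "r2 = 3 * b - b1"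
  \<comment> \<open>The Taylor form of the equation for \<open>u\<close>, divided by
    \<open>t ^ 2\<close>: \<open>\<beta>\<close> is the cofactor of \<open>u\<close> and
    \<open>- \<rho>\<close> the term free of \<open>u\<close>, both expressed through the null
    sequences \<open>1 / t\<close> and \<open>u / t\<close>.\<close>
  define \<beta> where "\<beta> = (\<lambda>t. let s = 1 / of_nat t; v = u t / of_nat t in
    g + Q' * s + q2 * v + R' * (s * s) + r2 * (v * s) + v * v)"
  define \<rho> where "\<rho> = (\<lambda>t::nat. let s = 1 / of_nat t in - (Q b * s + R b * (s * s)))"
  have s0: "(\<lambda>t. 1 / of_nat t :: complex) \<longlonglongrightarrow> 0" by (rule lim_1_over_n)
  have "\<beta> \<longlonglongrightarrow> g + Q' * 0 + q2 * 0 + R' * (0 * 0) + r2 * (0 * 0) + 0 * 0"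
    unfolding \<beta>_def Let_def by (intro tendsto_intros s0 ut)
  then have \<beta>: "\<beta> \<longlonglongrightarrow> g" by simp
  have "\<rho> \<longlonglongrightarrow> - (Q b * 0 + R b * (0 * 0))"
    unfolding \<rho>_def Let_def by (intro tendsto_intros s0)
  then have \<rho>: "\<rho> \<longlonglongrightarrow> 0" by simp
  have ub: "u t * \<beta> t = \<rho> t" if "t > 0" for t
  proof -
    define T where "T = (of_nat t :: complex)"
    have T: "T \<noteq> 0" using that by (simp add: T_def)
    have "0 = P T (k * T + (b + u t))"
      using x(1)[of t] by (simp add: u_def T_def)
    also have "\<dots> = T\<^sup>2 * (g * u t) + T * Q (b + u t) + R (b + u t)"
      unfolding P using g by (simp add: b_def distrib_left)
    also have "Q (b + u t) = Q b + Q' * u t + q2 * (u t)\<^sup>2"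
      unfolding Q_def Q'_def by (simp add: algebra_simps power2_eq_square)
    also have "R (b + u t) = R b + R' * u t + r2 * (u t)\<^sup>2 + u t ^ 3"
      unfolding R_def R'_def r2_def by (simp add: algebra_simps power2_eq_square power3_eq_cube)
    finally have eq: "T\<^sup>2 * (g * u t) + T * (Q b + Q' * u t + q2 * (u t)\<^sup>2)
      + (R b + R' * u t + r2 * (u t)\<^sup>2 + u t ^ 3) = 0" by simp
    have "T\<^sup>2 * (u t * \<beta> t - \<rho> t) = T\<^sup>2 * (g * u t) + T * (Q b + Q' * u t + q2 * (u t)\<^sup>2)
      + (R b + R' * u t + r2 * (u t)\<^sup>2 + u t ^ 3)"
      using T unfolding \<beta>_def \<rho>_def Let_def T_def[symmetric]
      by (simp add: field_simps power2_eq_square power3_eq_cube)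
    with eq T show ?thesis by simp
  qed
  have "(\<lambda>t. \<rho> t / \<beta> t) \<longlonglongrightarrow> 0 / g" by (intro tendsto_divide \<rho> \<beta> g)
  moreover have "\<forall>\<^sub>F t in sequentially. \<rho> t / \<beta> t = u t"
    using tendsto_imp_eventually_ne[OF \<beta> g] eventually_gt_at_top[of 0]
  proof eventually_elim
    case (elim t)
    then show ?case using ub[of t] by (simp add: divide_eq_eq)
  qed
  ultimately have "u \<longlonglongrightarrow> 0 / g" by (rule Lim_transform_eventually)
  then have "(\<lambda>t. u t + b) \<longlonglongrightarrow> 0 / g + b" by (intro tendsto_intros)
  then have "(\<lambda>t. x t - of_nat t * k) \<longlonglongrightarrow> b" by (simp add: u_def algebra_simps)
  moreover have "log_lattice \<Lambda> M x"
    unfolding log_lattice_def using fin lat x(1) by (auto elim!: eventually_mono)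
  ultimately have inf: "infinite {t. x t = of_nat t * k + b}" by (rule log_lattice_linear[rotated])
  \<comment> \<open>Restricted to the line, the characteristic polynomial is affine in
    \<open>t\<close>, so infinitely many zeros annihilate it.\<close>
  have "{t. x t = of_nat t * k + b} \<subseteq> {t. 0 * (of_nat t)\<^sup>2 + Q b * of_nat t + R b = 0}"
  proof (intro Collect_mono impI)
    fix t assume "x t = of_nat t * k + b"
    then have "P (of_nat t) (k * of_nat t + b) = 0" using x(1)[of t] by (simp add: mult.commute)
    then show "0 * (of_nat t)\<^sup>2 + Q b * of_nat t + R b = 0" unfolding Pb by (simp add: mult.commute)
  qed
  then have "infinite {t :: nat. 0 * (of_nat t)\<^sup>2 + Q b * of_nat t + R b = 0}"
    using inf finite_subset by blast
  from quadratic_identically_zero(2,3)[OF this] have "\<forall>z. P z (k * z + b) = 0" unfolding Pb by simp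
  then show ?thesis by blast
qed

text \<open>The case of a triple eigenvalue of \<open>A\<close>, after centring: the lattice
  condition fixes finitely many exponentials, so roots have bounded real part. This restricts their
  growth to \<open>O(sqrt t)\<close> and leaves only a constant branch.\<close>

lemma depressed_cubic_branch:
  fixes e f a b c :: complex
  defines "P \<equiv> \<lambda>z y. y ^ 3 + (e * z + f) * y - (a * z\<^sup>2 + b * z + c)"
  assumes fin: "finite M"
    and roots: "\<And>t :: nat. \<exists>r1 r2 r3. \<forall>x. P (of_nat t) x = (x - r1) * (x - r2) * (x - r3)"
    and lat: "\<forall>\<^sub>F t in sequentially. \<forall>x. P (of_nat t) x = 0 \<longrightarrow> (\<exists>m\<in>M. exp x = exp m)"
  shows "\<exists>y. \<forall>z. P z y = 0"
proof -
  obtain r1 r2 r3 where r: "\<And>t x. P (of_nat t) x = (x - r1 t) * (x - r2 t) * (x - r3 t)"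
    using roots by metis
  have sym: "0 = r1 t + r2 t + r3 t" "e * of_nat t + f = r1 t * r2 t + r1 t * r3 t + r2 t * r3 t"
    "a * (of_nat t)\<^sup>2 + b * of_nat t + c = r1 t * r2 t * r3 t" for t
  proof -
    have "x ^ 3 - 0 * x\<^sup>2 + (e * of_nat t + f) * x - (a * (of_nat t)\<^sup>2 + b * of_nat t + c)
      = (x - r1 t) * (x - r2 t) * (x - r3 t)" for x
      using r[of t x] by (simp add: P_def)
    from monic_cubic_coeffs[OF this] show "0 = r1 t + r2 t + r3 t"
      "e * of_nat t + f = r1 t * r2 t + r1 t * r3 t + r2 t * r3 t"
      "a * (of_nat t)\<^sup>2 + b * of_nat t + c = r1 t * r2 t * r3 t" by blast+
  qed
  obtain B where B: "\<And>m. m \<in> M \<Longrightarrow> \<bar>Re m\<bar> \<le> B"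
  proof
    fix m assume "m \<in> M"
    then show "\<bar>Re m\<bar> \<le> (\<Sum>m\<in>M. \<bar>Re m\<bar>)" by (intro member_le_sum fin) auto
  qed
  \<comment> \<open>Three bounded real parts and the root's own real part contribute
    \<open>4 * B ^ 2\<close>; the rest comes from \<open>e * t + f\<close>.\<close>
  define K0 where "K0 = 4 * B\<^sup>2 + 2 * cmod f"
  have bound: "\<forall>\<^sub>F t in sequentially. (cmod (r1 t))\<^sup>2 \<le> K0 + 2 * cmod e * t
    \<and> (cmod (r2 t))\<^sup>2 \<le> K0 + 2 * cmod e * t \<and> (cmod (r3 t))\<^sup>2 \<le> K0 + 2 * cmod e * t"
    using lat
  proof (rule eventually_mono)
    fix t :: nat assume t: "\<forall>x. P (of_nat t) x = 0 \<longrightarrow> (\<exists>m\<in>M. exp x = exp m)"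
    have re: "(Re x)\<^sup>2 \<le> B\<^sup>2" if px: "P (of_nat t) x = 0" for x
    proof -
      obtain m where "m \<in> M" "exp x = exp m" using t px by blast
      then have "\<bar>Re x\<bar> \<le> B" using B[of m] by (metis exp_inj_iff norm_exp_eq_Re)
      then show ?thesis by (simp add: abs_le_square_iff[symmetric])
    qed
    have R: "(Re (r1 t))\<^sup>2 \<le> B\<^sup>2" "(Re (r2 t))\<^sup>2 \<le> B\<^sup>2" "(Re (r3 t))\<^sup>2 \<le> B\<^sup>2"
      by (rule re, simp add: r)+
    \<comment> \<open>Since the roots sum to 0, their squares sum to
      \<open>- 2 * (e * t + f)\<close>; its real part bounds the imaginary parts in terms of the
      real ones.\<close>
    have "(r1 t)\<^sup>2 + (r2 t)\<^sup>2 + (r3 t)\<^sup>2 = (r1 t + r2 t + r3 t)\<^sup>2 - 2 * (r1 t * r2 t + r1 t * r3 t + r2 t * r3 t)"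
      by (simp add: algebra_simps power2_eq_square)
    also have "\<dots> = - 2 * (e * of_nat t + f)" unfolding sym(1)[symmetric] sym(2)[symmetric] by simp
    finally have "Re ((r1 t)\<^sup>2 + (r2 t)\<^sup>2 + (r3 t)\<^sup>2) = - 2 * Re (e * of_nat t + f)" by simp
    moreover have "Re (e * of_nat t + f) \<le> cmod e * t + cmod f"
      by (rule order_trans[OF complex_Re_le_cmod], rule norm_triangle_le) (simp add: norm_mult)
    ultimately have "(Im (r1 t))\<^sup>2 + (Im (r2 t))\<^sup>2 + (Im (r3 t))\<^sup>2
      \<le> (Re (r1 t))\<^sup>2 + (Re (r2 t))\<^sup>2 + (Re (r3 t))\<^sup>2 + 2 * (cmod e * t + cmod f)"
      by (simp add: power2_eq_square)
    then have "(Im (r1 t))\<^sup>2 + (Im (r2 t))\<^sup>2 + (Im (r3 t))\<^sup>2 \<le> 3 * B\<^sup>2 + 2 * (cmod e * t + cmod f)"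
      using R by linarith
    moreover have "0 \<le> (Im (r1 t))\<^sup>2" "0 \<le> (Im (r2 t))\<^sup>2" "0 \<le> (Im (r3 t))\<^sup>2" by simp_all
    moreover have "u + i \<le> K0 + 2 * cmod e * t"
      if "i + j + k \<le> 3 * B\<^sup>2 + 2 * (cmod e * t + cmod f)" "0 \<le> j" "0 \<le> k" "u \<le> B\<^sup>2" for u i j k :: real
      using that by (simp add: K0_def algebra_simps)
    ultimately show "(cmod (r1 t))\<^sup>2 \<le> K0 + 2 * cmod e * t
      \<and> (cmod (r2 t))\<^sup>2 \<le> K0 + 2 * cmod e * t \<and> (cmod (r3 t))\<^sup>2 \<le> K0 + 2 * cmod e * t"
      using R unfolding cmod_power2 by (smt (verit, best))
  qed
  have prod: "\<forall>\<^sub>F t in sequentially.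
    (cmod (a * (of_nat t)\<^sup>2 + b * of_nat t + c))\<^sup>2 \<le> (K0 + 2 * cmod e * t) ^ 3"
    using bound
  proof (rule eventually_mono)
    fix t :: nat
    let ?K = "K0 + 2 * cmod e * t"
    assume "(cmod (r1 t))\<^sup>2 \<le> ?K \<and> (cmod (r2 t))\<^sup>2 \<le> ?K \<and> (cmod (r3 t))\<^sup>2 \<le> ?K"
    moreover have "0 \<le> ?K" by (simp add: K0_def)
    ultimately have "(cmod (r1 t))\<^sup>2 * (cmod (r2 t))\<^sup>2 * (cmod (r3 t))\<^sup>2 \<le> ?K * ?K * ?K"
      by (intro mult_mono) auto
    then show "(cmod (a * (of_nat t)\<^sup>2 + b * of_nat t + c))\<^sup>2 \<le> ?K ^ 3"
      unfolding sym(3) by (simp add: norm_mult power_mult_distrib power3_eq_cube)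
  qed
  have s0: "(\<lambda>t. 1 / of_nat t :: complex) \<longlonglongrightarrow> 0" by (rule lim_1_over_n)
  have "(\<lambda>t. a + b * (1 / of_nat t) + c * (1 / of_nat t * (1 / of_nat t))) \<longlonglongrightarrow> a + b * 0 + c * (0 * 0)"
    by (intro tendsto_intros s0)
  then have la: "(\<lambda>t. (cmod (a + b * (1 / of_nat t) + c * (1 / of_nat t * (1 / of_nat t))))\<^sup>2) \<longlonglongrightarrow> (cmod a)\<^sup>2"
    by (intro tendsto_power tendsto_norm) simp
  \<comment> \<open>The squared product of the roots is \<open>O(t ^ 3)\<close>, which excludes a
    term of order \<open>t ^ 4\<close>.\<close>
  have "(cmod a)\<^sup>2 \<le> 0"
  proof (rule tendsto_le[OF trivial_limit_sequentially _ la])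
    have s0: "(\<lambda>t. 1 / real t) \<longlonglongrightarrow> 0" by (rule lim_1_over_n)
    have "(\<lambda>t. (K0 * (1 / real t) + 2 * cmod e) ^ 3 * (1 / real t)) \<longlonglongrightarrow> (K0 * 0 + 2 * cmod e) ^ 3 * 0"
      by (intro tendsto_intros s0)
    moreover have "\<forall>\<^sub>F t in sequentially.
      (K0 * (1 / real t) + 2 * cmod e) ^ 3 * (1 / real t) = (K0 + 2 * cmod e * real t) ^ 3 / real t ^ 4"
      using eventually_gt_at_top[of 0]
    proof (rule eventually_mono)
      fix t :: nat assume "t > 0"
      then have "K0 * (1 / real t) + 2 * cmod e = (K0 + 2 * cmod e * real t) / real t"
        by (simp add: add_divide_distrib)
      then show "(K0 * (1 / real t) + 2 * cmod e) ^ 3 * (1 / real t) = (K0 + 2 * cmod e * real t) ^ 3 / real t ^ 4"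
        by (simp add: power_divide eval_nat_numeral)
    qed
    ultimately show "(\<lambda>t. (K0 + 2 * cmod e * real t) ^ 3 / real t ^ 4) \<longlonglongrightarrow> 0"
      by (simp add: Lim_transform_eventually)
    show "\<forall>\<^sub>F t in sequentially. (cmod (a + b * (1 / of_nat t) + c * (1 / of_nat t * (1 / of_nat t))))\<^sup>2
      \<le> (K0 + 2 * cmod e * real t) ^ 3 / real t ^ 4"
      using prod eventually_gt_at_top[of 0]
    proof eventually_elim
      case (elim t)
      have "a * (of_nat t)\<^sup>2 + b * of_nat t + c
        = (of_nat t)\<^sup>2 * (a + b * (1 / of_nat t) + c * (1 / of_nat t * (1 / of_nat t)))"
        using elim(2) by (simp add: field_simps power2_eq_square)
      then have "(cmod (a * (of_nat t)\<^sup>2 + b * of_nat t + c))\<^sup>2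
        = real t ^ 4 * (cmod (a + b * (1 / of_nat t) + c * (1 / of_nat t * (1 / of_nat t))))\<^sup>2"
        by (simp only: norm_mult power_mult_distrib norm_power norm_of_nat power_mult[symmetric]) simp
      then show ?case using elim by (simp add: pos_le_divide_eq mult.commute)
    qed
  qed
  then have a: "a = 0" by simp
  show ?thesis
  proof (cases "e = 0")
    case e: True
    have lb: "(\<lambda>t. (cmod (b + c * (1 / of_nat t)))\<^sup>2) \<longlonglongrightarrow> (cmod (b + c * 0))\<^sup>2"
      by (intro tendsto_intros s0)
    have "(cmod (b + c * 0))\<^sup>2 \<le> 0"
    proof (rule tendsto_le[OF trivial_limit_sequentially _ lb])
      show "(\<lambda>t. K0 ^ 3 / (real t)\<^sup>2) \<longlonglongrightarrow> 0" by real_asymp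
      show "\<forall>\<^sub>F t in sequentially. (cmod (b + c * (1 / of_nat t)))\<^sup>2 \<le> K0 ^ 3 / (real t)\<^sup>2"
        using prod eventually_gt_at_top[of 0]
      proof eventually_elim
        case (elim t)
        have "a * (of_nat t)\<^sup>2 + b * of_nat t + c = of_nat t * (b + c * (1 / of_nat t))"
          using elim(2) by (simp add: a field_simps)
        then have "(cmod (a * (of_nat t)\<^sup>2 + b * of_nat t + c))\<^sup>2 = (real t)\<^sup>2 * (cmod (b + c * (1 / of_nat t)))\<^sup>2"
          by (simp only: norm_mult power_mult_distrib norm_of_nat)
        then show ?case using elim by (simp add: e pos_le_divide_eq mult.commute)
      qed
    qed
    then have b: "b = 0" by simp
    have "P z (r1 0) = P (of_nat 0) (r1 0)" for z by (simp add: P_def a b e)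
    then have "\<forall>z. P z (r1 0) = 0" by (simp only: r) simp
    then show ?thesis by blast
  next
    case e: False
    \<comment> \<open>The only value at which the cubic loses its dependence on \<open>z\<close>;
      what remains there is the constant \<open>k\<close>, which is shown to be 0.\<close>
    define y where "y = b / e"
    define k where "k = y ^ 3 + f * y - c"
    have Py: "P z y = k" for z using e by (simp add: P_def k_def a y_def algebra_simps)
    have "\<exists>x. P (of_nat t) x = 0 \<and> cmod (x - y) ^ 3 \<le> cmod (P (of_nat t) y)" for t :: nat
      by (rule root_near[OF r])
    then obtain x where x: "\<And>t. P (of_nat t) (x t) = 0" "\<And>t. cmod (x t - y) ^ 3 \<le> cmod k"
      unfolding Py by metis
    define u where "u = (\<lambda>t. x t - y)"
    define C where "C = max 1 (cmod k)"
    have uC: "cmod (u t) \<le> C" for t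
    proof (cases "cmod (u t) \<le> 1")
      case False
      then have "cmod (u t) ^ 1 \<le> cmod (u t) ^ 3" by (intro power_increasing) auto
      then show ?thesis using x(2)[of t] by (simp add: u_def C_def)
    qed (simp add: C_def)
    define D where "D = C ^ 3 + 3 * cmod y * C\<^sup>2 + cmod (3 * y\<^sup>2 + f) * C + cmod k"
    have "(\<lambda>t. u t * e) \<longlonglongrightarrow> 0"
    proof (rule Lim_null_comparison)
      show "(\<lambda>t. D / real t) \<longlonglongrightarrow> 0" by real_asymp
      show "\<forall>\<^sub>F t in sequentially. norm (u t * e) \<le> D / real t"
        using eventually_gt_at_top[of 0]
      proof (rule eventually_mono)
        fix t :: nat assume t: "t > 0"
        let ?R = "u t ^ 3 + 3 * y * (u t)\<^sup>2 + (3 * y\<^sup>2 + f) * u t + k"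
        have "P (of_nat t) (x t) = of_nat t * (u t * e) + ?R"
          using e by (simp add: P_def k_def u_def a y_def field_simps power2_eq_square power3_eq_cube)
        then have "of_nat t * (u t * e) + ?R = 0" using x(1)[of t] by simp
        then have "of_nat t * (u t * e) = - ?R" by (rule eq_neg_iff_add_eq_0[THEN iffD2])
        then have "cmod (of_nat t * (u t * e)) = cmod ?R" by (metis norm_minus_cancel)
        also have "\<dots> \<le> cmod (u t) ^ 3 + 3 * cmod y * (cmod (u t))\<^sup>2 + cmod (3 * y\<^sup>2 + f) * cmod (u t) + cmod k"
          by (intro norm_triangle_mono) (auto simp: norm_mult norm_power)
        also have "\<dots> \<le> D"
          unfolding D_def using uC[of t] by (intro add_mono mult_left_mono power_mono) auto
        finally show "norm (u t * e) \<le> D / real t"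
          using t by (simp add: norm_mult pos_le_divide_eq mult_ac)
      qed
    qed
    then have "(\<lambda>t. u t * e / e) \<longlonglongrightarrow> 0 / e" using e by (intro tendsto_divide tendsto_const)
    then have "u \<longlonglongrightarrow> 0" using e by simp
    then have "(\<lambda>t. x t - of_nat t * 0) \<longlonglongrightarrow> y" by (simp add: u_def LIM_zero_iff)
    moreover have "log_lattice {0} M x"
      unfolding log_lattice_def using fin lat x(1) by (auto elim!: eventually_mono)
    ultimately have "infinite {t. x t = of_nat t * 0 + y}" by (rule log_lattice_linear[rotated])
    then obtain t where "x t = y" using not_finite_existsD by fastforce
    then have "k = 0" using x(1)[of t] Py by simp
    then show ?thesis using Py by blast
  qed
qed

section \<open>The equivalence\<close>

lemma finite_eigval: "finite {x. eigval X x}"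
proof -
  have "{x. eigval X x} = {x. poly (char_poly (mat_of X)) x = 0}"
    by (simp add: eigval_iff_char_fun char_fun_eq_poly)
  moreover have "char_poly (mat_of X) \<noteq> 0" by (simp add: char_poly_mat_of)
  ultimately show ?thesis using poly_roots_finite by metis
qed

lemma eigval_of_exp:
  assumes "exp X * V = sc a V" "V \<noteq> 0"
  obtains x where "eigval X x" "a = exp x"
proof -
  have "exp X * X = X * exp X" by (simp add: exp_commute)
  moreover have "exp X * V = cs a * V" using assms(1) by (simp add: sc_ring)
  ultimately obtain x W where W: "W \<noteq> 0" "exp X * W = cs a * W" "X * W = cs x * W"
    using common_eigen assms(2) by metis
  have "cs (exp x) * W = cs a * W" using exp_eigen[OF W(3)] W(2) by simp
  then have "sc (exp x - a) W = 0" by (simp add: sc_ring)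
  then have "a = exp x" using W(1) by (simp add: sc_eq_0_iff)
  with W show thesis using that by (auto simp: eigval_def)
qed

text \<open>On a common eigenvector of \<open>exp X * exp Y\<close> and \<open>exp Y\<close> both
  exponentials act as scalars. Each scalar is the exponential of an eigenvalue, though the
  eigenvectors of \<open>X\<close> and of \<open>Y\<close> found for it may differ.\<close>

lemma eigval_exp_product:
  assumes "exp (X + Y) = exp X * exp Y" "exp X * exp Y = exp Y * exp X" "eigval (X + Y) z"
  obtains x y where "eigval X x" "eigval Y y" "exp z = exp (x + y)"
proof -
  obtain V where V: "V \<noteq> 0" "(X + Y) * V = cs z * V" using assms(3) by (auto simp: eigval_def)
  have "exp X * exp Y * V = cs (exp z) * V" using exp_eigen[OF V(2)] assms(1) by simp
  moreover have "exp X * exp Y * exp Y = exp Y * (exp X * exp Y)" using assms(2) by (simp add: mult.assoc)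
  ultimately obtain b W where W: "W \<noteq> 0" "exp X * exp Y * W = cs (exp z) * W" "exp Y * W = cs b * W"
    using common_eigen V(1) by metis
  obtain y where y: "eigval Y y" "b = exp y"
    using eigval_of_exp[of Y W b] W by (auto simp: sc_ring)
  have "sc b (exp X * W) = sc (exp z) W" using W(2,3) by (simp add: mult.assoc sc_ring)
  then have "sc (1 / b) (sc b (exp X * W)) = sc (1 / b) (sc (exp z) W)" by simp
  then have "exp X * W = sc (exp z / b) W" using y(2) by (simp add: sc_ring)
  then obtain x where x: "eigval X x" "exp z / b = exp x" using eigval_of_exp W(1) by blast
  have "exp z = exp (x + y)" using x(2) y(2) by (simp add: exp_add field_simps)
  with x(1) y(1) show thesis by (rule that)
qed

lemma eigval_scale: "eigval A x \<longleftrightarrow> eigval (cs t * A) (t * x)" if "t \<noteq> 0"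
proof -
  have "cs t * A * V = cs (t * x) * V \<longleftrightarrow> A * V = cs x * V" for V
  proof
    assume "cs t * A * V = cs (t * x) * V"
    then have "sc (1 / t) (sc t (A * V)) = sc (1 / t) (sc (t * x) V)" by (simp add: sc_ring)
    then show "A * V = cs x * V" using that by (simp add: sc_ring)
  next
    assume "A * V = cs x * V"
    then show "cs t * A * V = cs (t * x) * V" by (simp add: sc_ring)
  qed
  then show ?thesis by (simp add: eigval_def)
qed

section \<open>Linear factors of the characteristic polynomial of a pencil\<close>

lemma char_fun_pencil:
  obtains b3 c3 where "\<And>z x. char_fun (cs z * A + B) x = x ^ 3 - (e1 A * z + e1 B) * x\<^sup>2
    + (e2 A * z\<^sup>2 + (e2 (A + B) - e2 A - e2 B) * z + e2 B) * x - (e3 A * z ^ 3 + b3 * z\<^sup>2 + c3 * z + e3 B)"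
proof -
  obtain b c where bc: "\<And>x y. e3 (cs x * A + cs y * B) = x ^ 3 * e3 A + x\<^sup>2 * y * b + x * y\<^sup>2 * c + y ^ 3 * e3 B"
    using e3_lincomb[of A B] by metis
  show thesis
  proof (rule that)
    fix z x
    have 1: "e1 (cs z * A + B) = e1 A * z + e1 B" using e1_lincomb[of z A 1 B] by simp
    have 2: "e2 (cs z * A + B) = e2 A * z\<^sup>2 + (e2 (A + B) - e2 A - e2 B) * z + e2 B"
      using e2_lincomb[of z A 1 B] by simp
    have 3: "e3 (cs z * A + B) = e3 A * z ^ 3 + b * z\<^sup>2 + c * z + e3 B"
      using bc[of z 1] by (simp add: mult.commute)
    show "char_fun (cs z * A + B) x = x ^ 3 - (e1 A * z + e1 B) * x\<^sup>2
      + (e2 A * z\<^sup>2 + (e2 (A + B) - e2 A - e2 B) * z + e2 B) * x - (e3 A * z ^ 3 + b * z\<^sup>2 + c * z + e3 B)"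
      by (simp only: char_fun_def 1 2 3)
  qed
qed

text \<open>All eigenvalues are constrained at once, so every later choice of a branch is a
  \<open>log_lattice\<close> sequence.\<close>

definition pencil_spectrum_lattice :: "cmat3 \<Rightarrow> cmat3 \<Rightarrow> bool" where
  "pencil_spectrum_lattice A B \<longleftrightarrow> (\<forall>\<^sub>F t :: nat in sequentially. \<forall>x. eigval (cs (of_nat t) * A + B) x \<longrightarrow>
    (\<exists>l\<in>{l. eigval A l}. \<exists>m\<in>{m. eigval B m}. exp x = exp (of_nat t * l + m)))"

text \<open>In size 3 the matrix \<open>A\<close> has a simple eigenvalue or a triple one, so the
  two branch lemmas exhaust all cases.\<close>

lemma linear_branch:
  assumes lat: "pencil_spectrum_lattice A B"
  shows "\<exists>k b. \<forall>z. char_fun (cs z * A + B) (k * z + b) = 0"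
proof -
  obtain b3 c3 where char_fun: "\<And>z x. char_fun (cs z * A + B) x = x ^ 3 - (e1 A * z + e1 B) * x\<^sup>2
    + (e2 A * z\<^sup>2 + (e2 (A + B) - e2 A - e2 B) * z + e2 B) * x - (e3 A * z ^ 3 + b3 * z\<^sup>2 + c3 * z + e3 B)"
    using char_fun_pencil[of A B] by metis
  have roots: "\<exists>r1 r2 r3. \<forall>x. char_fun (cs z * A + B) x = (x - r1) * (x - r2) * (x - r3)" for z
    using char_fun_roots[of "cs z * A + B"] by blast
  obtain p q r where pqr: "e1 A = p + q + r" "e2 A = p * q + p * r + q * r" "e3 A = p * q * r"
    "\<forall>x. char_fun A x = (x - p) * (x - q) * (x - r)"
    using char_fun_roots[of A] by blast
  note lat' = lat[unfolded pencil_spectrum_lattice_def eigval_iff_char_fun[of "_ + _"]]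
  have simple: "\<exists>k b. \<forall>z. char_fun (cs z * A + B) (k * z + b) = 0"
    if "e1 A = k + p + q" "e2 A = k * p + k * q + p * q" "e3 A = k * p * q" "k \<noteq> p" "k \<noteq> q" for k p q
    using simple_eigenvalue_branch[OF that(4,5) finite_eigval[of A] finite_eigval[of B],
        of "e1 B" "e2 (A + B) - e2 A - e2 B" "e2 B" b3 c3 "e3 B"] roots lat'
    unfolding char_fun that(1-3) by blast
  consider "p \<noteq> q" "p \<noteq> r" | "p = q" "r \<noteq> p" | "p = r" "q \<noteq> p" | "p = q" "p = r" by blast
  then show ?thesis
  proof cases
    case 1
    then show ?thesis using pqr by (intro simple[of p q r]) auto
  next
    case 2
    then show ?thesis using pqr by (intro simple[of r p q]) (auto simp: algebra_simps)
  next
    case 3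
    then show ?thesis using pqr by (intro simple[of q p r]) (auto simp: algebra_simps)
  next
    case 4
    have A: "e1 A = 3 * p" "e2 A = 3 * p\<^sup>2" "e3 A = p ^ 3"
      using 4 pqr(1-3) by (simp_all add: power2_eq_square power3_eq_cube)
    have eA: "l = p" if "eigval A l" for l using that 4 pqr(4) by (auto simp: eigval_iff_char_fun)
    define s where "s = e1 B / 3"
    have s: "e1 B = 3 * s" by (simp add: s_def)
    define b2 where "b2 = e2 (A + B) - e2 A - e2 B"
    \<comment> \<open>Coefficients after the shift by \<open>p * z + s\<close>, a third of the
      trace. Because \<open>p\<close> is a triple eigenvalue, the terms \<open>z ^ 2 * y\<close> and
      \<open>z ^ 3\<close> vanish as well.\<close>
    define e f a b c where "e = b2 - 6 * p * s" and "f = e2 B - 3 * s\<^sup>2"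
      and "a = b3 + 3 * p\<^sup>2 * s - b2 * p" and "b = c3 + 6 * p * s\<^sup>2 - b2 * s - e2 B * p"
      and "c = e3 B + 2 * s ^ 3 - e2 B * s"
    have Q: "y ^ 3 + (e * z + f) * y - (a * z\<^sup>2 + b * z + c) = char_fun (cs z * A + B) (y + (p * z + s))" for z y
      unfolding char_fun b2_def[symmetric] unfolding A s e_def f_def a_def b_def c_def
      by (simp add: algebra_simps power2_eq_square power3_eq_cube)
    have "\<exists>y. \<forall>z. y ^ 3 + (e * z + f) * y - (a * z\<^sup>2 + b * z + c) = 0"
    proof (rule depressed_cubic_branch)
      \<comment> \<open>As \<open>p\<close> is the only eigenvalue of \<open>A\<close>, the shift
        cancels all dependence on \<open>t\<close>; the eigenvalues of \<open>B\<close>, moved by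
        \<open>s\<close>, remain.\<close>
      show "finite ((\<lambda>m. m - s) ` {m. eigval B m})" using finite_eigval by blast
      show "\<exists>r1 r2 r3. \<forall>x. x ^ 3 + (e * of_nat t + f) * x - (a * (of_nat t)\<^sup>2 + b * of_nat t + c)
        = (x - r1) * (x - r2) * (x - r3)" for t :: nat
      proof -
        let ?w = "p * of_nat t + s"
        obtain r1 r2 r3 where r: "\<And>x. char_fun (cs (of_nat t) * A + B) x = (x - r1) * (x - r2) * (x - r3)"
          using roots by blast
        have "\<forall>x. char_fun (cs (of_nat t) * A + B) (x + ?w) = (x - (r1 - ?w)) * (x - (r2 - ?w)) * (x - (r3 - ?w))"
          unfolding r by (simp add: algebra_simps)
        then show ?thesis unfolding Q by blast
      qed
      show "\<forall>\<^sub>F t in sequentially. \<forall>x. x ^ 3 + (e * of_nat t + f) * x - (a * (of_nat t)\<^sup>2 + b * of_nat t + c) = 0 \<longrightarrow>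
        (\<exists>m\<in>(\<lambda>m. m - s) ` {m. eigval B m}. exp x = exp m)"
        using lat' unfolding Q
      proof (rule eventually_mono, intro allI impI)
        fix t :: nat and x
        assume t: "\<forall>x. char_fun (cs (of_nat t) * A + B) x = 0 \<longrightarrow>
            (\<exists>l\<in>{l. eigval A l}. \<exists>m\<in>{m. eigval B m}. exp x = exp (of_nat t * l + m))"
          and x: "char_fun (cs (of_nat t) * A + B) (x + (p * of_nat t + s)) = 0"
        obtain l m where lm: "eigval A l" "eigval B m" "exp (x + (p * of_nat t + s)) = exp (of_nat t * l + m)"
          using t x by blast
        have "exp x = exp (x + (p * of_nat t + s)) * exp (- (p * of_nat t + s))"
          by (simp flip: exp_add)
        also have "\<dots> = exp (m - s)"
          unfolding lm(3) eA[OF lm(1)] by (simp add: mult.commute flip: exp_add)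
        finally show "\<exists>m\<in>(\<lambda>m. m - s) ` {m. eigval B m}. exp x = exp m" using lm(2) by blast
      qed
    qed
    then obtain y where y: "\<And>z. char_fun (cs z * A + B) (y + (p * z + s)) = 0" unfolding Q by blast
    have "char_fun (cs z * A + B) (p * z + (y + s)) = 0" for z using y[of z] by (simp add: add_ac)
    then show ?thesis by blast
  qed
qed

text \<open>Property L through symmetric functions, which fix the eigenvalues with multiplicity and
  require no ordering of the roots at each \<open>(x, y)\<close>.\<close>

definition symmetric_linear :: "cmat3 \<Rightarrow> cmat3 \<Rightarrow> (nat \<Rightarrow> complex) \<Rightarrow> (nat \<Rightarrow> complex) \<Rightarrow> bool" where
  "symmetric_linear A B l m \<longleftrightarrow> (\<forall>x y. let r = (\<lambda>i. x * l i + y * m i); C = cs x * A + cs y * B in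
    e1 C = r 0 + r 1 + r 2 \<and> e2 C = r 0 * r 1 + r 0 * r 2 + r 1 * r 2 \<and> e3 C = r 0 * r 1 * r 2)"

text \<open>The identities at \<open>y = 1\<close> are polynomial in \<open>z\<close>; comparing
  coefficients makes them homogeneous, so that \<open>y = 0\<close> is covered.\<close>

lemma symmetric_linear_homogenize:
  assumes "\<And>z. e1 (cs z * A + B) = (z * l 0 + m 0) + (z * l 1 + m 1) + (z * l 2 + m 2)"
    and "\<And>z. e2 (cs z * A + B) = (z * l 0 + m 0) * (z * l 1 + m 1) + (z * l 0 + m 0) * (z * l 2 + m 2)
      + (z * l 1 + m 1) * (z * l 2 + m 2)"
    and "\<And>z. e3 (cs z * A + B) = (z * l 0 + m 0) * (z * l 1 + m 1) * (z * l 2 + m 2)"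
  shows "symmetric_linear A B l m"
proof -
  obtain b c where bc: "\<And>x y. e3 (cs x * A + cs y * B) = x ^ 3 * e3 A + x\<^sup>2 * y * b + x * y\<^sup>2 * c + y ^ 3 * e3 B"
    using e3_lincomb[of A B] by metis
  have B: "e1 B = m 0 + m 1 + m 2" "e2 B = m 0 * m 1 + m 0 * m 2 + m 1 * m 2" "e3 B = m 0 * m 1 * m 2"
    using assms[of 0] by simp_all
  have A1: "e1 A = l 0 + l 1 + l 2"
    using assms(1)[of 1] e1_lincomb[of 1 A 1 B] by (simp add: B algebra_simps)
  define \<beta> where "\<beta> = e2 (A + B) - e2 A - e2 B"
  have e2: "e2 (cs z * A + B) = z\<^sup>2 * e2 A + z * \<beta> + e2 B" for z
    using e2_lincomb[of z A 1 B] by (simp add: \<beta>_def)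
  have e3: "e3 (cs z * A + B) = z ^ 3 * e3 A + z\<^sup>2 * b + z * c + e3 B" for z
    using bc[of z 1] by simp
  have inf: "infinite (UNIV :: nat set)" by simp
  have "(e2 A - (l 0 * l 1 + l 0 * l 2 + l 1 * l 2)) * z\<^sup>2
    + (\<beta> - (l 0 * m 1 + m 0 * l 1 + l 0 * m 2 + m 0 * l 2 + l 1 * m 2 + m 1 * l 2)) * z + 0 = 0" for z
    using assms(2)[of z] unfolding e2 B
    by (simp add: algebra_simps power2_eq_square)
  then have "{t :: nat. (e2 A - (l 0 * l 1 + l 0 * l 2 + l 1 * l 2)) * (of_nat t)\<^sup>2
    + (\<beta> - (l 0 * m 1 + m 0 * l 1 + l 0 * m 2 + m 0 * l 2 + l 1 * m 2 + m 1 * l 2)) * of_nat t + 0 = 0} = UNIV"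
    by blast
  from quadratic_identically_zero(1,2)[OF inf[folded this]]
  have A2: "e2 A = l 0 * l 1 + l 0 * l 2 + l 1 * l 2"
    and \<beta>: "\<beta> = l 0 * m 1 + m 0 * l 1 + l 0 * m 2 + m 0 * l 2 + l 1 * m 2 + m 1 * l 2" by simp_all
  have "(e3 A - l 0 * l 1 * l 2) * z ^ 3 + (b - (l 0 * l 1 * m 2 + l 0 * m 1 * l 2 + m 0 * l 1 * l 2)) * z\<^sup>2
    + (c - (l 0 * m 1 * m 2 + m 0 * l 1 * m 2 + m 0 * m 1 * l 2)) * z + 0 = 0" for z
    using assms(3)[of z] unfolding e3 B
    by (simp add: algebra_simps power2_eq_square power3_eq_cube)
  then have "{t :: nat. (e3 A - l 0 * l 1 * l 2) * of_nat t ^ 3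
    + (b - (l 0 * l 1 * m 2 + l 0 * m 1 * l 2 + m 0 * l 1 * l 2)) * (of_nat t)\<^sup>2
    + (c - (l 0 * m 1 * m 2 + m 0 * l 1 * m 2 + m 0 * m 1 * l 2)) * of_nat t + 0 = 0} = UNIV"
    by blast
  from cubic_identically_zero(1-3)[OF inf[folded this]]
  have A3: "e3 A = l 0 * l 1 * l 2"
    and b: "b = l 0 * l 1 * m 2 + l 0 * m 1 * l 2 + m 0 * l 1 * l 2"
    and c: "c = l 0 * m 1 * m 2 + m 0 * l 1 * m 2 + m 0 * m 1 * l 2" by simp_all
  have "e1 (cs x * A + cs y * B) = x * (l 0 + l 1 + l 2) + y * (m 0 + m 1 + m 2)" for x y
    unfolding e1_lincomb A1 B ..
  moreover have "e2 (cs x * A + cs y * B) = (x * l 0 + y * m 0) * (x * l 1 + y * m 1)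
    + (x * l 0 + y * m 0) * (x * l 2 + y * m 2) + (x * l 1 + y * m 1) * (x * l 2 + y * m 2)" for x y
    unfolding e2_lincomb \<beta>_def[symmetric] unfolding \<beta> A2 B by (simp add: algebra_simps power2_eq_square)
  moreover have "e3 (cs x * A + cs y * B) = (x * l 0 + y * m 0) * (x * l 1 + y * m 1) * (x * l 2 + y * m 2)" for x y
    unfolding bc A3 b c B by (simp add: algebra_simps power2_eq_square power3_eq_cube)
  ultimately show ?thesis unfolding symmetric_linear_def Let_def by (simp add: algebra_simps)
qed

lemma lattice_imp_symmetric_linear:
  assumes lat: "pencil_spectrum_lattice A B"
  shows "\<exists>l m. symmetric_linear A B l m"
proof -
  obtain k b where kb: "\<And>z. char_fun (cs z * A + B) (k * z + b) = 0" using linear_branch[OF lat] by blast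
  \<comment> \<open>These come from division by the linear factor \<open>x - (k * z + b)\<close>;
    the quotient is \<open>x ^ 2 - p z * x + q z\<close>.\<close>
  define p1 p0 where "p1 = e1 A - k" and "p0 = e1 B - b"
  define \<beta> where "\<beta> = e2 (A + B) - e2 A - e2 B"
  define q2 q1 q0 where "q2 = e2 A - k * p1" and "q1 = \<beta> - k * p0 - b * p1" and "q0 = e2 B - b * p0"
  define p q where "p = (\<lambda>z. p1 * z + p0)" and "q = (\<lambda>z. q2 * z\<^sup>2 + q1 * z + q0)"
  have E1: "e1 (cs z * A + B) = (k * z + b) + p z" for z
    using e1_lincomb[of z A 1 B] by (simp add: p_def p1_def p0_def algebra_simps)
  have E2: "e2 (cs z * A + B) = (k * z + b) * p z + q z" for z
    using e2_lincomb[of z A 1 B] unfolding \<beta>_def[symmetric]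
    by (simp add: p_def q_def q2_def q1_def q0_def algebra_simps power2_eq_square)
  have E3: "e3 (cs z * A + B) = (k * z + b) * q z" for z
    using kb[of z] unfolding char_fun_def E1 E2 by (simp add: algebra_simps power2_eq_square power3_eq_cube)
  have fac: "char_fun (cs z * A + B) x = (x - (k * z + b)) * (x\<^sup>2 - p z * x + q z)" for z x
    unfolding char_fun_def E1 E2 E3 by (simp add: algebra_simps power2_eq_square power3_eq_cube)
  define d2 d1 d0 where "d2 = p1\<^sup>2 - 4 * q2" and "d1 = 2 * p1 * p0 - 4 * q1" and "d0 = p0\<^sup>2 - 4 * q0"
  have disc: "d2 * z\<^sup>2 + d1 * z + d0 = (p z)\<^sup>2 - 4 * q z" for z
    by (simp add: d2_def d1_def d0_def p_def q_def algebra_simps power2_eq_square)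
  have "\<exists>k c. \<forall>z. d2 * z\<^sup>2 + d1 * z + d0 = (k * z + c)\<^sup>2"
  proof (rule discriminant_is_square)
    fix y :: "nat \<Rightarrow> complex" assume y: "\<And>t. (y t)\<^sup>2 = d2 * (of_nat t)\<^sup>2 + d1 * of_nat t + d0"
    \<comment> \<open>The quadratic formula: every choice of square roots of the discriminant gives
      eigenvalues.\<close>
    have "eigval (cs (of_nat t) * A + B) ((p1 * of_nat t + p0 + y t) / 2)" for t
    proof -
      let ?x = "(p (of_nat t) + y t) / 2"
      have "4 * (?x\<^sup>2 - p (of_nat t) * ?x + q (of_nat t)) = (y t)\<^sup>2 - ((p (of_nat t))\<^sup>2 - 4 * q (of_nat t))"
        by (simp add: field_simps power2_eq_square)
      also have "\<dots> = 0" unfolding y disc by simp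
      finally have "?x\<^sup>2 - p (of_nat t) * ?x + q (of_nat t) = 0" by (simp only: mult_eq_0_iff) simp
      then have "char_fun (cs (of_nat t) * A + B) ?x = 0" by (simp only: fac mult_zero_right)
      then show ?thesis by (simp add: eigval_iff_char_fun p_def)
    qed
    then show "log_lattice {l. eigval A l} {m. eigval B m} (\<lambda>t. (p1 * of_nat t + p0 + y t) / 2)"
      unfolding log_lattice_def using lat[unfolded pencil_spectrum_lattice_def] finite_eigval
      by (auto elim!: eventually_mono)
  qed
  then obtain \<kappa> c where \<kappa>: "\<And>z. d2 * z\<^sup>2 + d1 * z + d0 = (\<kappa> * z + c)\<^sup>2" by blast
  have sq: "4 * q z = (p z)\<^sup>2 - (\<kappa> * z + c)\<^sup>2" for z
    unfolding \<kappa>[symmetric] disc by simp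
  \<comment> \<open>Index 0 is the branch already split off; 1 and 2 are the roots of the quadratic
    factor, linear now that its discriminant is a square.\<close>
  define l where "l = (\<lambda>i::nat. if i = 0 then k else if i = 1 then (p1 + \<kappa>) / 2 else (p1 - \<kappa>) / 2)"
  define m where "m = (\<lambda>i::nat. if i = 0 then b else if i = 1 then (p0 + c) / 2 else (p0 - c) / 2)"
  have lm: "z * l 0 + m 0 = k * z + b" "z * l 1 + m 1 = (p z + (\<kappa> * z + c)) / 2"
    "z * l 2 + m 2 = (p z - (\<kappa> * z + c)) / 2" for z
    by (simp_all add: l_def m_def p_def field_simps)
  have q: "q z = ((p z + (\<kappa> * z + c)) / 2) * ((p z - (\<kappa> * z + c)) / 2)" for z
  proof -
    have "4 * q z = 4 * (((p z + (\<kappa> * z + c)) / 2) * ((p z - (\<kappa> * z + c)) / 2))"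
      unfolding sq by (simp add: field_simps power2_eq_square)
    then show ?thesis by (simp only: mult_cancel_left) simp
  qed
  have p: "p z = (p z + (\<kappa> * z + c)) / 2 + (p z - (\<kappa> * z + c)) / 2" for z by (simp add: field_simps)
  have "symmetric_linear A B l m"
  proof (rule symmetric_linear_homogenize)
    fix z
    define w v where "w = (p z + (\<kappa> * z + c)) / 2" and "v = (p z - (\<kappa> * z + c)) / 2"
    have pw: "p z = w + v" unfolding w_def v_def by (rule p)
    have qw: "q z = w * v" unfolding w_def v_def by (rule q)
    show "e1 (cs z * A + B) = (z * l 0 + m 0) + (z * l 1 + m 1) + (z * l 2 + m 2)"
      unfolding E1 lm w_def[symmetric] v_def[symmetric] unfolding pw by simp
    show "e2 (cs z * A + B) = (z * l 0 + m 0) * (z * l 1 + m 1) + (z * l 0 + m 0) * (z * l 2 + m 2)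
      + (z * l 1 + m 1) * (z * l 2 + m 2)"
      unfolding E2 lm w_def[symmetric] v_def[symmetric] unfolding pw qw by (simp add: distrib_left)
    show "e3 (cs z * A + B) = (z * l 0 + m 0) * (z * l 1 + m 1) * (z * l 2 + m 2)"
      unfolding E3 lm w_def[symmetric] v_def[symmetric] unfolding qw by (simp add: mult.assoc)
  qed
  then show ?thesis by blast
qed

section \<open>Passage between symmetric functions and property L\<close>

lemma mat_of_cs_mult: "mat_of (cs z * X) = z \<cdot>\<^sub>m mat_of X"
  using mat_of[of X] by (intro eq_matI) (auto simp: times_cmat3.rep_eq cs.rep_eq)

lemma mat_of_lincomb: "mat_of (cs x * A + cs y * B) = x \<cdot>\<^sub>m mat_of A + y \<cdot>\<^sub>m mat_of B"
  by (simp add: plus_cmat3.rep_eq mat_of_cs_mult)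

lemma symmetric_linear_imp_property_L:
  assumes "symmetric_linear A B l m"
  shows "property_L 3 (mat_of A) (mat_of B)"
proof -
  have ev: "eigenvalues_mset (mat_of (cs x * A + cs y * B)) = mset (map (\<lambda>i. x * l i + y * m i) [0..<3])" for x y
  proof -
    define r where "r = (\<lambda>i. x * l i + y * m i)"
    have e: "e1 (cs x * A + cs y * B) = r 0 + r 1 + r 2"
      "e2 (cs x * A + cs y * B) = r 0 * r 1 + r 0 * r 2 + r 1 * r 2"
      "e3 (cs x * A + cs y * B) = r 0 * r 1 * r 2"
      using assms unfolding symmetric_linear_def Let_def r_def by blast+
    have "char_poly (mat_of (cs x * A + cs y * B)) = [:- r 0, 1:] * ([:- r 1, 1:] * [:- r 2, 1:])"
      unfolding char_poly_mat_of e by (simp add: algebra_simps)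
    also have "proots \<dots> = {#r 0, r 1, r 2#}" by (simp add: proots_mult del: mult_pCons_left mult_pCons_right)
    finally show ?thesis
      unfolding eigenvalues_mset_def r_def by (simp add: numeral_3_eq_3 upt_rec numeral_2_eq_2)
  qed
  have list: "map (\<lambda>i. x * map l [0..<3] ! i + y * map m [0..<3] ! i) [0..<3] = map (\<lambda>i. x * l i + y * m i) [0..<3]" for x y
    by simp
  \<comment> \<open>The orderings for \<open>A\<close> and \<open>B\<close> are read off from the
    pencil at \<open>(1, 0)\<close> and \<open>(0, 1)\<close>.\<close>
  have A: "mat_of A = mat_of (cs 1 * A + cs 0 * B)" and B: "mat_of B = mat_of (cs 0 * A + cs 1 * B)" by simp_all
  show ?thesis
    unfolding property_L_def
  proof (intro exI conjI allI)
    show "mset (map l [0..<3]) = eigenvalues_mset (mat_of A)" unfolding A ev by simp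
    show "mset (map m [0..<3]) = eigenvalues_mset (mat_of B)" unfolding B ev by simp
    show "eigenvalues_mset (x \<cdot>\<^sub>m mat_of A + y \<cdot>\<^sub>m mat_of B)
      = mset (map (\<lambda>i. x * map l [0..<3] ! i + y * map m [0..<3] ! i) [0..<3])" for x y
      unfolding list ev[symmetric] mat_of_lincomb ..
  qed simp_all
qed

lemma property_L_imp_linear_spectrum:
  assumes "property_L 3 (mat_of A) (mat_of B)"
  shows "\<exists>l m. linear_spectrum A B l m"
proof -
  obtain ls ms where L: "\<And>x y. eigenvalues_mset (x \<cdot>\<^sub>m mat_of A + y \<cdot>\<^sub>m mat_of B)
    = mset (map (\<lambda>i. x * ls ! i + y * ms ! i) [0..<3])"
    using assms unfolding property_L_def by blast
  have "eigval (cs x * A + cs y * B) z \<longleftrightarrow> (\<exists>i<3. z = x * ls ! i + y * ms ! i)" for x y z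
  proof -
    let ?p = "char_poly (mat_of (cs x * A + cs y * B))"
    have "?p \<noteq> 0" by (simp add: char_poly_mat_of)
    then have "eigval (cs x * A + cs y * B) z \<longleftrightarrow> z \<in># proots ?p"
      by (simp add: eigval_iff_char_fun char_fun_eq_poly)
    also have "\<dots> \<longleftrightarrow> z \<in># mset (map (\<lambda>i. x * ls ! i + y * ms ! i) [0..<3])"
      using L[of x y] by (simp only: eigenvalues_mset_def mat_of_lincomb)
    also have "\<dots> \<longleftrightarrow> (\<exists>i<3. z = x * ls ! i + y * ms ! i)" by (auto simp del: upt_rec_numeral upt_Suc)
    finally show ?thesis .
  qed
  then show ?thesis unfolding linear_spectrum_def by blast
qed

theorem theorem2:
  fixes A B :: "complex mat"
  assumes "A \<in> carrier_mat 3 3" and "B \<in> carrier_mat 3 3"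
  shows "(\<exists>U :: nat set. finite U \<and> U \<subseteq> {n. n \<ge> 2} \<and>
            (\<forall>t. t \<ge> 1 \<and> t \<notin> U \<longrightarrow>
               mat_exp (of_nat t \<cdot>\<^sub>m A + B) = mat_exp (of_nat t \<cdot>\<^sub>m A) * mat_exp B \<and>
               mat_exp (of_nat t \<cdot>\<^sub>m A) * mat_exp B = mat_exp B * mat_exp (of_nat t \<cdot>\<^sub>m A)))
         \<longleftrightarrow>
         (mat_exp (A + B) = mat_exp A * mat_exp B \<and>
          mat_exp A * mat_exp B = mat_exp B * mat_exp A \<and>
          property_L 3 A B)"
proof -
  obtain X Y where XY: "A = mat_of X" "B = mat_of Y"
    using assms cmat_inverse by metis
  define good where "good = (\<lambda>t :: nat. exp (cs (of_nat t) * X + Y) = exp (cs (of_nat t) * X) * exp Y)"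
  define com where "com = (\<lambda>t :: nat. exp (cs (of_nat t) * X) * exp Y = exp Y * exp (cs (of_nat t) * X))"
  have iff: "mat_exp (of_nat t \<cdot>\<^sub>m A + B) = mat_exp (of_nat t \<cdot>\<^sub>m A) * mat_exp B \<longleftrightarrow> good t"
    "mat_exp (of_nat t \<cdot>\<^sub>m A) * mat_exp B = mat_exp B * mat_exp (of_nat t \<cdot>\<^sub>m A) \<longleftrightarrow> com t" for t
    unfolding XY mat_of_cs_mult[symmetric] plus_cmat3.rep_eq[symmetric] mat_of_exp[symmetric] times_cmat3.rep_eq[symmetric]
      mat_of_inject good_def com_def by (rule refl)+
  have one: "mat_exp (A + B) = mat_exp A * mat_exp B \<longleftrightarrow> exp (X + Y) = exp X * exp Y"
    "mat_exp A * mat_exp B = mat_exp B * mat_exp A \<longleftrightarrow> exp X * exp Y = exp Y * exp X"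
    unfolding XY plus_cmat3.rep_eq[symmetric] mat_of_exp[symmetric] times_cmat3.rep_eq[symmetric]
      mat_of_inject by (rule refl)+
  have good1: "good 1 \<longleftrightarrow> exp (X + Y) = exp X * exp Y" "com 1 \<longleftrightarrow> exp X * exp Y = exp Y * exp X"
    by (simp_all add: good_def com_def)
  show ?thesis
    unfolding iff one
  proof (intro iffI conjI)
    assume "\<exists>U. finite U \<and> U \<subseteq> {n. n \<ge> 2} \<and> (\<forall>t. t \<ge> 1 \<and> t \<notin> U \<longrightarrow> good t \<and> com t)"
    then obtain U where U: "finite U" "U \<subseteq> {n. n \<ge> 2}" "\<And>t. t \<ge> 1 \<Longrightarrow> t \<notin> U \<Longrightarrow> good t \<and> com t" by blast
    have "1 \<notin> U" using U(2) by auto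
    then show "exp (X + Y) = exp X * exp Y" "exp X * exp Y = exp Y * exp X"
      using U(3)[of 1] good1 by auto
    have "\<forall>\<^sub>F t in sequentially. t \<notin> U"
      using U(1) by (simp add: eventually_cofinite flip: cofinite_eq_sequentially)
    then have "pencil_spectrum_lattice X Y"
      unfolding pencil_spectrum_lattice_def using eventually_ge_at_top[of 1]
    proof eventually_elim
      case (elim t)
      then have gc: "good t" "com t" using U(3) by auto
      show ?case
      proof (intro allI impI)
        fix x assume "eigval (cs (of_nat t) * X + Y) x"
        then obtain l' m where lm: "eigval (cs (of_nat t) * X) l'" "eigval Y m" "exp x = exp (l' + m)"
          using eigval_exp_product gc unfolding good_def com_def by metis
        have t: "of_nat t \<noteq> (0 :: complex)" using elim by simp
        have "eigval X (l' / of_nat t)" using lm(1) eigval_scale[OF t, of X "l' / of_nat t"] t by simp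
        with lm t show "\<exists>l\<in>{l. eigval X l}. \<exists>m\<in>{m. eigval Y m}. exp x = exp (of_nat t * l + m)"
          by (intro bexI[of _ "l' / of_nat t"] bexI[of _ m]) auto
      qed
    qed
    then show "property_L 3 A B"
      using lattice_imp_symmetric_linear symmetric_linear_imp_property_L unfolding XY by blast
  next
    assume r: "exp (X + Y) = exp X * exp Y \<and> exp X * exp Y = exp Y * exp X \<and> property_L 3 A B"
    then obtain l m where "linear_spectrum X Y l m"
      using property_L_imp_linear_spectrum unfolding XY by blast
    then have fin: "finite {t. \<not> good t}"
      using exp_pencil_linear_spectrum r unfolding good_def by blast
    \<comment> \<open>\<open>exp (t * X)\<close> is the power \<open>exp X ^ t\<close>, so
      commutation holds for every \<open>t\<close>; only the product formula can fail.\<close>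
    have com: "com t" for t
      unfolding com_def exp_of_nat_cs using r by (intro commute_power) simp
    \<comment> \<open>The exceptional set starts at 2: at \<open>t = 1\<close> the product formula
      is the hypothesis, and \<open>t = 0\<close> lies outside the quantifier.\<close>
    have "{t. \<not> good t \<and> t \<ge> 2} \<subseteq> {n. n \<ge> 2}" by blast
    moreover have "finite {t. \<not> good t \<and> t \<ge> 2}" using fin by (rule rev_finite_subset) blast
    moreover have "good t \<and> com t" if "t \<ge> 1 \<and> t \<notin> {t. \<not> good t \<and> t \<ge> 2}" for t
    proof (cases "t = 1")
      case True
      then show ?thesis using good1 r by simp
    next
      case False
      then show ?thesis using that com by auto
    qed
    ultimately show "\<exists>U. finite U \<and> U \<subseteq> {n. n \<ge> 2} \<and> (\<forall>t. t \<ge> 1 \<and> t \<notin> U \<longrightarrow> good t \<and> com t)" by blast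
  qed
qed

end
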